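(* Let $r:\check K^*\to\mathfrak g\wedge\mathfrak g$ be a (possibly zero) triangular Poisson-Lie dynamical $r$-matrix for $K\subseteq G$. Let $H\subset K$ be a connected Poisson-Lie subgroup with Lie algebra $\mathfrak h$, and let $\mathfrak k=\mathfrak h+\mathfrak m$ be a vector space direct sum such that, with $\mathfrak h^*:=\mathfrak m^\perp$ and $\mathfrak m^*:=\mathfrak h^\perp$ in $\mathfrak k^*$: $\mathfrak h^*\subset\mathfrak k^*$ is a Lie subalgebra, $\mathfrak h^\perp\subset\mathfrak k^*$ is a Lie ideal, and $[\mathfrak h,\mathfrak m]\subset\mathfrak m$. Let $\{M^i\}$ be a basis of $\mathfrak m$ and let $H^*\subset K^*$ be the connected Lie subgroup with Lie algebra $\mathfrak h^*$. Suppose that $$C^{ij}(\lambda)=\langle\langle(\lambda M^j\lambda^{-1})_{\mathfrak m^*},(\lambda M^i\lambda^{-1})_{\mathfrak m}\rangle\rangle$$ defines a non-degenerate matrix function on a non-empty open submanifold $\check H^*$ of $H^*\cap\check K^*$ (open in $H^*$). Then $r^*:\check H^*\to\mathfrak g\wedge\mathfrak g$, $$r^*(\lambda)=r(\lambda)+\sum_{i,j}(C^{-1}(\lambda))_{ij}\,(\lambda M^i\lambda^{-1})_{\mathfrak m}\otimes(\lambda M^j\lambda^{-1})_{\mathfrak m},$$ is a triangular Poisson-Lie dynamical $r$-matrix for $H\subset G$.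
   Context: **Group $G$ and constant $r$-matrix.** $G$ is a connected Poisson-Lie group of coboundary type with Lie algebra $\mathfrak g$. Its Poisson bracket is $\{g_1,g_2\}_G=[g_1g_2,R]$ (tensor notation), where $R\in\mathfrak g\wedge\mathfrak g$ satisfies $[R_{12},R_{13}]+[R_{12},R_{23}]+[R_{13},R_{23}]=\mathcal I_R$ with a $G$-invariant $\mathcal I_R\in\mathfrak g\wedge\mathfrak g\wedge\mathfrak g$. $K\subseteq G$ is a connected Poisson-Lie subgroup with Lie algebra $\mathfrak k$, $K^*$ is the dual Poisson-Lie group with Lie algebra $\mathfrak k^*$, and $\check K^*\subset K^*$ is an open submanifold. Functions are "admissible", meaning smooth or meromorphic. **Drinfeld double.** $\mathcal D(\mathfrak k,\mathfrak k^* )=\mathfrak k+\mathfrak k^*$ is the Drinfeld double Lie algebra with its invariant scalar product $\langle\langle\ ,\ \rangle\rangle$ ($\mathfrak k$ and $\mathfrak k^*$ are isotropic and paired by the canonical pairing $\langle\ ,\ \rangle$). $D(K,K^* )$ is the Drinfeld double Lie group, containing $K$ and $K^*$ as Lie subgroups. For $\kappa\in K^*$ and $X\in\mathcal D(\mathfrak k,\mathfrak k^* )$, $\kappa X\kappa^{-1}$ means $\mathrm{Ad}_\kappa X$ in $D(K,K^* )$. For a subspace $V\subset\mathfrak k$, $V^\perp=\{\alpha\in\mathfrak k^*\mid\langle\alpha,X\rangle=0\ \forall X\in V\}$. In the decomposition $\mathcal D(\mathfrak k,\mathfrak k^* )=\mathfrak h+\mathfrak m+\mathfrak h^*+\mathfrak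 m^*$, and similarly in $\mathfrak k+\mathfrak k^*$, a subscript such as $(\,\cdot\,)_{\mathfrak m}$, $(\,\cdot\,)_{\mathfrak m^*}$, $(\,\cdot\,)_{\mathfrak k^*}$ denotes the corresponding component. **Triangular Poisson-Lie dynamical $r$-matrix for $K\subseteq G$.** The infinitesimal left dressing action of $X\in\mathfrak k$ on $K^*$ is $\mathrm{dress}_X\kappa=\kappa(\kappa^{-1}X\kappa)_{\mathfrak k^*}$; $\mathrm{dress}_Xr$ denotes the derivative of $r$ along this vector field. For $\alpha\in\mathfrak k^*$, $(\mathcal L_\alpha f)(\kappa)=\frac{d}{dt}f(e^{t\alpha}\kappa)|_{t=0}$. A triangular Poisson-Lie dynamical $r$-matrix for $K\subseteq G$ is an admissible map $r:\check K^*\to\mathfrak g\wedge\mathfrak g$ satisfying $\mathrm{dress}_Xr=[X\otimes1+1\otimes X,r]$ for all $X\in\mathfrak k$ and $$[R_{12}+r_{12},R_{23}+r_{23}]+K^a_1\mathcal L_{K_a}r_{23}+\text{cyclic permutations}=\mathcal I_R,$$ where $\{K^a\}\subset\mathfrak k$ and $\{K_a\}\subset\mathfrak k^*$ are dual bases and summation over $a$ is understood. **The notion for $H\subset G$.** This is the same definition with $(K,\check K^* )$ replaced by $(H,\check H^* )$. Here $H^*$, as dual Poisson-Lie group of $H$, is identified with the connected subgroup of $K^*$ with Lie algebra $\mathfrak h^*=\mathfrak m^\perp\cong\mathfrak k^*/\mathfrak h^\perp$, and the double used is $\mathcal D(\mathfrak h,\mathfrak h^* )$. *)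

theory Defs
  imports "HOL-Analysis.Analysis" "HOL-Algebra.Group"
begin

text \<open>
  The ground field is a type \<open>'k\<close> of sort \<open>{real_normed_field, euclidean_space}\<close>.  A finite-dimensional
  real normed field is isomorphic to the reals or to the complex numbers, so the real smooth and the
  complex analytic category are treated at once.  Finite-dimensional vector spaces over \<open>'k\<close> carry
  a fixed basis and are written \<open>'k^'n\<close>; \<open>V \<otimes> V\<close> is \<open>'k^'n^'n\<close>, where \<open>T $ i $ j\<close> is
  the coefficient of \<open>e\<^sub>i \<otimes> e\<^sub>j\<close>, and similarly for \<open>V \<otimes> V \<otimes> V\<close>.
\<close>

section \<open>Smooth functions and manifolds over the ground field\<close>

text \<open>The derivative is required to be linear over \<open>'k\<close>; for the complex numbers
  \<open>Ck_on (Suc r)\<close> therefore means holomorphic.\<close>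

primrec Ck_on ::
  "nat \<Rightarrow> ('k::{real_normed_field,euclidean_space}^'n) set \<Rightarrow> ('k^'n \<Rightarrow> 'k) \<Rightarrow> bool" where
  "Ck_on 0 S f \<longleftrightarrow> continuous_on S f"
| "Ck_on (Suc r) S f \<longleftrightarrow>
     (\<exists>g :: 'k^'n \<Rightarrow> 'k^'n.
        (\<forall>x\<in>S. (f has_derivative (\<lambda>h. \<Sum>i\<in>UNIV. g x $ i * h $ i)) (at x)) \<and>
        (\<forall>i. Ck_on r S (\<lambda>x. g x $ i)))"

definition smooth_scalar_on ::
  "('k::{real_normed_field,euclidean_space}^'n) set \<Rightarrow> ('k^'n \<Rightarrow> 'k) \<Rightarrow> bool" where
  "smooth_scalar_on S f \<longleftrightarrow> (\<forall>r. Ck_on r S f)"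

definition smooth_vec_on ::
  "('k::{real_normed_field,euclidean_space}^'n) set \<Rightarrow> ('k^'n \<Rightarrow> 'k^'m) \<Rightarrow> bool" where
  "smooth_vec_on S f \<longleftrightarrow> (\<forall>j. smooth_scalar_on S (\<lambda>x. f x $ j))"

type_synonym ('a, 'k, 'n) atl = "('a set \<times> ('a \<Rightarrow> 'k^'n)) set"

definition mfd_top ::
  "('a, 'k::{real_normed_field,euclidean_space}, 'n::finite) atl \<Rightarrow> 'a topology" where
  "mfd_top A = topology (\<lambda>S. S \<subseteq> \<Union>(fst ` A) \<and> (\<forall>(U, \<phi>)\<in>A. open (\<phi> ` (S \<inter> U))))"

definition smooth_manifold ::
  "'a set \<Rightarrow> ('a, 'k::{real_normed_field,euclidean_space}, 'n::finite) atl \<Rightarrow> bool" where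
  "smooth_manifold M A \<longleftrightarrow>
     \<Union>(fst ` A) = M \<and>
     (\<forall>(U, \<phi>)\<in>A. inj_on \<phi> U \<and> open (\<phi> ` U)) \<and>
     (\<forall>(U, \<phi>)\<in>A. \<forall>(V, \<psi>)\<in>A.
        open (\<phi> ` (U \<inter> V)) \<and> smooth_vec_on (\<phi> ` (U \<inter> V)) (\<psi> \<circ> inv_into U \<phi>)) \<and>
     Hausdorff_space (mfd_top A) \<and> second_countable (mfd_top A)"

definition smooth_fun ::
  "('a, 'k::{real_normed_field,euclidean_space}, 'n::finite) atl \<Rightarrow> 'a set \<Rightarrow> ('a \<Rightarrow> 'k) \<Rightarrow> bool" where
  "smooth_fun A S f \<longleftrightarrow> (\<forall>(U, \<phi>)\<in>A. smooth_scalar_on (\<phi> ` (S \<inter> U)) (f \<circ> inv_into U \<phi>))"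

text \<open>For open \<open>S\<close>; the openness condition amounts to the continuity of \<open>f\<close>.\<close>

definition smooth_map ::
  "('a, 'k::{real_normed_field,euclidean_space}, 'n::finite) atl \<Rightarrow> 'a set \<Rightarrow> ('b, 'k, 'm::finite) atl
    \<Rightarrow> ('a \<Rightarrow> 'b) \<Rightarrow> bool" where
  "smooth_map A S B f \<longleftrightarrow>
     f ` S \<subseteq> \<Union>(fst ` B) \<and>
     (\<forall>(U, \<phi>)\<in>A. \<forall>(V, \<psi>)\<in>B.
        open (\<phi> ` (S \<inter> U \<inter> f -` V)) \<and>
        smooth_vec_on (\<phi> ` (S \<inter> U \<inter> f -` V)) (\<psi> \<circ> f \<circ> inv_into U \<phi>))"

definition vjoin :: "'k^'n \<Rightarrow> 'k^'m \<Rightarrow> 'k^('n::finite + 'm::finite)" where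
  "vjoin x y = (\<chi> i. case i of Inl a \<Rightarrow> x $ a | Inr b \<Rightarrow> y $ b)"

definition vfst :: "'k^('n::finite + 'm::finite) \<Rightarrow> 'k^'n" where
  "vfst z = (\<chi> a. z $ Inl a)"

definition vsnd :: "'k^('n::finite + 'm::finite) \<Rightarrow> 'k^'m" where
  "vsnd z = (\<chi> b. z $ Inr b)"

definition prod_atlas ::
  "('a, 'k, 'n::finite) atl \<Rightarrow> ('b, 'k, 'm::finite) atl \<Rightarrow> ('a \<times> 'b, 'k, 'n + 'm) atl" where
  "prod_atlas A B = {(U \<times> V, \<lambda>(x, y). vjoin (\<phi> x) (\<psi> y)) | U \<phi> V \<psi>. (U, \<phi>) \<in> A \<and> (V, \<psi>) \<in> B}"

subsection \<open>Admissible functions\<close>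

definition smooth_at ::
  "('a, 'k::{real_normed_field,euclidean_space}, 'n::finite) atl \<Rightarrow> ('a \<Rightarrow> 'k) \<Rightarrow> 'a \<Rightarrow> bool" where
  "smooth_at A f x \<longleftrightarrow> (\<exists>W. openin (mfd_top A) W \<and> x \<in> W \<and> smooth_fun A W f)"

text \<open>A meromorphic function is locally a quotient of holomorphic functions; its values on the
  zero set of the denominator are irrelevant.\<close>

definition meromorphic_fun ::
  "('a, 'k::{real_normed_field,euclidean_space}, 'n::finite) atl \<Rightarrow> 'a set \<Rightarrow> ('a \<Rightarrow> 'k) \<Rightarrow> bool" where
  "meromorphic_fun A S f \<longleftrightarrow>
     (\<forall>x\<in>S. \<exists>W p q. openin (mfd_top A) W \<and> x \<in> W \<and> W \<subseteq> S \<and>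
        smooth_fun A W p \<and> smooth_fun A W q \<and>
        W \<subseteq> mfd_top A closure_of {y \<in> W. q y \<noteq> 0} \<and>
        (\<forall>y\<in>W. q y \<noteq> 0 \<longrightarrow> f y = p y / q y))"

datatype admissibility = Smooth | Meromorphic

text \<open>\<open>Smooth\<close> means holomorphic over the complex numbers; \<open>Meromorphic\<close> is available only there.\<close>

definition admissible ::
  "admissibility \<Rightarrow> ('a, 'k::{real_normed_field,euclidean_space}, 'n::finite) atl \<Rightarrow> 'a set
    \<Rightarrow> ('a \<Rightarrow> 'k) \<Rightarrow> bool" where
  "admissible mode A S f \<longleftrightarrow>
     (case mode of
        Smooth \<Rightarrow> smooth_fun A S f
      | Meromorphic \<Rightarrow> (\<exists>i::'k. i * i = -1) \<and> meromorphic_fun A S f)"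

definition regular_at ::
  "('a, 'k::{real_normed_field,euclidean_space}, 'n::finite) atl \<Rightarrow> ('a \<Rightarrow> 'k^'m^'p) \<Rightarrow> 'a \<Rightarrow> bool" where
  "regular_at A r x \<longleftrightarrow> (\<forall>i j. smooth_at A (\<lambda>y. r y $ i $ j) x)"

text \<open>The function \<open>r\<close> given on a manifold with atlas \<open>A\<close> can be restricted to the open subset \<open>V\<close> of
  an immersed submanifold with atlas \<open>B\<close>.  This is automatic for smooth \<open>r\<close>; in the meromorphic case it
  says that \<open>V\<close> is not locally contained in the polar set of \<open>r\<close>.\<close>

definition restrictable ::
  "admissibility \<Rightarrow> ('a, 'k::{real_normed_field,euclidean_space}, 'n::finite) atl \<Rightarrow>
    ('a, 'k, 'h::finite) atl \<Rightarrow> 'a set \<Rightarrow> ('a \<Rightarrow> 'k^'m^'p) \<Rightarrow> bool" where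
  "restrictable mode A B V r \<longleftrightarrow>
     (mode = Meromorphic \<longrightarrow>
        (\<forall>i j. meromorphic_fun B V (\<lambda>x. r x $ i $ j)) \<and>
        V \<subseteq> mfd_top B closure_of {x \<in> V. regular_at A r x})"

section \<open>Lie groups\<close>

text \<open>The Lie algebra of a Lie group is presented as \<open>'k^'n\<close> by means of the exponential map, which fixes
  the identification of \<open>'k^'n\<close> with the tangent space at the unit.\<close>

record ('a, 'k, 'n) lie_group_data = "'a monoid" +
  atlas :: "('a, 'k, 'n) atl"
  lexp :: "'k^'n \<Rightarrow> 'a"

definition lie_group ::
  "('a, 'k::{real_normed_field,euclidean_space}, 'n::finite) lie_group_data \<Rightarrow> bool" where
  "lie_group G \<longleftrightarrow>
     Group.group G \<and>
     smooth_manifold (carrier G) (atlas G) \<and>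
     smooth_map (prod_atlas (atlas G) (atlas G)) (carrier G \<times> carrier G) (atlas G)
       (\<lambda>(x, y). x \<otimes>\<^bsub>G\<^esub> y) \<and>
     smooth_map (atlas G) (carrier G) (atlas G) (\<lambda>x. inv\<^bsub>G\<^esub> x) \<and>
     smooth_map {(UNIV, \<lambda>X. X)} UNIV (atlas G) (lexp G) \<and>
     (\<forall>X s t. lexp G ((s + t) *s X) = lexp G (s *s X) \<otimes>\<^bsub>G\<^esub> lexp G (t *s X)) \<and>
     (\<forall>(U, \<phi>)\<in>atlas G. \<one>\<^bsub>G\<^esub> \<in> U \<longrightarrow> (\<exists>L. (\<phi> \<circ> lexp G has_derivative L) (at 0) \<and> bij L))"

definition lie_connected ::
  "('a, 'k::{real_normed_field,euclidean_space}, 'n::finite) lie_group_data \<Rightarrow> bool" where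
  "lie_connected G \<longleftrightarrow> connected_space (mfd_top (atlas G))"

definition Ad ::
  "('a, 'k::{real_normed_field,euclidean_space}, 'n::finite) lie_group_data \<Rightarrow> 'a \<Rightarrow> 'k^'n \<Rightarrow> 'k^'n" where
  "Ad G g X =
     (THE Y. \<forall>t::'k. g \<otimes>\<^bsub>G\<^esub> lexp G (t *s X) \<otimes>\<^bsub>G\<^esub> inv\<^bsub>G\<^esub> g = lexp G (t *s Y))"

definition lie_br ::
  "('a, 'k::{real_normed_field,euclidean_space}, 'n::finite) lie_group_data
    \<Rightarrow> 'k^'n \<Rightarrow> 'k^'n \<Rightarrow> 'k^'n" where
  "lie_br G X Y = (\<chi> i. deriv (\<lambda>t. Ad G (lexp G (t *s X)) Y $ i) 0)"

text \<open>\<open>\<iota>\<close> makes \<open>K\<close> an (immersed) Lie subgroup of \<open>G\<close>, with \<open>d\<close> the induced inclusion of Lie algebras.\<close>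

definition lie_subgroup ::
  "('b \<Rightarrow> 'a) \<Rightarrow> ('k^'m \<Rightarrow> 'k^'n) \<Rightarrow>
   ('b, 'k::{real_normed_field,euclidean_space}, 'm::finite) lie_group_data \<Rightarrow>
   ('a, 'k, 'n::finite) lie_group_data \<Rightarrow> bool" where
  "lie_subgroup \<iota> d K G \<longleftrightarrow>
     lie_group K \<and> lie_group G \<and>
     \<iota> \<in> hom K G \<and> inj_on \<iota> (carrier K) \<and>
     smooth_map (atlas K) (carrier K) (atlas G) \<iota> \<and>
     Vector_Spaces.linear (*s) (*s) d \<and> inj d \<and>
     (\<forall>X. \<iota> (lexp K X) = lexp G (d X))"

section \<open>Tensors\<close>

definition antisym2 :: "'k::ring_1^'n^'n \<Rightarrow> bool" where
  "antisym2 T \<longleftrightarrow> (\<forall>i j. T $ i $ j = - T $ j $ i)"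

definition antisym3 :: "'k::ring_1^'n^'n^'n \<Rightarrow> bool" where
  "antisym3 T \<longleftrightarrow> (\<forall>i j k. T $ i $ j $ k = - T $ j $ i $ k \<and> T $ i $ j $ k = - T $ i $ k $ j)"

definition tmap2 :: "('k::comm_ring_1^'m \<Rightarrow> 'k^'n) \<Rightarrow> 'k^'m^'m \<Rightarrow> 'k^'n^'n" where
  "tmap2 L T = (\<chi> i j. \<Sum>a\<in>UNIV. \<Sum>b\<in>UNIV. L (axis a 1) $ i * L (axis b 1) $ j * T $ a $ b)"

definition tmap3 :: "('k::comm_ring_1^'m \<Rightarrow> 'k^'n) \<Rightarrow> 'k^'m^'m^'m \<Rightarrow> 'k^'n^'n^'n" where
  "tmap3 L T = (\<chi> i j k. \<Sum>a\<in>UNIV. \<Sum>b\<in>UNIV. \<Sum>c\<in>UNIV.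
     L (axis a 1) $ i * L (axis b 1) $ j * L (axis c 1) $ k * T $ a $ b $ c)"

text \<open>\<open>br12_13 G S T\<close> is \<open>[S\<^sub>1\<^sub>2, T\<^sub>1\<^sub>3]\<close>, and so on.\<close>

definition br12_13 ::
  "('a, 'k::{real_normed_field,euclidean_space}, 'n::finite) lie_group_data
    \<Rightarrow> 'k^'n^'n \<Rightarrow> 'k^'n^'n \<Rightarrow> 'k^'n^'n^'n" where
  "br12_13 G S T = (\<chi> i j k. \<Sum>a\<in>UNIV. \<Sum>b\<in>UNIV.
     lie_br G (axis a 1) (axis b 1) $ i * S $ a $ j * T $ b $ k)"

definition br12_23 ::
  "('a, 'k::{real_normed_field,euclidean_space}, 'n::finite) lie_group_data
    \<Rightarrow> 'k^'n^'n \<Rightarrow> 'k^'n^'n \<Rightarrow> 'k^'n^'n^'n" where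
  "br12_23 G S T = (\<chi> i j k. \<Sum>a\<in>UNIV. \<Sum>b\<in>UNIV.
     lie_br G (axis a 1) (axis b 1) $ j * S $ i $ a * T $ b $ k)"

definition br13_23 ::
  "('a, 'k::{real_normed_field,euclidean_space}, 'n::finite) lie_group_data
    \<Rightarrow> 'k^'n^'n \<Rightarrow> 'k^'n^'n \<Rightarrow> 'k^'n^'n^'n" where
  "br13_23 G S T = (\<chi> i j k. \<Sum>a\<in>UNIV. \<Sum>b\<in>UNIV.
     lie_br G (axis a 1) (axis b 1) $ k * S $ i $ a * T $ j $ b)"

text \<open>\<open>[X \<otimes> 1 + 1 \<otimes> X, T]\<close>\<close>

definition ad2 ::
  "('a, 'k::{real_normed_field,euclidean_space}, 'n::finite) lie_group_data
    \<Rightarrow> 'k^'n \<Rightarrow> 'k^'n^'n \<Rightarrow> 'k^'n^'n" where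
  "ad2 G X T = (\<chi> i j.
     (\<Sum>a\<in>UNIV. lie_br G X (axis a 1) $ i * T $ a $ j) +
     (\<Sum>b\<in>UNIV. lie_br G X (axis b 1) $ j * T $ i $ b))"

definition cyc3 :: "'k::comm_ring_1^'n^'n^'n \<Rightarrow> 'k^'n^'n^'n" where
  "cyc3 T = (\<chi> i j k. T $ i $ j $ k + T $ j $ k $ i + T $ k $ i $ j)"

section \<open>Poisson-Lie groups and the Drinfeld double\<close>

text \<open>\<open>I\<close> plays the role of the tensor \<open>\<I>\<^sub>R\<close>.\<close>

definition coboundary_PL_group ::
  "('a, 'k::{real_normed_field,euclidean_space}, 'n::finite) lie_group_data
    \<Rightarrow> 'k^'n^'n \<Rightarrow> 'k^'n^'n^'n \<Rightarrow> bool" where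
  "coboundary_PL_group G R I \<longleftrightarrow>
     lie_group G \<and> antisym2 R \<and>
     br12_13 G R R + br12_23 G R R + br13_23 G R R = I \<and>
     antisym3 I \<and> (\<forall>g\<in>carrier G. tmap3 (Ad G g) I = I)"

text \<open>Poisson bivectors are written in the trivialization by right translations.  The bracket
  \<open>{g\<^sub>1, g\<^sub>2} = [g\<^sub>1 g\<^sub>2, R] = g\<^sub>1 g\<^sub>2 R - R g\<^sub>1 g\<^sub>2\<close> then corresponds to
  \<open>(Ad g \<otimes> Ad g) R - R\<close>.\<close>

definition coboundary_bivector ::
  "('a, 'k::{real_normed_field,euclidean_space}, 'n::finite) lie_group_data
    \<Rightarrow> 'k^'n^'n \<Rightarrow> 'a \<Rightarrow> 'k^'n^'n" where
  "coboundary_bivector G R g = tmap2 (Ad G g) R - R"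

text \<open>\<open>K\<close>, with bivector \<open>\<pi>\<^sub>K\<close>, is a Lie subgroup of \<open>G\<close> whose inclusion is a Poisson map.\<close>

definition PL_subgroup ::
  "('k^'m \<Rightarrow> 'k^'n) \<Rightarrow>
   ('a, 'k::{real_normed_field,euclidean_space}, 'm::finite) lie_group_data \<Rightarrow> ('a \<Rightarrow> 'k^'m^'m) \<Rightarrow>
   ('a, 'k, 'n::finite) lie_group_data \<Rightarrow> ('a \<Rightarrow> 'k^'n^'n) \<Rightarrow> bool" where
  "PL_subgroup d K \<pi>\<^sub>K G \<pi>\<^sub>G \<longleftrightarrow>
     lie_subgroup (\<lambda>x. x) d K G \<and> (\<forall>x\<in>carrier K. \<pi>\<^sub>G x = tmap2 d (\<pi>\<^sub>K x))"

text \<open>The dual of \<open>'k^'n\<close> is again \<open>'k^'n\<close>, with the dual basis.\<close>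

definition pair :: "'k::comm_ring_1^'n \<Rightarrow> 'k^'n \<Rightarrow> 'k" where
  "pair \<alpha> X = (\<Sum>i\<in>UNIV. \<alpha> $ i * X $ i)"

definition perp :: "('k::comm_ring_1^'n) set \<Rightarrow> ('k^'n) set" where
  "perp V = {\<alpha>. \<forall>X\<in>V. pair \<alpha> X = 0}"

text \<open>The Lie bracket of the dual is, up to sign, the linearization of the Poisson bivector at the unit.
  The sign is forced by the other conventions: with left dressing vector fields and
  \<open>{g\<^sub>1, g\<^sub>2} = [g\<^sub>1 g\<^sub>2, R]\<close> the Lie bracket is
  \<open>\<langle>[\<alpha>, \<beta>], X\<rangle> = \<langle>\<alpha> \<otimes> \<beta>, [R, X \<otimes> 1 + 1 \<otimes> X]\<rangle>\<close>; the opposite sign would make the equivariance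
  property incompatible with the dynamical Yang-Baxter equation below.\<close>

definition dual_PL_group ::
  "('a, 'k::{real_normed_field,euclidean_space}, 'm::finite) lie_group_data \<Rightarrow> ('a \<Rightarrow> 'k^'m^'m)
    \<Rightarrow> ('b, 'k, 'm) lie_group_data \<Rightarrow> bool" where
  "dual_PL_group K \<pi>\<^sub>K Ks \<longleftrightarrow>
     lie_group Ks \<and>
     (\<forall>X a b. pair (lie_br Ks (axis a 1) (axis b 1)) X =
              - deriv (\<lambda>t. \<pi>\<^sub>K (lexp K (t *s X)) $ a $ b) 0)"

text \<open>The scalar product on \<open>\<kk> + \<kk>\<^sup>*\<close>.\<close>

definition dpair :: "'k::comm_ring_1^('m::finite + 'm) \<Rightarrow> 'k^('m + 'm) \<Rightarrow> 'k" where
  "dpair A B = pair (vsnd A) (vfst B) + pair (vsnd B) (vfst A)"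

text \<open>\<open>D\<close> is a Lie group with Lie algebra \<open>\<kk> + \<kk>\<^sup>*\<close> that contains \<open>K\<close> and \<open>K\<^sup>*\<close>
  (via \<open>\<iota>\<close> and \<open>\<iota>s\<close>) as Lie subgroups.  Since \<open>\<kk>\<close> and \<open>\<kk>\<^sup>*\<close> are subalgebras, the invariance of the
  scalar product determines the Lie bracket completely.\<close>

definition drinfeld_double ::
  "('a, 'k::{real_normed_field,euclidean_space}, 'm::finite) lie_group_data
    \<Rightarrow> ('b, 'k, 'm) lie_group_data \<Rightarrow> ('d, 'k, 'm + 'm) lie_group_data
    \<Rightarrow> ('a \<Rightarrow> 'd) \<Rightarrow> ('b \<Rightarrow> 'd) \<Rightarrow> bool" where
  "drinfeld_double K Ks D \<iota> \<iota>s \<longleftrightarrow>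
     lie_subgroup \<iota> (\<lambda>X. vjoin X 0) K D \<and>
     lie_subgroup \<iota>s (\<lambda>\<alpha>. vjoin 0 \<alpha>) Ks D \<and>
     (\<forall>A B C. dpair (lie_br D A B) C = dpair A (lie_br D B C))"

section \<open>Triangular Poisson-Lie dynamical r-matrices\<close>

definition L_deriv ::
  "('b, 'k::{real_normed_field,euclidean_space}, 'm::finite) lie_group_data \<Rightarrow> 'k^'m
    \<Rightarrow> ('b \<Rightarrow> 'k^'n^'n) \<Rightarrow> 'b \<Rightarrow> 'k^'n^'n" where
  "L_deriv Ks \<alpha> r \<kappa> =
     (\<chi> i j. deriv (\<lambda>t. r (lexp Ks (t *s \<alpha>) \<otimes>\<^bsub>Ks\<^esub> \<kappa>) $ i $ j) 0)"

text \<open>The derivative of \<open>r\<close> along the vector field whose value at \<open>\<kappa>\<close> is the left translate by \<open>\<kappa>\<close> of the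
  \<open>\<kk>\<^sup>*\<close>-component of \<open>\<kappa>\<^sup>-\<^sup>1 X \<kappa>\<close>.\<close>

definition dress_deriv ::
  "('b, 'k::{real_normed_field,euclidean_space}, 'm::finite) lie_group_data
    \<Rightarrow> ('d, 'k, 'm + 'm) lie_group_data \<Rightarrow> ('b \<Rightarrow> 'd) \<Rightarrow> 'k^'m
    \<Rightarrow> ('b \<Rightarrow> 'k^'n^'n) \<Rightarrow> 'b \<Rightarrow> 'k^'n^'n" where
  "dress_deriv Ks D \<iota>s X r \<kappa> =
     (let \<alpha> = vsnd (Ad D (inv\<^bsub>D\<^esub> (\<iota>s \<kappa>)) (vjoin X 0))
      in \<chi> i j. deriv (\<lambda>t. r (\<kappa> \<otimes>\<^bsub>Ks\<^esub> lexp Ks (t *s \<alpha>)) $ i $ j) 0)"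

text \<open>Here \<open>d\<close> is the inclusion of the Lie algebra of \<open>K\<close> into that of \<open>G\<close>.  Differential equations for a
  meromorphic \<open>r\<close> are imposed wherever \<open>r\<close> is regular; a smooth \<open>r\<close> is regular everywhere.\<close>

definition triangular_PL_dynamical_r_matrix ::
  "admissibility
    \<Rightarrow> ('a, 'k::{real_normed_field,euclidean_space}, 'n::finite) lie_group_data
    \<Rightarrow> 'k^'n^'n \<Rightarrow> 'k^'n^'n^'n \<Rightarrow> ('k^'m \<Rightarrow> 'k^'n)
    \<Rightarrow> ('b, 'k, 'm::finite) lie_group_data \<Rightarrow> ('d, 'k, 'm + 'm) lie_group_data \<Rightarrow> ('b \<Rightarrow> 'd)
    \<Rightarrow> 'b set \<Rightarrow> ('b \<Rightarrow> 'k^'n^'n) \<Rightarrow> bool" where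
  "triangular_PL_dynamical_r_matrix mode G R I d Ks D \<iota>s U r \<longleftrightarrow>
     openin (mfd_top (atlas Ks)) U \<and>
     (\<forall>\<kappa>\<in>U. antisym2 (r \<kappa>)) \<and>
     (\<forall>i j. admissible mode (atlas Ks) U (\<lambda>\<kappa>. r \<kappa> $ i $ j)) \<and>
     (\<forall>\<kappa>\<in>U. regular_at (atlas Ks) r \<kappa> \<longrightarrow>
        (\<forall>X. dress_deriv Ks D \<iota>s X r \<kappa> = ad2 G (d X) (r \<kappa>)) \<and>
        cyc3 (br12_23 G (R + r \<kappa>) (R + r \<kappa>) +
              (\<chi> i j k. \<Sum>a\<in>UNIV. d (axis a 1) $ i * L_deriv Ks (axis a 1) r \<kappa> $ j $ k)) = I)"

section \<open>The matrix function of the reduction\<close>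

text \<open>The component in \<open>V\<close> with respect to the direct sum of the subspaces \<open>V\<close> and \<open>W\<close>.\<close>

definition component :: "('k::field^'n) set \<Rightarrow> ('k^'n) set \<Rightarrow> 'k^'n \<Rightarrow> 'k^'n" where
  "component V W X = (THE Y. Y \<in> V \<and> X - Y \<in> W)"

text \<open>The components of \<open>\<lambda> X \<lambda>\<^sup>-\<^sup>1\<close>, for \<open>X\<close> in \<open>\<kk>\<close>, in \<open>\<mm>\<close> and in \<open>\<mm>\<^sup>* = \<hh>\<^sup>\<bottom>\<close>,
  the complement of the latter being \<open>\<hh>\<^sup>* = \<mm>\<^sup>\<bottom>\<close>.\<close>

definition m_part ::
  "('d, 'k::{real_normed_field,euclidean_space}, 'm::finite + 'm) lie_group_data \<Rightarrow> ('b \<Rightarrow> 'd)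
    \<Rightarrow> ('k^'m) set \<Rightarrow> ('k^'m) set \<Rightarrow> 'b \<Rightarrow> 'k^'m \<Rightarrow> 'k^'m" where
  "m_part D \<iota>s \<hh> \<mm> l X = component \<mm> \<hh> (vfst (Ad D (\<iota>s l) (vjoin X 0)))"

definition mstar_part ::
  "('d, 'k::{real_normed_field,euclidean_space}, 'm::finite + 'm) lie_group_data \<Rightarrow> ('b \<Rightarrow> 'd)
    \<Rightarrow> ('k^'m) set \<Rightarrow> ('k^'m) set \<Rightarrow> 'b \<Rightarrow> 'k^'m \<Rightarrow> 'k^'m" where
  "mstar_part D \<iota>s \<hh> \<mm> l X = component (perp \<hh>) (perp \<mm>) (vsnd (Ad D (\<iota>s l) (vjoin X 0)))"

definition C_matrix ::
  "('d, 'k::{real_normed_field,euclidean_space}, 'm::finite + 'm) lie_group_data \<Rightarrow> ('b \<Rightarrow> 'd)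
    \<Rightarrow> ('k^'m) set \<Rightarrow> ('k^'m) set \<Rightarrow> ('i \<Rightarrow> 'k^'m) \<Rightarrow> 'b \<Rightarrow> 'i \<Rightarrow> 'i \<Rightarrow> 'k" where
  "C_matrix D \<iota>s \<hh> \<mm> M l i j =
     dpair (vjoin 0 (mstar_part D \<iota>s \<hh> \<mm> l (M j))) (vjoin (m_part D \<iota>s \<hh> \<mm> l (M i)) 0)"

text \<open>Square matrices whose rows and columns are indexed by a finite, possibly empty set \<open>J\<close>.\<close>

definition inverse_matrix_on ::
  "'i set \<Rightarrow> ('i \<Rightarrow> 'i \<Rightarrow> 'k::comm_ring_1) \<Rightarrow> ('i \<Rightarrow> 'i \<Rightarrow> 'k) \<Rightarrow> bool" where
  "inverse_matrix_on J A B \<longleftrightarrow>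
     (\<forall>i\<in>J. \<forall>j\<in>J. (\<Sum>l\<in>J. A i l * B l j) = (if i = j then 1 else 0) \<and>
                  (\<Sum>l\<in>J. B i l * A l j) = (if i = j then 1 else 0))"

definition tensor :: "'k::times^'n \<Rightarrow> 'k^'n \<Rightarrow> 'k^'n^'n" where
  "tensor X Y = (\<chi> i j. X $ i * Y $ j)"

definition tscale :: "'k::times \<Rightarrow> 'k^'n^'n \<Rightarrow> 'k^'n^'n" where
  "tscale c T = (\<chi> i j. c * T $ i $ j)"

end

theory Submission
  imports Defs
begin

text \<open>
  For \<open>\<lambda> \<in> H\<^sup>*\<close> the map \<open>Ad \<lambda>\<close> is an isometry of the double that preserves \<open>\<hh> + \<hh>\<^sup>*\<close>, hence also
  \<open>\<mm> + \<mm>\<^sup>*\<close>.  For \<open>Y \<in> \<mm>\<close> write \<open>Ad \<lambda> Y = X + \<xi>\<close> with \<open>X \<in> \<mm>\<close> and \<open>\<xi> \<in> \<mm>\<^sup>*\<close>.  Then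
  \<open>\<rho> = r\<^sup>* - r\<close>, regarded as a map from \<open>\<mm>\<^sup>*\<close> to \<open>\<mm>\<close>, is \<open>\<xi> \<mapsto> - X\<close>; that is, the graph of \<open>- \<rho>\<close> is
  \<open>Ad \<lambda> \<mm>\<close>.  Differentiating this relation gives
  \<open>\<L>\<^sub>\<alpha> \<rho> (\<xi>, \<eta>) = - \<langle>\<langle>Y + \<eta>, [\<alpha>, X + \<xi>]\<rangle>\<rangle>\<close> for \<open>\<alpha> \<in> \<hh>\<^sup>*\<close> and points \<open>X + \<xi>\<close>, \<open>Y + \<eta>\<close> of \<open>Ad \<lambda> \<mm>\<close>.
  Moreover the equivariance of \<open>r\<close> in the direction \<open>X\<close> reads \<open>\<L>\<^sub>\<xi> r = - [X \<otimes> 1 + 1 \<otimes> X, r]\<close>.  Insert both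
  into the Yang-Baxter equation for \<open>r\<^sup>*\<close> and subtract the one for \<open>r\<close>: all terms with \<open>r\<close> cancel, \<open>R\<close> enters
  only through the cobracket of \<open>\<kk>\<close>, and what remains is
  \<open>\<langle>\<langle>X + \<xi>, [Y + \<eta>, Z + \<zeta>]\<rangle>\<rangle> = 0\<close>, which holds because \<open>Ad \<lambda> \<kk>\<close> is an isotropic subalgebra.

  A meromorphic \<open>r\<close> may have poles at points where the restriction of \<open>r\<^sup>*\<close> to \<open>H\<^sup>*\<close> is smooth; there the
  equations follow by continuity from the dense set of points where \<open>r\<close> is regular.
\<close>

section \<open>Calculus of \<open>C\<^sup>k\<close> functions over the ground field\<close>

text \<open>The hypotheses on h, m and h-perp are infinitesimal, whereas the overview starts from
  properties of Ad \<lambda> for group elements \<lambda>. The bridge is the linear map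
  \<open>\<Psi>\<close> from the double of h onto h + h*. It is an isometry, and since invariance of
  the scalar product determines the mixed brackets, the conditions [h, m] \<subseteq> m and
  [k*, h-perp] \<subseteq> h-perp make it a homomorphism. One-parameter subgroups and the
  connectedness of H* transfer this to Ad \<lambda>.

  A Lie group is given here by a smooth exponential, its law on lines and its bijective derivative
  at 0. Linearity and smoothness of Ad, and with them the bilinear bracket, are extracted from this
  by local injectivity of the exponential and repeated halving.

  The inverse of C is given only pointwise. Its geometric meaning is that Ad \<lambda> m, an
  isotropic subspace of m + m*, is the graph of a map from m* to m. Both the smoothness of this map,
  by Cramer's rule, and its derivative follow from that description, so the inverse matrix itself is
  never differentiated.\<close>

definition kgrad :: "('k::{real_normed_field,euclidean_space}^'n \<Rightarrow> 'k) \<Rightarrow> 'k^'n \<Rightarrow> 'k^'n \<Rightarrow> bool" where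
  "kgrad f x g \<longleftrightarrow> (f has_derivative (\<lambda>h. \<Sum>i\<in>UNIV. g $ i * h $ i)) (at x)"

lemma Ck_on_Suc:
  "Ck_on (Suc r) S f \<longleftrightarrow> (\<exists>g. (\<forall>x\<in>S. kgrad f x (g x)) \<and> (\<forall>i. Ck_on r S (\<lambda>x. g x $ i)))"
  by (simp add: kgrad_def)

lemma Ck_on_SucI:
  "(\<And>x. x \<in> S \<Longrightarrow> kgrad f x (g x)) \<Longrightarrow> (\<And>i. Ck_on r S (\<lambda>x. g x $ i)) \<Longrightarrow> Ck_on (Suc r) S f"
  unfolding Ck_on_Suc by blast

lemma Ck_on_SucE:
  assumes "Ck_on (Suc r) S f"
  obtains g where "\<And>x. x \<in> S \<Longrightarrow> kgrad f x (g x)" "\<And>i. Ck_on r S (\<lambda>x. g x $ i)"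
  using assms unfolding Ck_on_Suc by blast

text \<open>\<open>Ck_on\<close> asserts a gradient separately for every order and every set.
  Uniqueness is what lets these choices be merged, across local pieces and across orders.\<close>

lemma kgrad_unique:
  assumes "kgrad f x g" "kgrad f x g'"
  shows "g = g'"
proof -
  have eq: "(\<lambda>h. \<Sum>i\<in>UNIV. g $ i * h $ i) = (\<lambda>h. \<Sum>i\<in>UNIV. g' $ i * h $ i)"
    using has_derivative_unique[OF assms[unfolded kgrad_def]] .
  have "g $ j = g' $ j" for j
    using fun_cong[OF eq, of "axis j 1"] by (simp add: axis_def if_distrib cong: if_cong)
  thus ?thesis by (simp add: vec_eq_iff)
qed

lemma kgrad_transform:
  assumes "kgrad f x g" "open S" "x \<in> S" "\<And>y. y \<in> S \<Longrightarrow> f y = f' y"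
  shows "kgrad f' x g"
  using has_derivative_transform_within_open[OF assms(1)[unfolded kgrad_def] assms(2-4)]
  by (simp add: kgrad_def)

lemma Ck_on_subset: "Ck_on r S f \<Longrightarrow> T \<subseteq> S \<Longrightarrow> Ck_on r T f"
proof (induction r arbitrary: f)
  case 0 thus ?case by (auto intro: continuous_on_subset)
next
  case (Suc r)
  from Suc.prems(1) obtain g where "\<And>x. x \<in> S \<Longrightarrow> kgrad f x (g x)" "\<And>i. Ck_on r S (\<lambda>x. g x $ i)"
    by (rule Ck_on_SucE) blast
  with Suc.IH Suc.prems(2) show ?case by (intro Ck_on_SucI[of _ _ g]) auto
qed

lemma Ck_on_cong:
  assumes "open S" "\<And>x. x \<in> S \<Longrightarrow> f x = f' x" "Ck_on r S f"
  shows "Ck_on r S f'"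
proof (cases r)
  case 0 thus ?thesis using assms by (simp cong: continuous_on_cong)
next
  case (Suc q)
  from assms(3)[unfolded Suc] obtain g where
    "\<And>x. x \<in> S \<Longrightarrow> kgrad f x (g x)" "\<And>i. Ck_on q S (\<lambda>x. g x $ i)"
    by (rule Ck_on_SucE) blast
  with kgrad_transform[OF _ assms(1) _ assms(2)] show ?thesis
    unfolding Suc by (intro Ck_on_SucI[of _ _ g]) auto
qed

lemma Ck_on_SucD: "Ck_on (Suc r) S f \<Longrightarrow> Ck_on r S f"
proof (induction r arbitrary: f)
  case 0
  then obtain g where "\<And>x. x \<in> S \<Longrightarrow> kgrad f x (g x)" by (rule Ck_on_SucE) blast
  thus ?case unfolding kgrad_def
    by (auto intro!: continuous_at_imp_continuous_on dest: has_derivative_continuous)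
next
  case (Suc r)
  from Suc.prems obtain g where g: "\<And>x. x \<in> S \<Longrightarrow> kgrad f x (g x)" "\<And>i. Ck_on (Suc r) S (\<lambda>x. g x $ i)"
    by (rule Ck_on_SucE) blast
  show ?case by (rule Ck_on_SucI[OF g(1) Suc.IH[OF g(2)]])
qed

lemma Ck_on_const: "Ck_on r S (\<lambda>x. c)"
proof (induction r arbitrary: c)
  case 0 show ?case by simp
next
  case (Suc r)
  show ?case by (rule Ck_on_SucI[of _ _ "\<lambda>x. 0"]) (use Suc in \<open>auto simp: kgrad_def\<close>)
qed

lemma Ck_on_nth: "Ck_on r S (\<lambda>x. x $ i)"
proof (cases r)
  case 0 thus ?thesis by (simp add: continuous_on_component)
next
  case (Suc q)
  have e: "(\<Sum>j\<in>UNIV. axis i 1 $ j * h $ j) = h $ i" for h :: "'a^'b"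
    using sum.delta[of UNIV i "\<lambda>j. h $ j"] by (simp add: axis_def if_distrib[of "\<lambda>c. c * _"] cong: if_cong)
  have "((\<lambda>x. x $ i) has_derivative (\<lambda>h. h $ i)) (at x)" for x :: "'a^'b"
    by (simp add: bounded_linear_imp_has_derivative bounded_linear_vec_nth)
  thus ?thesis unfolding Suc
    by (intro Ck_on_SucI[of _ _ "\<lambda>x. axis i 1"]) (simp_all add: Ck_on_const kgrad_def e)
qed

lemma Ck_on_add: "Ck_on r S f \<Longrightarrow> Ck_on r S g \<Longrightarrow> Ck_on r S (\<lambda>x. f x + g x)"
proof (induction r arbitrary: f g)
  case 0 thus ?case by (simp add: continuous_on_add)
next
  case (Suc r)
  obtain f' where f: "\<And>x. x \<in> S \<Longrightarrow> kgrad f x (f' x)" "\<And>i. Ck_on r S (\<lambda>x. f' x $ i)"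
    using Ck_on_SucE[OF Suc.prems(1)] by blast
  obtain g' where g: "\<And>x. x \<in> S \<Longrightarrow> kgrad g x (g' x)" "\<And>i. Ck_on r S (\<lambda>x. g' x $ i)"
    using Ck_on_SucE[OF Suc.prems(2)] by blast
  have "kgrad (\<lambda>x. f x + g x) x (f' x + g' x)" if "x \<in> S" for x
    using has_derivative_add[OF f(1)[OF that, unfolded kgrad_def] g(1)[OF that, unfolded kgrad_def]]
    by (simp add: sum.distrib distrib_right kgrad_def)
  thus ?case
    by (intro Ck_on_SucI[of _ _ "\<lambda>x. f' x + g' x"]) (simp_all add: Suc.IH f g)
qed

lemma Ck_on_mult: "Ck_on r S f \<Longrightarrow> Ck_on r S g \<Longrightarrow> Ck_on r S (\<lambda>x. f x * g x)"
proof (induction r arbitrary: f g)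
  case 0 thus ?case by (simp add: continuous_on_mult)
next
  case (Suc r)
  obtain f' where f: "\<And>x. x \<in> S \<Longrightarrow> kgrad f x (f' x)" "\<And>i. Ck_on r S (\<lambda>x. f' x $ i)"
    using Ck_on_SucE[OF Suc.prems(1)] by blast
  obtain g' where g: "\<And>x. x \<in> S \<Longrightarrow> kgrad g x (g' x)" "\<And>i. Ck_on r S (\<lambda>x. g' x $ i)"
    using Ck_on_SucE[OF Suc.prems(2)] by blast
  have "kgrad (\<lambda>x. f x * g x) x (f x *s g' x + g x *s f' x)" if "x \<in> S" for x
    using has_derivative_mult[OF f(1)[OF that, unfolded kgrad_def] g(1)[OF that, unfolded kgrad_def]]
    by (simp add: sum.distrib distrib_right sum_distrib_left sum_distrib_right algebra_simps kgrad_def)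
  moreover have "Ck_on r S f" "Ck_on r S g" using Suc.prems Ck_on_SucD by auto
  ultimately show ?case
    by (intro Ck_on_SucI[of _ _ "\<lambda>x. f x *s g' x + g x *s f' x"]) (simp_all add: Suc.IH f g Ck_on_add)
qed

lemma Ck_on_sum: "(\<And>i. i \<in> A \<Longrightarrow> Ck_on r S (f i)) \<Longrightarrow> Ck_on r S (\<lambda>x. \<Sum>i\<in>A. f i x)"
  by (induction A rule: infinite_finite_induct) (auto simp: Ck_on_const Ck_on_add)

text \<open>The gradient of 1/f is built from the gradient of f and 1/f itself, so order r for 1/f
  yields order r + 1.\<close>

lemma Ck_on_inverse:
  "Ck_on r S f \<Longrightarrow> (\<And>x. x \<in> S \<Longrightarrow> f x \<noteq> 0) \<Longrightarrow> Ck_on r S (\<lambda>x. inverse (f x))"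
proof (induction r)
  case 0 thus ?case by (simp add: continuous_on_inverse)
next
  case (Suc r)
  obtain f' where f: "\<And>x. x \<in> S \<Longrightarrow> kgrad f x (f' x)" "\<And>i. Ck_on r S (\<lambda>x. f' x $ i)"
    using Ck_on_SucE[OF Suc.prems(1)] by blast
  have inv: "Ck_on r S (\<lambda>x. inverse (f x))" using Suc.IH[OF Ck_on_SucD[OF Suc.prems(1)] Suc.prems(2)] .
  have "kgrad (\<lambda>x. inverse (f x)) x ((- 1 * inverse (f x) * inverse (f x)) *s f' x)" if "x \<in> S" for x
    using Deriv.has_derivative_inverse[OF Suc.prems(2)[OF that] f(1)[OF that, unfolded kgrad_def]]
    by (simp add: sum_distrib_left sum_distrib_right sum_negf algebra_simps kgrad_def)
  moreover have "Ck_on r S (\<lambda>x. ((- 1 * inverse (f x) * inverse (f x)) *s f' x) $ i)" for i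
    unfolding vector_smult_component by (intro Ck_on_mult Ck_on_const inv f)
  ultimately show ?case
    by (rule Ck_on_SucI)
qed

lemma bounded_linear_axis: "bounded_linear (axis j :: 'b::real_normed_vector \<Rightarrow> 'b^'m)"
proof (rule bounded_linear_intro[where K=1])
  have "(\<Sum>i\<in>UNIV. (norm (axis j x $ i))\<^sup>2) = (\<Sum>i\<in>UNIV. if i = j then (norm x)\<^sup>2 else 0)" for x :: 'b and j :: 'm
    by (intro sum.cong) (auto simp: axis_def)
  thus "norm (axis j x :: 'b^'m) \<le> norm x * 1" for x by (simp add: norm_vec_def L2_set_def)
qed (simp_all add: axis_def vec_eq_iff)

lemma vec_lambda_has_derivative:
  fixes f :: "'a::real_normed_vector \<Rightarrow> 'm::finite \<Rightarrow> 'b::real_normed_vector"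
  assumes "\<And>j. ((\<lambda>x. f x j) has_derivative (\<lambda>h. f' h j)) (at x within S)"
  shows "((\<lambda>x. \<chi> j. f x j) has_derivative (\<lambda>h. \<chi> j. f' h j)) (at x within S)"
proof -
  have e: "(\<chi> j. u j) = (\<Sum>j\<in>UNIV. axis j (u j))" for u :: "'m \<Rightarrow> 'b"
    by (simp add: vec_eq_iff axis_def)
  show ?thesis unfolding e
    by (intro has_derivative_sum bounded_linear.has_derivative[OF bounded_linear_axis] assms)
qed

lemma vec_has_derivative_iff:
  fixes f :: "'a::real_normed_vector \<Rightarrow> 'b::real_normed_vector^'m"
  shows "(f has_derivative f') (at x within S) \<longleftrightarrow>
    (\<forall>j. ((\<lambda>x. f x $ j) has_derivative (\<lambda>h. f' h $ j)) (at x within S))"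
  using vec_lambda_has_derivative[of "\<lambda>x j. f x $ j" "\<lambda>h j. f' h $ j" x S]
  by (auto intro: bounded_linear.has_derivative[OF bounded_linear_vec_nth])

lemma kgrad_compose:
  assumes "\<And>j. kgrad (\<lambda>x. F x $ j) x (g j)" "kgrad h (F x) h'"
  shows "kgrad (\<lambda>x. h (F x)) x (\<chi> i. \<Sum>j\<in>UNIV. h' $ j * g j $ i)"
proof -
  have "(F has_derivative (\<lambda>v. \<chi> j. \<Sum>i\<in>UNIV. g j $ i * v $ i)) (at x)"
    using assms(1) by (simp add: vec_has_derivative_iff kgrad_def)
  from has_derivative_compose[OF this assms(2)[unfolded kgrad_def]]
  have "((\<lambda>x. h (F x)) has_derivative (\<lambda>v. \<Sum>j\<in>UNIV. h' $ j * (\<Sum>i\<in>UNIV. g j $ i * v $ i))) (at x)"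
    by simp
  moreover have "(\<Sum>j\<in>UNIV. h' $ j * (\<Sum>i\<in>UNIV. g j $ i * v $ i)) =
     (\<Sum>i\<in>UNIV. (\<chi> i. \<Sum>j\<in>UNIV. h' $ j * g j $ i) $ i * v $ i)" for v
    unfolding sum_distrib_left by (subst sum.swap) (simp add: sum_distrib_right mult.assoc)
  ultimately show ?thesis by (simp add: kgrad_def)
qed

text \<open>Induction on the order with the outer function arbitrary and the inner map fixed: the
  gradient of the composite consists of products of h'(F x), covered by the induction hypothesis,
  with the gradient of F.\<close>

lemma Ck_on_compose:
  assumes "\<And>j. Ck_on r S (\<lambda>x. F x $ j)" "Ck_on r T h" "F ` S \<subseteq> T"
  shows "Ck_on r S (\<lambda>x. h (F x))"
  using assms
proof (induction r arbitrary: h)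
  case 0
  have "continuous_on S (\<lambda>x. \<chi> j. F x $ j)" using 0 by (intro continuous_on_vec_lambda) simp
  thus ?case using 0 by (auto intro: continuous_on_compose2)
next
  case (Suc r)
  obtain h' where h: "\<And>x. x \<in> T \<Longrightarrow> kgrad h x (h' x)" "\<And>i. Ck_on r T (\<lambda>x. h' x $ i)"
    using Ck_on_SucE[OF Suc.prems(2)] by blast
  have "\<forall>j. \<exists>g. (\<forall>x\<in>S. kgrad (\<lambda>x. F x $ j) x (g x)) \<and> (\<forall>i. Ck_on r S (\<lambda>x. g x $ i))"
    using Suc.prems(1) unfolding Ck_on_Suc by blast
  from choice[OF this] obtain g where g: "\<And>j x. x \<in> S \<Longrightarrow> kgrad (\<lambda>x. F x $ j) x (g j x)"
    "\<And>j i. Ck_on r S (\<lambda>x. g j x $ i)" by blast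
  have "kgrad (\<lambda>x. h (F x)) x (\<chi> i. \<Sum>j\<in>UNIV. h' (F x) $ j * g j x $ i)" if x: "x \<in> S" for x
    by (rule kgrad_compose) (use x g(1) h(1) Suc.prems(3) in auto)
  moreover have "Ck_on r S (\<lambda>x. (\<chi> i. \<Sum>j\<in>UNIV. h' (F x) $ j * g j x $ i) $ i)" for i
    unfolding vec_lambda_beta
    by (intro Ck_on_sum Ck_on_mult g Suc.IH[OF _ h(2) Suc.prems(3)] Ck_on_SucD[OF Suc.prems(1)])
  ultimately show ?case by (rule Ck_on_SucI)
qed

text \<open>Local gradients agree on overlaps by \<open>kgrad_unique\<close>. Hence taking at x the
  gradient that belongs to the neighbourhood chosen for x gives one function that is locally as
  regular as the pieces.\<close>

lemma Ck_on_local: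
  assumes "\<And>x. x \<in> S \<Longrightarrow> \<exists>T. open T \<and> x \<in> T \<and> T \<subseteq> S \<and> Ck_on r T f"
  shows "Ck_on r S f"
  using assms
proof (induction r arbitrary: f)
  case 0
  have "continuous (at x) f" if "x \<in> S" for x
    using 0[OF that] by (auto simp: continuous_on_eq_continuous_at)
  thus ?case by (simp add: continuous_at_imp_continuous_on)
next
  case (Suc r)
  have "\<forall>x\<in>S. \<exists>Tg. open (fst Tg) \<and> x \<in> fst Tg \<and> fst Tg \<subseteq> S \<and>
     (\<forall>y\<in>fst Tg. kgrad f y (snd Tg y)) \<and> (\<forall>i. Ck_on r (fst Tg) (\<lambda>y. snd Tg y $ i))"
    using Suc.prems unfolding Ck_on_Suc by fastforce
  from bchoice[OF this] obtain Tg where T: "\<And>x. x \<in> S \<Longrightarrow> open (fst (Tg x)) \<and> x \<in> fst (Tg x) \<and> fst (Tg x) \<subseteq> S"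
    and d: "\<And>x y. x \<in> S \<Longrightarrow> y \<in> fst (Tg x) \<Longrightarrow> kgrad f y (snd (Tg x) y)"
    and c: "\<And>x i. x \<in> S \<Longrightarrow> Ck_on r (fst (Tg x)) (\<lambda>y. snd (Tg x) y $ i)"
    by blast
  have eq: "snd (Tg x) y = snd (Tg y) y" if "x \<in> S" "y \<in> fst (Tg x)" for x y
    using kgrad_unique[OF d[OF that] d[of y y]] that T by blast
  have "Ck_on r S (\<lambda>x. snd (Tg x) x $ i)" for i
  proof (rule Suc.IH)
    fix x assume x: "x \<in> S"
    have "Ck_on r (fst (Tg x)) (\<lambda>x. snd (Tg x) x $ i)"
      by (rule Ck_on_cong[OF _ _ c[OF x, of i]]) (use T[OF x] in blast, metis eq[OF x])
    thus "\<exists>T. open T \<and> x \<in> T \<and> T \<subseteq> S \<and> Ck_on r T (\<lambda>x. snd (Tg x) x $ i)" using T[OF x] by blast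
  qed
  thus ?case using d T by (intro Ck_on_SucI[of _ _ "\<lambda>x. snd (Tg x) x"]) auto
qed

lemma smooth_scalar_on_subset: "smooth_scalar_on S f \<Longrightarrow> T \<subseteq> S \<Longrightarrow> smooth_scalar_on T f"
  by (auto simp: smooth_scalar_on_def intro: Ck_on_subset)

lemma smooth_scalar_on_cong:
  "open S \<Longrightarrow> (\<And>x. x \<in> S \<Longrightarrow> f x = f' x) \<Longrightarrow> smooth_scalar_on S f \<Longrightarrow> smooth_scalar_on S f'"
  by (auto simp: smooth_scalar_on_def intro: Ck_on_cong)

lemma smooth_scalar_on_local:
  assumes "\<And>x. x \<in> S \<Longrightarrow> \<exists>T. open T \<and> x \<in> T \<and> T \<subseteq> S \<and> smooth_scalar_on T f"
  shows "smooth_scalar_on S f"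
  unfolding smooth_scalar_on_def
proof (intro allI Ck_on_local)
  fix r x assume "x \<in> S"
  from assms[OF this] show "\<exists>T. open T \<and> x \<in> T \<and> T \<subseteq> S \<and> Ck_on r T f"
    unfolding smooth_scalar_on_def by blast
qed

lemma smooth_scalar_on_compose:
  assumes "smooth_vec_on S F" "smooth_scalar_on T h" "F ` S \<subseteq> T"
  shows "smooth_scalar_on S (\<lambda>x. h (F x))"
  unfolding smooth_scalar_on_def
  using assms by (auto simp: smooth_scalar_on_def smooth_vec_on_def intro: Ck_on_compose[of _ S F T h])

lemma smooth_scalar_on_continuous: "smooth_scalar_on S f \<Longrightarrow> continuous_on S f"
  unfolding smooth_scalar_on_def using Ck_on.simps(1) by blast

lemma smooth_vec_on_continuous: "smooth_vec_on S F \<Longrightarrow> continuous_on S F"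
  using continuous_on_vec_lambda[of S "\<lambda>i x. F x $ i"]
  by (simp add: smooth_vec_on_def smooth_scalar_on_continuous)

text \<open>Each order comes with its own gradient. They all coincide on S, so the one of order 0
  inherits every order of regularity.\<close>

lemma smooth_scalar_on_gradient:
  assumes "smooth_scalar_on S f" "open S"
  obtains g where "\<And>x. x \<in> S \<Longrightarrow> kgrad f x (g x)" "\<And>i. smooth_scalar_on S (\<lambda>x. g x $ i)"
proof -
  have "\<forall>r. \<exists>g. (\<forall>x\<in>S. kgrad f x (g x)) \<and> (\<forall>i. Ck_on r S (\<lambda>x. g x $ i))"
    using assms(1) Ck_on_Suc smooth_scalar_on_def by blast
  from choice[OF this] obtain g where g: "\<And>r x. x \<in> S \<Longrightarrow> kgrad f x (g r x)"
    "\<And>r i. Ck_on r S (\<lambda>x. g r x $ i)" by blast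
  have eq: "g r x = g 0 x" if "x \<in> S" for x r
    by (rule kgrad_unique[OF g(1)[OF that] g(1)[OF that]])
  have "Ck_on r S (\<lambda>x. g 0 x $ i)" for r i
    by (rule Ck_on_cong[OF assms(2) _ g(2)[of r i]]) (metis eq)
  hence "smooth_scalar_on S (\<lambda>x. g 0 x $ i)" for i by (simp add: smooth_scalar_on_def)
  with g(1)[of _ 0] show ?thesis by (rule that)
qed

section \<open>Smooth maps between manifolds\<close>

text \<open>The same one-chart atlas as in the smoothness clause for \<open>lexp\<close> in
  \<open>lie_group\<close>. With it, vector-valued functions are instances of smooth maps between
  manifolds.\<close>

abbreviation vatl :: "('k^'n, 'k::{real_normed_field,euclidean_space}, 'n::finite) atl" where
  "vatl \<equiv> {(UNIV, \<lambda>X. X)}"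

text \<open>The predicate to which \<open>mfd_top\<close> applies \<open>topology\<close>.
  Injectivity of the charts makes it satisfy the axioms of a topology, so that it then coincides
  with openness in \<open>mfd_top A\<close>.\<close>

definition aopen :: "('a, 'k::{real_normed_field,euclidean_space}, 'n::finite) atl \<Rightarrow> 'a set \<Rightarrow> bool" where
  "aopen A S \<longleftrightarrow> S \<subseteq> \<Union>(fst ` A) \<and> (\<forall>(U, \<phi>)\<in>A. open (\<phi> ` (S \<inter> U)))"

text \<open>The part of \<open>smooth_manifold\<close> that carries the arguments on openness and
  composition. Isolating it allows product atlases to be used without showing that they define
  manifolds.\<close>

definition chart_inj :: "('a, 'k, 'n) atl \<Rightarrow> bool" where
  "chart_inj A \<longleftrightarrow> (\<forall>(U, \<phi>)\<in>A. inj_on \<phi> U)"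

lemma inv_into_UNIV_ident [simp]: "inv_into UNIV (\<lambda>X. X) = (\<lambda>X. X)"
  using inv_id by (simp add: id_def)

lemma aopen_vatl [simp]: "aopen vatl S \<longleftrightarrow> open S"
  by (simp add: aopen_def)

lemma chart_inj_vatl [simp]: "chart_inj vatl"
  by (simp add: chart_inj_def inj_on_def)

lemma manifold_chart_inj: "smooth_manifold M A \<Longrightarrow> chart_inj A"
  by (auto simp: smooth_manifold_def chart_inj_def)

lemma chart_injD: "chart_inj A \<Longrightarrow> (U, \<phi>) \<in> A \<Longrightarrow> inj_on \<phi> U"
  by (auto simp: chart_inj_def)

lemma istopology_aopen:
  assumes "chart_inj A"
  shows "istopology (aopen A)"
  unfolding istopology_def
proof (intro conjI allI impI)
  fix S T assume ST: "aopen A S" "aopen A T"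
  have "open (\<phi> ` (S \<inter> T \<inter> U))" if "(U, \<phi>) \<in> A" for U \<phi>
  proof -
    have "\<phi> ` (S \<inter> T \<inter> U) = \<phi> ` (S \<inter> U) \<inter> \<phi> ` (T \<inter> U)"
      using chart_injD[OF assms that] by (auto simp: inj_on_def)
    thus ?thesis using ST that by (auto simp: aopen_def)
  qed
  thus "aopen A (S \<inter> T)" using ST by (auto simp: aopen_def)
next
  fix \<K> assume K: "\<forall>S\<in>\<K>. aopen A S"
  have "open (\<phi> ` (\<Union>\<K> \<inter> U))" if "(U, \<phi>) \<in> A" for U \<phi>
  proof -
    have "\<phi> ` (\<Union>\<K> \<inter> U) = (\<Union>S\<in>\<K>. \<phi> ` (S \<inter> U))" by auto
    moreover have "open (\<phi> ` (S \<inter> U))" if "S \<in> \<K>" for S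
      using K that \<open>(U, \<phi>) \<in> A\<close> by (auto simp: aopen_def)
    ultimately show ?thesis by auto
  qed
  thus "aopen A (\<Union>\<K>)" using K by (auto simp: aopen_def)
qed

lemma openin_mfd_top: "chart_inj A \<Longrightarrow> openin (mfd_top A) S \<longleftrightarrow> aopen A S"
  using topology_inverse'[OF istopology_aopen, of A]
  by (simp add: mfd_top_def aopen_def[abs_def])

lemma aopen_Int: "chart_inj A \<Longrightarrow> aopen A S \<Longrightarrow> aopen A T \<Longrightarrow> aopen A (S \<inter> T)"
  using istopology_aopen by (auto simp: istopology_def)

lemma aopen_Union: "chart_inj A \<Longrightarrow> (\<And>S. S \<in> \<K> \<Longrightarrow> aopen A S) \<Longrightarrow> aopen A (\<Union>\<K>)"
  using istopology_aopen[of A] unfolding istopology_def by blast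

lemma aopen_local:
  assumes "chart_inj A" "\<And>x. x \<in> S \<Longrightarrow> \<exists>T. aopen A T \<and> x \<in> T \<and> T \<subseteq> S"
  shows "aopen A S"
proof -
  have "S = \<Union>{T. aopen A T \<and> T \<subseteq> S}" using assms(2) by blast
  thus ?thesis using aopen_Union[OF assms(1), of "{T. aopen A T \<and> T \<subseteq> S}"] by simp
qed

lemma manifold_carrier: "smooth_manifold M A \<Longrightarrow> \<Union>(fst ` A) = M"
  by (simp add: smooth_manifold_def)

lemma aopen_manifold: "smooth_manifold M A \<Longrightarrow> aopen A M"
proof -
  assume M: "smooth_manifold M A"
  have "M \<inter> U = U" if "(U, \<phi>) \<in> A" for U \<phi> using M that by (force simp: smooth_manifold_def)
  thus ?thesis using M by (force simp: smooth_manifold_def aopen_def)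
qed

lemma manifold_chart_overlap:
  assumes "smooth_manifold M A" "(U, \<phi>) \<in> A" "(V, \<psi>) \<in> A"
  shows "open (\<phi> ` (U \<inter> V))" "smooth_vec_on (\<phi> ` (U \<inter> V)) (\<psi> \<circ> inv_into U \<phi>)"
  using assms unfolding smooth_manifold_def by blast+

lemma aopen_chart:
  assumes "smooth_manifold M A" "(U, \<phi>) \<in> A"
  shows "aopen A U"
  unfolding aopen_def
proof (intro conjI ballI, goal_cases)
  case 1 show ?case using assms(2) by force
next
  case (2 p)
  thus ?case using manifold_chart_overlap(1)[OF assms(1) _ assms(2)] by (cases p) (simp add: Int_commute)
qed

lemma manifold_chart_at:
  assumes "smooth_manifold M A" "x \<in> M"
  obtains U \<phi> where "(U, \<phi>) \<in> A" "x \<in> U" "U \<subseteq> M" "inj_on \<phi> U" "open (\<phi> ` U)"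
proof -
  have "x \<in> \<Union>(fst ` A)" using assms manifold_carrier by blast
  then obtain U \<phi> where U: "(U, \<phi>) \<in> A" "x \<in> U" by auto
  moreover have "U \<subseteq> M" using manifold_carrier[OF assms(1)] U by force
  moreover have "inj_on \<phi> U" "open (\<phi> ` U)"
    using chart_injD[OF manifold_chart_inj] manifold_chart_overlap(1)[OF assms(1) U(1) U(1)] assms U by auto
  ultimately show ?thesis by (rule that)
qed

section \<open>Smooth maps: continuity, restriction, composition and pairs\<close>

lemma smooth_mapD:
  assumes "smooth_map A S B f" "(U, \<phi>) \<in> A" "(V, \<psi>) \<in> B"
  shows "open (\<phi> ` (S \<inter> U \<inter> f -` V))"
    "smooth_vec_on (\<phi> ` (S \<inter> U \<inter> f -` V)) (\<psi> \<circ> f \<circ> inv_into U \<phi>)"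
  using assms by (auto simp: smooth_map_def)

lemma smooth_map_in: "smooth_map A S B f \<Longrightarrow> x \<in> S \<Longrightarrow> f x \<in> \<Union>(fst ` B)"
  unfolding smooth_map_def by blast

lemma smooth_map_chart_at:
  assumes "smooth_map A S B f" "x \<in> S"
  obtains V \<psi> where "(V, \<psi>) \<in> B" "f x \<in> V"
  using smooth_map_in[OF assms] by auto

lemma aopen_chart_at:
  assumes "aopen A S" "x \<in> S"
  obtains V \<psi> where "(V, \<psi>) \<in> A" "x \<in> V"
  using assms unfolding aopen_def by auto

text \<open>The definition of \<open>smooth_map\<close> gives open preimages for chart domains only.
  For a general open set, such a preimage is cut down by the continuous coordinate expression of
  f.\<close>

lemma smooth_map_aopen:
  assumes f: "smooth_map A S B f" and A: "chart_inj A" "S \<subseteq> \<Union>(fst ` A)" and B: "chart_inj B" and T: "aopen B T"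
  shows "aopen A (S \<inter> f -` T)"
  unfolding aopen_def
proof (intro conjI ballI, goal_cases)
  case 1 show ?case using A by auto
next
  case (2 p)
  obtain U \<phi> where p: "p = (U, \<phi>)" and U: "(U, \<phi>) \<in> A" using 2 by (cases p) auto
  note inj = chart_injD[OF A(1) U]
  have "open (\<phi> ` (S \<inter> f -` T \<inter> U))"
  proof (subst open_subopen, intro ballI)
    fix z assume "z \<in> \<phi> ` (S \<inter> f -` T \<inter> U)"
    then obtain x where x: "x \<in> S" "f x \<in> T" "x \<in> U" "z = \<phi> x" by auto
    obtain V \<psi> where V: "(V, \<psi>) \<in> B" "f x \<in> V" using aopen_chart_at[OF T x(2)] .
    note d = smooth_mapD[OF f U V(1)]
    let ?F = "\<psi> \<circ> f \<circ> inv_into U \<phi>"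
    let ?Z = "\<phi> ` (S \<inter> U \<inter> f -` V)"
    have "open (?Z \<inter> ?F -` (\<psi> ` (T \<inter> V)))"
      by (rule continuous_open_preimage[OF smooth_vec_on_continuous[OF d(2)] d(1)])
        (use T V in \<open>auto simp: aopen_def\<close>)
    moreover have "z \<in> ?Z \<inter> ?F -` (\<psi> ` (T \<inter> V))" using x V inj by auto
    moreover have "?Z \<inter> ?F -` (\<psi> ` (T \<inter> V)) \<subseteq> \<phi> ` (S \<inter> f -` T \<inter> U)"
    proof
      fix w assume w: "w \<in> ?Z \<inter> ?F -` (\<psi> ` (T \<inter> V))"
      then obtain y where y: "y \<in> S" "y \<in> U" "f y \<in> V" "w = \<phi> y" by auto
      with w inj obtain t where t: "t \<in> T" "t \<in> V" "\<psi> (f y) = \<psi> t" by auto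
      with chart_injD[OF B V(1)] y have "f y = t" by (meson inj_onD)
      thus "w \<in> \<phi> ` (S \<inter> f -` T \<inter> U)" using y t by auto
    qed
    ultimately show "\<exists>Q. open Q \<and> z \<in> Q \<and> Q \<subseteq> \<phi> ` (S \<inter> f -` T \<inter> U)" by blast
  qed
  thus ?case using p by simp
qed

lemma smooth_map_subset:
  assumes "smooth_map A S B f" "chart_inj A" "aopen A T" "T \<subseteq> S"
  shows "smooth_map A T B f"
  unfolding smooth_map_def
proof (intro conjI ballI, goal_cases)
  case 1 show ?case using assms by (auto simp: smooth_map_def)
next
  case (2 p)
  obtain U \<phi> where p: "p = (U, \<phi>)" and U: "(U, \<phi>) \<in> A" using 2 by (cases p) auto
  have "open (\<phi> ` (T \<inter> U \<inter> f -` V)) \<and> smooth_vec_on (\<phi> ` (T \<inter> U \<inter> f -` V)) (\<psi> \<circ> f \<circ> inv_into U \<phi>)"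
    if V: "(V, \<psi>) \<in> B" for V \<psi>
  proof
    note d = smooth_mapD[OF assms(1) U V]
    have "\<phi> ` (T \<inter> U \<inter> f -` V) = \<phi> ` (T \<inter> U) \<inter> \<phi> ` (S \<inter> U \<inter> f -` V)"
      using assms(4) chart_injD[OF assms(2) U] by (auto simp: inj_on_def)
    thus "open (\<phi> ` (T \<inter> U \<inter> f -` V))" using d(1) assms(3) U by (auto simp: aopen_def)
    show "smooth_vec_on (\<phi> ` (T \<inter> U \<inter> f -` V)) (\<psi> \<circ> f \<circ> inv_into U \<phi>)"
      using d(2) smooth_scalar_on_subset[of "\<phi> ` (S \<inter> U \<inter> f -` V)" _ "\<phi> ` (T \<inter> U \<inter> f -` V)"] assms(4)
      unfolding smooth_vec_on_def by blast
  qed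
  thus ?case using p by auto
qed

text \<open>Smoothness is local. Near a point a chart of the middle manifold is inserted, and on the
  open set \<open>?Q\<close> where this is possible the coordinate expression factors as
  \<open>?H\<close> after \<open>?F\<close>.\<close>

lemma smooth_map_compose:
  assumes f: "smooth_map A S B f" and g: "smooth_map B T C g" and fS: "f ` S \<subseteq> T"
    and A: "chart_inj A" and B: "chart_inj B"
  shows "smooth_map A S C (\<lambda>x. g (f x))"
  unfolding smooth_map_def
proof (intro conjI ballI, goal_cases)
  case 1 show ?case using smooth_map_in[OF g] fS by blast
next
  case (2 p)
  obtain U \<phi> where p: "p = (U, \<phi>)" and U: "(U, \<phi>) \<in> A" using 2 by (cases p) auto
  note inj = chart_injD[OF A U]
  have main: "open (\<phi> ` (S \<inter> U \<inter> (\<lambda>x. g (f x)) -` W)) \<and>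
     smooth_vec_on (\<phi> ` (S \<inter> U \<inter> (\<lambda>x. g (f x)) -` W)) (\<xi> \<circ> (\<lambda>x. g (f x)) \<circ> inv_into U \<phi>)"
    if W: "(W, \<xi>) \<in> C" for W \<xi>
  proof -
    let ?Z = "\<phi> ` (S \<inter> U \<inter> (\<lambda>x. g (f x)) -` W)"
    have loc: "\<exists>Q. open Q \<and> z \<in> Q \<and> Q \<subseteq> ?Z \<and> smooth_vec_on Q (\<xi> \<circ> (\<lambda>x. g (f x)) \<circ> inv_into U \<phi>)"
      if "z \<in> ?Z" for z
    proof -
      obtain x where x: "x \<in> S" "g (f x) \<in> W" "x \<in> U" "z = \<phi> x" using \<open>z \<in> ?Z\<close> by auto
      obtain V \<psi> where V: "(V, \<psi>) \<in> B" "f x \<in> V" using smooth_map_chart_at[OF f x(1)] .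
      note d = smooth_mapD[OF f U V(1)] and e = smooth_mapD[OF g V(1) W]
      let ?F = "\<psi> \<circ> f \<circ> inv_into U \<phi>" and ?H = "\<xi> \<circ> g \<circ> inv_into V \<psi>"
      let ?Q = "\<phi> ` (S \<inter> U \<inter> f -` V) \<inter> ?F -` (\<psi> ` (T \<inter> V \<inter> g -` W))"
      have op: "open ?Q"
        by (rule continuous_open_preimage[OF smooth_vec_on_continuous[OF d(2)] d(1) e(1)])
      have zO: "z \<in> ?Q" using x V inj fS by auto
      have *: "w \<in> ?Z \<and> \<xi> (g (f (inv_into U \<phi> w))) = ?H (?F w)" if w: "w \<in> ?Q" for w
      proof -
        obtain y where y: "y \<in> S" "y \<in> U" "f y \<in> V" "w = \<phi> y" using w by auto
        with w inj obtain t where t: "t \<in> T" "t \<in> V" "g t \<in> W" "\<psi> (f y) = \<psi> t" by auto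
        with chart_injD[OF B V(1)] y have "f y = t" by (meson inj_onD)
        thus ?thesis using y t inj chart_injD[OF B V(1)] by auto
      qed
      have "smooth_vec_on ?Q ?F" using d(2) unfolding smooth_vec_on_def
        by (auto intro: smooth_scalar_on_subset)
      hence h: "smooth_scalar_on ?Q (\<lambda>w. ?H (?F w) $ j)" for j
        by (rule smooth_scalar_on_compose[where T="\<psi> ` (T \<inter> V \<inter> g -` W)"])
          (use e(2) in \<open>auto simp: smooth_vec_on_def\<close>)
      have "smooth_vec_on ?Q (\<xi> \<circ> (\<lambda>x. g (f x)) \<circ> inv_into U \<phi>)"
        unfolding smooth_vec_on_def
      proof (intro allI smooth_scalar_on_cong[OF op _ h])
        fix j w assume "w \<in> ?Q"
        from conjunct2[OF *[OF this]]
        show "?H (?F w) $ j = (\<xi> \<circ> (\<lambda>x. g (f x)) \<circ> inv_into U \<phi>) w $ j"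
          by (simp only: o_apply)
      qed
      moreover have "?Q \<subseteq> ?Z" using conjunct1[OF *] by (rule subsetI)
      ultimately show ?thesis using op zO by (intro exI[of _ ?Q] conjI)
    qed
    have "open ?Z"
    proof (subst open_subopen, intro ballI)
      fix z assume "z \<in> ?Z"
      from loc[OF this] show "\<exists>T. open T \<and> z \<in> T \<and> T \<subseteq> ?Z" by (elim exE conjE) (intro exI conjI)
    qed
    moreover have "smooth_vec_on ?Z (\<xi> \<circ> (\<lambda>x. g (f x)) \<circ> inv_into U \<phi>)"
      unfolding smooth_vec_on_def
    proof (intro allI smooth_scalar_on_local)
      fix j z assume "z \<in> ?Z"
      from loc[OF this] show "\<exists>T. open T \<and> z \<in> T \<and> T \<subseteq> ?Z \<and>
         smooth_scalar_on T (\<lambda>x. (\<xi> \<circ> (\<lambda>x. g (f x)) \<circ> inv_into U \<phi>) x $ j)"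
        unfolding smooth_vec_on_def by blast
    qed
    ultimately show ?thesis by (rule conjI)
  qed
  show ?case by (simp only: p split_conv, intro ballI, clarify, rule main)
qed

lemma prod_atlas_chart_inj:
  assumes "chart_inj A" "chart_inj B"
  shows "chart_inj (prod_atlas A B)"
proof -
  have "inj_on (\<lambda>(x, y). vjoin (\<phi> x) (\<psi> y)) (U \<times> V)" if "(U, \<phi>) \<in> A" "(V, \<psi>) \<in> B" for U \<phi> V \<psi>
  proof (rule inj_onI, clarify)
    fix x y x' y' assume *: "x \<in> U" "y \<in> V" "x' \<in> U" "y' \<in> V" and e: "vjoin (\<phi> x) (\<psi> y) = vjoin (\<phi> x') (\<psi> y')"
    have "\<phi> x $ i = \<phi> x' $ i" for i using arg_cong[OF e, of "\<lambda>z. z $ Inl i"] by (simp add: vjoin_def)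
    moreover have "\<psi> y $ i = \<psi> y' $ i" for i using arg_cong[OF e, of "\<lambda>z. z $ Inr i"] by (simp add: vjoin_def)
    ultimately show "x = x' \<and> y = y'"
      using * chart_injD[OF assms(1) that(1)] chart_injD[OF assms(2) that(2)] by (simp add: vec_eq_iff inj_on_def)
  qed
  thus ?thesis by (auto simp: chart_inj_def prod_atlas_def)
qed

lemma smooth_map_Pair:
  assumes f: "smooth_map A S B f" and g: "smooth_map A S C g" and A: "chart_inj A"
  shows "smooth_map A S (prod_atlas B C) (\<lambda>x. (f x, g x))"
  unfolding smooth_map_def
proof (intro conjI ballI, goal_cases)
  case 1
  show ?case
  proof (clarify)
    fix x assume x: "x \<in> S"
    obtain V \<psi> where V: "(V, \<psi>) \<in> B" "f x \<in> V" using smooth_map_chart_at[OF f x] .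
    obtain W \<xi> where W: "(W, \<xi>) \<in> C" "g x \<in> W" using smooth_map_chart_at[OF g x] .
    have "(V \<times> W, \<lambda>(x, y). vjoin (\<psi> x) (\<xi> y)) \<in> prod_atlas B C" using V W by (auto simp: prod_atlas_def)
    thus "(f x, g x) \<in> \<Union>(fst ` prod_atlas B C)" using V W by force
  qed
next
  case (2 p)
  obtain U \<phi> where p: "p = (U, \<phi>)" and U: "(U, \<phi>) \<in> A" using 2 by (cases p) auto
  have "open (\<phi> ` (S \<inter> U \<inter> (\<lambda>x. (f x, g x)) -` (V \<times> W))) \<and>
    smooth_vec_on (\<phi> ` (S \<inter> U \<inter> (\<lambda>x. (f x, g x)) -` (V \<times> W)))
       ((\<lambda>(x, y). vjoin (\<psi> x) (\<xi> y)) \<circ> (\<lambda>x. (f x, g x)) \<circ> inv_into U \<phi>)"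
    if V: "(V, \<psi>) \<in> B" and W: "(W, \<xi>) \<in> C" for V \<psi> W \<xi>
  proof
    let ?Z = "\<phi> ` (S \<inter> U \<inter> (\<lambda>x. (f x, g x)) -` (V \<times> W))"
    note d = smooth_mapD[OF f U V] and e = smooth_mapD[OF g U W]
    have Z: "?Z = \<phi> ` (S \<inter> U \<inter> f -` V) \<inter> \<phi> ` (S \<inter> U \<inter> g -` W)"
      using chart_injD[OF A U] by (auto simp: inj_on_def)
    show "open ?Z" unfolding Z using d(1) e(1) by blast
    have "smooth_scalar_on ?Z (\<lambda>x. ((\<lambda>(x, y). vjoin (\<psi> x) (\<xi> y)) \<circ> (\<lambda>x. (f x, g x)) \<circ> inv_into U \<phi>) x $ j)" for j
    proof (cases j)
      case (Inl a)
      have "smooth_scalar_on ?Z (\<lambda>x. (\<psi> \<circ> f \<circ> inv_into U \<phi>) x $ a)"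
        unfolding Z by (rule smooth_scalar_on_subset[OF d(2)[unfolded smooth_vec_on_def, rule_format]]) auto
      thus ?thesis using Inl by (simp add: vjoin_def)
    next
      case (Inr a)
      have "smooth_scalar_on ?Z (\<lambda>x. (\<xi> \<circ> g \<circ> inv_into U \<phi>) x $ a)"
        unfolding Z by (rule smooth_scalar_on_subset[OF e(2)[unfolded smooth_vec_on_def, rule_format]]) auto
      thus ?thesis using Inr by (simp add: vjoin_def)
    qed
    thus "smooth_vec_on ?Z ((\<lambda>(x, y). vjoin (\<psi> x) (\<xi> y)) \<circ> (\<lambda>x. (f x, g x)) \<circ> inv_into U \<phi>)"
      unfolding smooth_vec_on_def by blast
  qed
  thus ?case using p by (auto simp: prod_atlas_def)
qed

lemma smooth_map_const:
  assumes "aopen A S" "c \<in> \<Union>(fst ` B)"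
  shows "smooth_map A S B (\<lambda>x. c)"
  unfolding smooth_map_def
proof (intro conjI ballI, goal_cases)
  case 1 show ?case using assms by auto
next
  case (2 p)
  obtain U \<phi> where p: "p = (U, \<phi>)" and U: "(U, \<phi>) \<in> A" using 2 by (cases p) auto
  have "open (\<phi> ` (S \<inter> U \<inter> (\<lambda>x. c) -` V))" for V
    using assms(1) U by (cases "c \<in> V") (auto simp: aopen_def)
  thus ?case using p by (auto simp: smooth_vec_on_def smooth_scalar_on_def Ck_on_const)
qed

section \<open>Smooth scalar functions on manifolds\<close>

lemma smooth_fun_iff:
  "smooth_fun A S f \<longleftrightarrow> (\<forall>U \<phi> r. (U, \<phi>) \<in> A \<longrightarrow> Ck_on r (\<phi> ` (S \<inter> U)) (\<lambda>x. f (inv_into U \<phi> x)))"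
  unfolding smooth_fun_def smooth_scalar_on_def o_def by blast

lemma smooth_map_vatl:
  assumes "aopen A S"
  shows "smooth_map A S vatl F \<longleftrightarrow> (\<forall>j. smooth_fun A S (\<lambda>x. F x $ j))"
proof -
  have "open (\<phi> ` (S \<inter> U))" if "(U, \<phi>) \<in> A" for U \<phi> using assms that unfolding aopen_def by blast
  thus ?thesis
    unfolding smooth_map_def smooth_fun_def smooth_vec_on_def o_def by auto
qed

lemma smooth_fun_vatl [simp]: "smooth_fun vatl S f \<longleftrightarrow> smooth_scalar_on S f"
  by (simp add: smooth_fun_def o_def)

lemma smooth_fun_compose:
  fixes g :: "'b \<Rightarrow> 'k::{real_normed_field,euclidean_space}"
  assumes f: "smooth_map A S B f" and g: "smooth_fun B T g" and fS: "f ` S \<subseteq> T"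
    and A: "chart_inj A" and B: "chart_inj B" and S: "aopen A S" and T: "aopen B T"
  shows "smooth_fun A S (\<lambda>x. g (f x))"
proof -
  \<comment> \<open>A scalar function is viewed as a map into the one-dimensional space
    \<open>'k^1\<close>, so that composition of smooth maps applies.\<close>
  have "smooth_map B T vatl (\<lambda>x. (\<chi> i. g x) :: 'k^1)" using g by (simp add: smooth_map_vatl[OF T])
  from smooth_map_compose[OF f this fS A B] show ?thesis by (simp add: smooth_map_vatl[OF S])
qed

lemma smooth_fun_subset: "smooth_fun A S f \<Longrightarrow> T \<subseteq> S \<Longrightarrow> smooth_fun A T f"
  unfolding smooth_fun_iff by (meson Ck_on_subset Int_mono image_mono order_refl)

lemma smooth_fun_cong:
  assumes "chart_inj A" "aopen A S" "\<And>x. x \<in> S \<Longrightarrow> f x = g x" "smooth_fun A S f"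
  shows "smooth_fun A S g"
  unfolding smooth_fun_def
proof (clarify)
  fix U \<phi> assume U: "(U, \<phi>) \<in> A"
  show "smooth_scalar_on (\<phi> ` (S \<inter> U)) (g \<circ> inv_into U \<phi>)"
  proof (rule smooth_scalar_on_cong)
    show "open (\<phi> ` (S \<inter> U))" using assms(2) U by (auto simp: aopen_def)
    show "smooth_scalar_on (\<phi> ` (S \<inter> U)) (f \<circ> inv_into U \<phi>)" using assms(4) U by (auto simp: smooth_fun_def)
  qed (use assms(3) chart_injD[OF assms(1) U] in auto)
qed

lemma smooth_fun_const: "smooth_fun A S (\<lambda>x. c)"
  by (simp add: smooth_fun_iff Ck_on_const)

lemma smooth_fun_add: "smooth_fun A S f \<Longrightarrow> smooth_fun A S g \<Longrightarrow> smooth_fun A S (\<lambda>x. f x + g x)"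
  by (simp add: smooth_fun_iff Ck_on_add)

lemma smooth_fun_mult: "smooth_fun A S f \<Longrightarrow> smooth_fun A S g \<Longrightarrow> smooth_fun A S (\<lambda>x. f x * g x)"
  by (simp add: smooth_fun_iff Ck_on_mult)

lemma smooth_fun_minus: "smooth_fun A S f \<Longrightarrow> smooth_fun A S (\<lambda>x. - f x)"
  using smooth_fun_mult[OF smooth_fun_const[of A S "- 1"]] by simp

lemma smooth_fun_diff: "smooth_fun A S f \<Longrightarrow> smooth_fun A S g \<Longrightarrow> smooth_fun A S (\<lambda>x. f x - g x)"
  using smooth_fun_add[OF _ smooth_fun_minus, of A S f g] by simp

lemma smooth_fun_sum: "(\<And>i. i \<in> I \<Longrightarrow> smooth_fun A S (f i)) \<Longrightarrow> smooth_fun A S (\<lambda>x. \<Sum>i\<in>I. f i x)"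
  by (induction I rule: infinite_finite_induct) (auto simp: smooth_fun_const smooth_fun_add)

lemma smooth_fun_prod: "(\<And>i. i \<in> I \<Longrightarrow> smooth_fun A S (f i)) \<Longrightarrow> smooth_fun A S (\<lambda>x. \<Prod>i\<in>I. f i x)"
  by (induction I rule: infinite_finite_induct) (auto simp: smooth_fun_const smooth_fun_mult)

lemma smooth_fun_divide:
  assumes "chart_inj A" "smooth_fun A S f" "smooth_fun A S g" "\<And>x. x \<in> S \<Longrightarrow> g x \<noteq> 0"
  shows "smooth_fun A S (\<lambda>x. f x / g x)"
proof -
  have "smooth_fun A S (\<lambda>x. inverse (g x))"
    unfolding smooth_fun_def smooth_scalar_on_def
  proof (clarify)
    fix U \<phi> r assume U: "(U, \<phi>) \<in> A"
    have "Ck_on r (\<phi> ` (S \<inter> U)) (g \<circ> inv_into U \<phi>)" using assms(3) U by (auto simp: smooth_fun_def smooth_scalar_on_def)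
    moreover have "(g \<circ> inv_into U \<phi>) x \<noteq> 0" if "x \<in> \<phi> ` (S \<inter> U)" for x
      using that assms(4) chart_injD[OF assms(1) U] by auto
    ultimately have "Ck_on r (\<phi> ` (S \<inter> U)) (\<lambda>x. inverse ((g \<circ> inv_into U \<phi>) x))" by (rule Ck_on_inverse)
    thus "Ck_on r (\<phi> ` (S \<inter> U)) ((\<lambda>x. inverse (g x)) \<circ> inv_into U \<phi>)" by (simp add: o_def)
  qed
  from smooth_fun_mult[OF assms(2) this] show ?thesis by (simp add: divide_inverse)
qed

lemma smooth_fun_nonzero_aopen:
  fixes f :: "'a \<Rightarrow> 'k::{real_normed_field,euclidean_space}"
  assumes "chart_inj A" "aopen A S" "smooth_fun A S f"
  shows "aopen A {x \<in> S. f x \<noteq> 0}"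
proof -
  have sm: "smooth_map A S vatl (\<lambda>x. (\<chi> i. f x) :: 'k^1)"
    using assms smooth_map_vatl[OF assms(2), of "\<lambda>x. (\<chi> i. f x) :: 'k^1"] by simp
  have "S \<subseteq> \<Union>(fst ` A)" using assms(2) unfolding aopen_def by blast
  moreover have "open (- {0 :: 'k^1})" by (rule open_Compl) simp
  ultimately have "aopen A (S \<inter> (\<lambda>x. (\<chi> i. f x) :: 'k^1) -` (- {0}))"
    using smooth_map_aopen[OF sm assms(1) _ chart_inj_vatl] by simp
  moreover have "S \<inter> (\<lambda>x. (\<chi> i. f x) :: 'k^1) -` (- {0}) = {x \<in> S. f x \<noteq> 0}"
    by (auto simp: vec_eq_iff)
  ultimately show ?thesis by simp
qed

lemma smooth_map_inverse_chart:
  assumes "smooth_manifold M A" "(U, \<phi>) \<in> A"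
  shows "smooth_map vatl (\<phi> ` U) A (inv_into U \<phi>)"
  unfolding smooth_map_def
proof (intro conjI ballI, goal_cases)
  case 1 show ?case using assms(2) by (force intro: inv_into_into)
next
  case (2 p)
  have inj: "inj_on \<phi> U" using chart_injD[OF manifold_chart_inj] assms by blast
  have "\<phi> ` U \<inter> inv_into U \<phi> -` V = \<phi> ` (U \<inter> V)" for V using inj by auto
  moreover have "open (\<phi> ` (U \<inter> V))" "smooth_vec_on (\<phi> ` (U \<inter> V)) (\<psi> \<circ> inv_into U \<phi>)"
    if "(V, \<psi>) \<in> A" for V \<psi>
    using manifold_chart_overlap assms that by blast+
  ultimately show ?case using 2 by (auto simp: o_def)
qed

lemma smooth_fun_chart:
  assumes "smooth_manifold M A" "(U, \<phi>) \<in> A"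
  shows "smooth_fun A U (\<lambda>x. \<phi> x $ i)"
  unfolding smooth_fun_def
proof (clarify)
  fix V \<psi> assume V: "(V, \<psi>) \<in> A"
  have "smooth_vec_on (\<psi> ` (V \<inter> U)) (\<phi> \<circ> inv_into V \<psi>)"
    by (rule manifold_chart_overlap(2)[OF assms(1) V assms(2)])
  thus "smooth_scalar_on (\<psi> ` (U \<inter> V)) ((\<lambda>x. \<phi> x $ i) \<circ> inv_into V \<psi>)"
    by (simp add: smooth_vec_on_def o_def Int_commute)
qed

section \<open>Derivatives that depend smoothly on a point\<close>

lemma kgrad_vjoin:
  assumes "kgrad h (vjoin x y) g"
  shows "kgrad (\<lambda>X. h (vjoin X y)) x (vfst g)"
proof -
  have "kgrad (\<lambda>X. vjoin X y $ j) x (case j of Inl a \<Rightarrow> axis a 1 | Inr b \<Rightarrow> 0)" for j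
  proof (cases j)
    case (Inl a)
    have "(\<Sum>j\<in>UNIV. axis a 1 $ j * h $ j) = h $ a" for h :: "'a^'b"
      using sum.delta[of UNIV a "\<lambda>j. h $ j"] by (simp add: axis_def if_distrib[of "\<lambda>c. c * _"] cong: if_cong)
    thus ?thesis using Inl
      by (simp add: vjoin_def kgrad_def bounded_linear_imp_has_derivative bounded_linear_vec_nth)
  qed (simp add: vjoin_def kgrad_def)
  from kgrad_compose[OF this assms]
  have "kgrad (\<lambda>X. h (vjoin X y)) x
    (\<chi> i. \<Sum>j\<in>UNIV. g $ j * (case j of Inl a \<Rightarrow> axis a 1 | Inr b \<Rightarrow> 0) $ i)" .
  moreover have "(\<Sum>j\<in>UNIV. g $ j * (case j of Inl a \<Rightarrow> axis a 1 | Inr b \<Rightarrow> 0) $ i) = vfst g $ i" for i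
  proof -
    have "(\<Sum>j\<in>UNIV. g $ j * (case j of Inl a \<Rightarrow> axis a 1 | Inr b \<Rightarrow> 0) $ i) =
       (\<Sum>j\<in>UNIV. if j = Inl i then g $ j else 0)"
      by (intro sum.cong) (auto simp: axis_def split: sum.splits)
    thus ?thesis by (simp add: vfst_def)
  qed
  ultimately show ?thesis by (simp add: vec_eq_iff)
qed

text \<open>In a chart, f (\<Gamma> X x) is a smooth function of the joint variable (X, y). Its
  gradient is therefore smooth, and the X-part at X = 0 is the wanted derivative. Smoothness of
  \<Gamma> is phrased through smooth substitutions for X and x, which is the form that the closure
  rules for group operations deliver.\<close>

lemma smooth_parametric_derivative:
  fixes A :: "('a, 'k::{real_normed_field,euclidean_space}, 'm::finite) atl"
    and B :: "('b, 'k, 'p::finite) atl" and \<Gamma> :: "'k^'n::finite \<Rightarrow> 'a \<Rightarrow> 'b"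
  assumes A: "smooth_manifold M A" and B: "chart_inj B" and S: "aopen A S" and T: "aopen B T"
    and \<Gamma>: "\<And>Z (X :: 'k^('n + 'm) \<Rightarrow> 'k^'n) x. open Z \<Longrightarrow> smooth_map vatl Z vatl X \<Longrightarrow> smooth_map vatl Z A x \<Longrightarrow>
       smooth_map vatl Z B (\<lambda>z. \<Gamma> (X z) (x z))"
    and f: "smooth_fun B T f" and ST: "\<And>x. x \<in> S \<Longrightarrow> \<Gamma> 0 x \<in> T"
  obtains D where "\<And>x. x \<in> S \<Longrightarrow> kgrad (\<lambda>X. f (\<Gamma> X x)) 0 (D x)" "\<And>a. smooth_fun A S (\<lambda>x. D x $ a)"
proof -
  \<comment> \<open>The choice does not mention a chart; uniqueness of the gradient identifies it
    with the one computed in any chart.\<close>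
  define D where "D x = (SOME g. kgrad (\<lambda>X. f (\<Gamma> X x)) 0 g)" for x
  note inj = manifold_chart_inj[OF A]
  have loc: "(\<forall>y\<in>\<phi> ` (S \<inter> U). kgrad (\<lambda>X. f (\<Gamma> X (inv_into U \<phi> y))) 0 (D (inv_into U \<phi> y))) \<and>
      (\<forall>a. smooth_scalar_on (\<phi> ` (S \<inter> U)) (\<lambda>y. D (inv_into U \<phi> y) $ a))"
    if U: "(U, \<phi>) \<in> A" for U \<phi>
  proof -
    note injU = chart_injD[OF inj U]
    let ?Q = "\<phi> ` (S \<inter> U)"
    have Q: "open ?Q" using S U by (auto simp: aopen_def)
    define Z where "Z = {z :: 'k^('n + 'm). vsnd z \<in> ?Q}"
    have vs: "smooth_vec_on W (vsnd :: 'k^('n + 'm) \<Rightarrow> _)" "smooth_vec_on W (vfst :: 'k^('n + 'm) \<Rightarrow> _)" for W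
      by (simp_all add: smooth_vec_on_def smooth_scalar_on_def vsnd_def vfst_def Ck_on_nth)
    have Z: "open Z" unfolding Z_def
      using open_vimage[OF Q smooth_vec_on_continuous[OF vs(1)[of UNIV]]] by (simp only: vimage_def)
    have X: "smooth_map vatl Z vatl vfst" and sn: "smooth_map vatl Z vatl vsnd"
      using Z vs by (simp_all add: smooth_map_vatl smooth_vec_on_def)
    have ic: "smooth_map vatl ?Q A (inv_into U \<phi>)"
      by (rule smooth_map_subset[OF smooth_map_inverse_chart[OF A U]]) (use Q in auto)
    have x: "smooth_map vatl Z A (\<lambda>z. inv_into U \<phi> (vsnd z))"
      by (rule smooth_map_compose[OF sn ic]) (auto simp: Z_def)
    note G = \<Gamma>[OF Z X x]
    \<comment> \<open>On \<open>W\<close> the values of \<Gamma> lie in \<open>T\<close>, where f is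
      smooth; all points with X = 0 belong to it.\<close>
    define W where "W = Z \<inter> (\<lambda>z. \<Gamma> (vfst z) (inv_into U \<phi> (vsnd z))) -` T"
    have W: "open W" using smooth_map_aopen[OF G chart_inj_vatl _ B T] by (simp add: W_def)
    have "smooth_map vatl W B (\<lambda>z. \<Gamma> (vfst z) (inv_into U \<phi> (vsnd z)))"
      by (rule smooth_map_subset[OF G]) (use W in \<open>auto simp: W_def\<close>)
    from smooth_fun_compose[OF this f] have
      "smooth_scalar_on W (\<lambda>z. f (\<Gamma> (vfst z) (inv_into U \<phi> (vsnd z))))"
      using W B T by (auto simp: W_def)
    from smooth_scalar_on_gradient[OF this W] obtain g where
      g: "\<And>z. z \<in> W \<Longrightarrow> kgrad (\<lambda>z. f (\<Gamma> (vfst z) (inv_into U \<phi> (vsnd z)))) z (g z)"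
        "\<And>i. smooth_scalar_on W (\<lambda>z. g z $ i)" by blast
    have vj: "vfst (vjoin a b) = a" "vsnd (vjoin a b) = b" for a :: "'k^'n" and b :: "'k^'m"
      by (simp_all add: vfst_def vsnd_def vjoin_def)
    have W0: "vjoin 0 y \<in> W" if "y \<in> ?Q" for y
      using that ST injU by (auto simp: W_def Z_def vj)
    have gd: "kgrad (\<lambda>X. f (\<Gamma> X (inv_into U \<phi> y))) 0 (vfst (g (vjoin 0 y)))" if "y \<in> ?Q" for y
      using kgrad_vjoin[OF g(1)[OF W0[OF that]]] by (simp add: vj)
    hence De: "D (inv_into U \<phi> y) = vfst (g (vjoin 0 y))" if "y \<in> ?Q" for y
      using that kgrad_unique unfolding D_def by (metis someI)
    have "smooth_vec_on ?Q (\<lambda>y. vjoin 0 y :: 'k^('n + 'm))"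
      unfolding smooth_vec_on_def smooth_scalar_on_def vjoin_def
      by (intro allI, rename_tac j r, case_tac j) (simp_all add: Ck_on_nth Ck_on_const)
    from smooth_scalar_on_compose[OF this g(2)] W0
    have "smooth_scalar_on ?Q (\<lambda>y. g (vjoin 0 y) $ Inl a)" for a by blast
    hence "smooth_scalar_on ?Q (\<lambda>y. D (inv_into U \<phi> y) $ a)" for a
      by (rule smooth_scalar_on_cong[OF Q, rotated]) (simp add: De vfst_def)
    thus ?thesis using gd De by simp
  qed
  show ?thesis
  proof
    fix x assume x: "x \<in> S"
    obtain U \<phi> where U: "(U, \<phi>) \<in> A" "x \<in> U" using aopen_chart_at[OF S x] .
    from loc[OF U(1)] x U chart_injD[OF inj U(1)] show "kgrad (\<lambda>X. f (\<Gamma> X x)) 0 (D x)" by force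
  next
    show "smooth_fun A S (\<lambda>x. D x $ a)" for a unfolding smooth_fun_def using loc by (force simp: o_def)
  qed
qed

section \<open>Lie groups and the adjoint action\<close>

abbreviation klinear :: "('k::field^'n \<Rightarrow> 'k^'m) \<Rightarrow> bool" where
  "klinear f \<equiv> Vector_Spaces.linear (*s) (*s) f"

lemma klinearI:
  fixes f :: "'k::field^'n \<Rightarrow> 'k^'m"
  assumes "\<And>x y. f (x + y) = f x + f y" "\<And>c x. f (c *s x) = c *s f x"
  shows "klinear f"
  unfolding Vector_Spaces.linear_def module_hom_def module_hom_axioms_def
  by (intro conjI vec.module_axioms vec.vector_space_axioms allI assms)

lemma klinear_add: "klinear f \<Longrightarrow> f (x + y) = f x + f y"
  unfolding Vector_Spaces.linear_def module_hom_def module_hom_axioms_def by blast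

lemma klinear_smult: "klinear f \<Longrightarrow> f (c *s x) = c *s f x"
  unfolding Vector_Spaces.linear_def module_hom_def module_hom_axioms_def by blast

lemma klinear_zero: "klinear f \<Longrightarrow> f 0 = 0"
  using klinear_smult[of f 0 0] by simp

lemma klinear_minus: "klinear f \<Longrightarrow> f (- x) = - f x"
  using klinear_smult[of f "-1" x] by (simp add: vec.scale_minus_left)

lemma klinear_diff: "klinear f \<Longrightarrow> f (x - y) = f x - f y"
  using klinear_add[of f x "- y"] klinear_minus[of f y] by simp

lemma klinear_sum: "klinear f \<Longrightarrow> f (\<Sum>i\<in>I. g i) = (\<Sum>i\<in>I. f (g i))"
  by (induction I rule: infinite_finite_induct) (auto simp: klinear_zero klinear_add)

lemma klinear_nth: "klinear f \<Longrightarrow> f x $ j = (\<Sum>i\<in>UNIV. x $ i * f (axis i 1) $ j)"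
  by (rule linear_componentwise)

lemma of_real_smult: "of_real a *s (X :: 'k::real_normed_field^'n) = a *\<^sub>R X"
  by (simp add: vec_eq_iff) (simp add: scaleR_conv_of_real)

lemma half_smult: "(1/2) *s (X :: 'k::real_normed_field^'n) = (1/2) *\<^sub>R X"
  using of_real_smult[of "1/2" X] by simp

lemma klinear_bounded:
  fixes f :: "'k::{real_normed_field,euclidean_space}^'n \<Rightarrow> 'k^'m"
  assumes "klinear f" shows "bounded_linear f"
proof -
  have "linear f"
    by (rule linearI) (simp_all add: klinear_add[OF assms] klinear_smult[OF assms] flip: of_real_smult)
  thus ?thesis by (simp add: linear_conv_bounded_linear)
qed

text \<open>Passes from gradients to the one-variable derivatives by which \<open>lie_br\<close> and
  \<open>L_deriv\<close> are defined.\<close>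

lemma kgrad_line:
  assumes "kgrad h 0 g"
  shows "((\<lambda>t. h (t *s X)) has_field_derivative (\<Sum>i\<in>UNIV. g $ i * X $ i)) (at 0)"
proof -
  have d: "((\<lambda>t. t *s X) has_derivative (\<lambda>t. t *s X)) (at 0)"
    by (simp add: vec_has_derivative_iff bounded_linear_imp_has_derivative bounded_linear_mult_left)
  have "((\<lambda>t. h (t *s X)) has_derivative (\<lambda>t. \<Sum>i\<in>UNIV. g $ i * (t *s X) $ i)) (at 0)"
    by (rule has_derivative_compose[OF d]) (use assms in \<open>simp add: kgrad_def\<close>)
  moreover have "(\<Sum>i\<in>UNIV. g $ i * (t *s X) $ i) = (\<Sum>i\<in>UNIV. g $ i * X $ i) * t" for t
    by (simp add: sum_distrib_left sum_distrib_right mult_ac)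
  ultimately show ?thesis by (simp add: has_field_derivative_def)
qed

lemma smooth_scalar_on_gradient_ex:
  assumes "smooth_scalar_on S f" "open S"
  shows "\<exists>g. (\<forall>x\<in>S. kgrad f x (g x)) \<and> (\<forall>i. smooth_scalar_on S (\<lambda>x. g x $ i))"
proof (rule smooth_scalar_on_gradient[OF assms])
  fix g assume "\<And>x. x \<in> S \<Longrightarrow> kgrad f x (g x)" "\<And>i. smooth_scalar_on S (\<lambda>x. g x $ i)"
  thus ?thesis by (intro exI[of _ g]) simp
qed

section \<open>Smoothness of the group operations and of the exponential map\<close>

locale lie =
  fixes G :: "('a, 'k::{real_normed_field,euclidean_space}, 'n::finite) lie_group_data" (structure)
  assumes lie: "lie_group G"
begin

lemma is_group: "Group.group G"
  using lie by (simp add: lie_group_def)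

end

sublocale lie \<subseteq> group G by (rule is_group)

context lie begin

lemma mfd: "smooth_manifold (carrier G) (atlas G)"
  using lie by (simp add: lie_group_def)

lemma inj_charts: "chart_inj (atlas G)"
  by (rule manifold_chart_inj[OF mfd])

lemma carrier_charts: "\<Union>(fst ` atlas G) = carrier G"
  by (rule manifold_carrier[OF mfd])

lemma aopen_carrier: "aopen (atlas G) (carrier G)"
  by (rule aopen_manifold[OF mfd])

lemma aopen_subset_carrier: "aopen (atlas G) S \<Longrightarrow> S \<subseteq> carrier G"
  using carrier_charts unfolding aopen_def by blast

lemma sm_closed: "smooth_map A S (atlas G) f \<Longrightarrow> x \<in> S \<Longrightarrow> f x \<in> carrier G"
  using smooth_map_in[of A S "atlas G" f x] unfolding carrier_charts .

lemma sm_mult: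
  assumes "chart_inj A" "smooth_map A S (atlas G) f" "smooth_map A S (atlas G) g"
  shows "smooth_map A S (atlas G) (\<lambda>z. f z \<otimes> g z)"
proof -
  have m: "smooth_map (prod_atlas (atlas G) (atlas G)) (carrier G \<times> carrier G) (atlas G) (\<lambda>(x, y). x \<otimes> y)"
    using lie by (simp add: lie_group_def)
  have "(\<lambda>z. (f z, g z)) ` S \<subseteq> carrier G \<times> carrier G"
    using sm_closed[OF assms(2)] sm_closed[OF assms(3)] by blast
  from smooth_map_compose[OF smooth_map_Pair[OF assms(2,3,1)] m this assms(1) prod_atlas_chart_inj[OF inj_charts inj_charts]]
  show ?thesis by simp
qed

lemma sm_inv:
  assumes "chart_inj A" "smooth_map A S (atlas G) f"
  shows "smooth_map A S (atlas G) (\<lambda>z. inv (f z))"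
proof -
  have m: "smooth_map (atlas G) (carrier G) (atlas G) (\<lambda>x. inv x)"
    using lie by (simp add: lie_group_def)
  show ?thesis
    by (rule smooth_map_compose[OF assms(2) m _ assms(1) inj_charts]) (use sm_closed[OF assms(2)] in blast)
qed

lemma exp_smooth: "smooth_map vatl UNIV (atlas G) (lexp G)"
  using lie by (simp add: lie_group_def)

lemma sm_exp:
  assumes "chart_inj A" "smooth_map A S vatl X"
  shows "smooth_map A S (atlas G) (\<lambda>z. lexp G (X z))"
  by (rule smooth_map_compose[OF assms(2) exp_smooth _ assms(1) chart_inj_vatl]) blast

lemma sm_const: "aopen A S \<Longrightarrow> c \<in> carrier G \<Longrightarrow> smooth_map A S (atlas G) (\<lambda>_. c)"
  by (rule smooth_map_const) (simp_all add: carrier_charts)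

lemma exp_closed [simp]: "lexp G X \<in> carrier G"
  by (rule sm_closed[OF exp_smooth UNIV_I])

lemma exp_add: "lexp G ((s + t) *s X) = lexp G (s *s X) \<otimes> lexp G (t *s X)"
  using lie unfolding lie_group_def by blast

lemma exp_zero [simp]: "lexp G 0 = \<one>"
proof -
  have "lexp G 0 \<otimes> lexp G 0 = lexp G 0" using exp_add[of 0 0 0, symmetric] by simp
  thus ?thesis by (rule l_cancel_one[THEN iffD1, OF exp_closed exp_closed])
qed

lemma exp_minus: "lexp G (- X) = inv (lexp G X)"
proof -
  have "lexp G (- X) \<otimes> lexp G X = \<one>"
    using exp_add[of "-1" 1 X] by (simp add: vec.scale_minus_left)
  thus ?thesis by (rule inv_equality[OF _ exp_closed exp_closed, symmetric])
qed

lemma exp_half: "lexp G X = lexp G ((1/2) *s X) \<otimes> lexp G ((1/2) *s X)"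
proof -
  have e: "1/2 + 1/2 = (1::'k)" by simp
  show ?thesis using exp_add[of "1/2" "1/2" X] by (simp only: e vec.scale_one)
qed

section \<open>The exponential map as a local chart\<close>

text \<open>\<open>N\<close> is a neighbourhood of 0 on which the exponential map is injective with
  open image, \<open>Lg\<close> is the logarithm read in the chart \<phi>, and \<open>l\<close> is
  its derivative at the unit.\<close>

definition exp_chart where
  "exp_chart U \<phi> N Lg l \<longleftrightarrow> (U, \<phi>) \<in> atlas G \<and> \<one> \<in> U \<and> open N \<and> 0 \<in> N \<and>
    lexp G ` N \<subseteq> U \<and> open (\<phi> ` lexp G ` N) \<and> (\<forall>X\<in>N. Lg (\<phi> (lexp G X)) = X) \<and>
    (Lg has_derivative l) (at (\<phi> \<one>)) \<and> klinear l"

lemma exp_chartD: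
  assumes "exp_chart U \<phi> N Lg l"
  shows "(U, \<phi>) \<in> atlas G" "\<one> \<in> U" "open N" "0 \<in> N"
    "lexp G ` N \<subseteq> U" "open (\<phi> ` lexp G ` N)" "\<And>X. X \<in> N \<Longrightarrow> Lg (\<phi> (lexp G X)) = X"
    "(Lg has_derivative l) (at (\<phi> \<one>))" "klinear l"
  using assms by (auto simp: exp_chart_def)

text \<open>The inverse function theorem for \<open>lexp\<close> in a chart at the unit, where
  \<open>lie_group\<close> provides a bijective derivative. That theorem is about real derivatives,
  so linearity of the inverse over the ground field is read off from that of
  \<open>dE 0\<close>.\<close>

lemma exp_local: "\<exists>U \<phi> N Lg l. exp_chart U \<phi> N Lg l"
proof -
  obtain U \<phi> where U: "(U, \<phi>) \<in> atlas G" "\<one> \<in> U" "U \<subseteq> carrier G" "inj_on \<phi> U" "open (\<phi> ` U)"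
    using manifold_chart_at[OF mfd one_closed] .
  define Q where "Q = lexp G -` U"
  have aU: "aopen (atlas G) U" by (rule aopen_chart[OF mfd U(1)])
  have Q: "open Q"
    using smooth_map_aopen[OF exp_smooth chart_inj_vatl _ inj_charts aU] by (simp add: Q_def)
  have Q0: "0 \<in> Q" using U by (simp add: Q_def)
  have "smooth_map vatl Q (atlas G) (lexp G)" by (rule smooth_map_subset[OF exp_smooth]) (use Q in auto)
  from smooth_fun_compose[OF this smooth_fun_chart[OF mfd U(1)] _ chart_inj_vatl inj_charts _ aU]
  have sm: "smooth_scalar_on Q (\<lambda>X. \<phi> (lexp G X) $ i)" for i using Q by (simp add: Q_def)
  have "\<forall>i. \<exists>g. (\<forall>X\<in>Q. kgrad (\<lambda>X. \<phi> (lexp G X) $ i) X (g X)) \<and> (\<forall>j. smooth_scalar_on Q (\<lambda>X. g X $ j))"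
    using smooth_scalar_on_gradient_ex[OF sm Q] ..
  from choice[OF this] obtain g where
    g: "\<And>i X. X \<in> Q \<Longrightarrow> kgrad (\<lambda>X. \<phi> (lexp G X) $ i) X (g i X)"
      "\<And>i j. smooth_scalar_on Q (\<lambda>X. g i X $ j)" by blast
  define dE where "dE X h = (\<chi> i. \<Sum>j\<in>UNIV. g i X $ j * h $ j)" for X h
  have klin: "klinear (dE X)" for X
    by (rule klinearI) (simp_all add: dE_def vec_eq_iff sum.distrib distrib_left sum_distrib_left mult.left_commute)
  define E where "E X = \<phi> (lexp G X)" for X
  have der: "(E has_derivative dE X) (at X)" if "X \<in> Q" for X
    using g(1)[OF that] by (simp add: vec_has_derivative_iff dE_def kgrad_def E_def)
  note bl = klinear_bounded[OF klin]
  define f' where "f' X = Blinfun (dE X)" for X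
  have ap: "blinfun_apply (f' X) = dE X" for X
    by (simp add: f'_def bounded_linear_Blinfun_apply[OF bl])
  have cont: "continuous_on Q f'"
  proof (rule continuous_on_blinfun_componentwise)
    fix i show "continuous_on Q (\<lambda>x. blinfun_apply (f' x) i)"
      unfolding ap dE_def
      by (intro continuous_on_vec_lambda continuous_on_sum continuous_on_mult continuous_on_const
          smooth_scalar_on_continuous[OF g(2)])
  qed
  have "\<exists>L. (\<phi> \<circ> lexp G has_derivative L) (at 0) \<and> bij L"
    using lie U(1,2) unfolding lie_group_def by (elim conjE) (drule (1) bspec, simp)
  then obtain L where L: "(\<phi> \<circ> lexp G has_derivative L) (at 0)" "bij L" by (elim exE conjE)
  have "L = dE 0" using has_derivative_unique[OF L(1), of "dE 0"] der[OF Q0] by (simp add: E_def[abs_def] o_def)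
  with L(2) have bij: "bij (dE 0)" by simp
  have "linear (dE 0)" using bl by (simp add: linear_conv_bounded_linear)
  from linear_injective_left_inverse[OF this bij_is_inj[OF bij]] obtain i where
    i: "linear i" "i \<circ> dE 0 = id" by blast
  have invf: "Blinfun i o\<^sub>L f' 0 = id_blinfun"
    using i(2) by (intro blinfun_eqI) (simp add: ap bounded_linear_Blinfun_apply[OF linear_conv_bounded_linear[THEN iffD1, OF i(1)]] fun_eq_iff)
  have der': "\<And>x. x \<in> Q \<Longrightarrow> (E has_derivative blinfun_apply (f' x)) (at x)" using der by (simp add: ap)
  obtain N V Lg g' where N: "open N" "N \<subseteq> Q" "0 \<in> N" "open V" "E 0 \<in> V" "homeomorphism N V E Lg"
    "\<And>y. y \<in> V \<Longrightarrow> (Lg has_derivative (g' y)) (at y)"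
    "\<And>y. y \<in> V \<Longrightarrow> g' y = inv_into UNIV (blinfun_apply (f' (Lg y)))" "\<And>y. y \<in> V \<Longrightarrow> bij (blinfun_apply (f' (Lg y)))"
  proof (rule inverse_function_theorem[OF Q der' cont Q0 invf], goal_cases)
    case 1 thus ?case by simp
  next
    case (2 N V Lg g')
    show ?case by (rule 2(1)) (fact 2)+
  qed
  have "Lg (E 0) = 0" using N(3,6) by (simp add: homeomorphism_def)
  hence "g' (E 0) = inv_into UNIV (dE 0)" using N(8)[OF N(5)] by (simp add: ap)
  hence d: "(Lg has_derivative inv_into UNIV (dE 0)) (at (\<phi> \<one>))" using N(7)[OF N(5)] by (simp add: E_def)
  have kl: "klinear (inv_into UNIV (dE 0))"
  proof (rule klinearI)
    have s: "dE 0 (inv_into UNIV (dE 0) x) = x" for x using bij by (simp add: bij_is_surj surj_f_inv_f)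
    have ii: "inv_into UNIV (dE 0) (dE 0 x) = x" for x using bij by (simp add: bij_is_inj)
    show "inv_into UNIV (dE 0) (x + y) = inv_into UNIV (dE 0) x + inv_into UNIV (dE 0) y" for x y
      using ii[of "inv_into UNIV (dE 0) x + inv_into UNIV (dE 0) y"] by (simp add: klinear_add[OF klin] s)
    show "inv_into UNIV (dE 0) (c *s x) = c *s inv_into UNIV (dE 0) x" for c x
      using ii[of "c *s inv_into UNIV (dE 0) x"] by (simp add: klinear_smult[OF klin] s)
  qed
  have NU: "lexp G ` N \<subseteq> U" using N(2) by (auto simp: Q_def)
  have oN: "open (\<phi> ` lexp G ` N)"
  proof -
    have "\<phi> ` lexp G ` N = V" using N(6) by (auto simp: homeomorphism_def E_def image_image)
    thus ?thesis using N by simp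
  qed
  have Lg: "Lg (\<phi> (lexp G X)) = X" if "X \<in> N" for X
    using N(6) that by (auto simp: homeomorphism_def E_def)
  have "exp_chart U \<phi> N Lg (inv_into UNIV (dE 0))"
    unfolding exp_chart_def using U(1,2) N(1,3) NU oN Lg d kl by (intro conjI ballI)
  thus ?thesis by (intro exI)
qed

section \<open>Halving arguments and one-parameter subgroups\<close>

lemma power_half_tendsto: "(\<lambda>n. (1/2) ^ n *\<^sub>R (X :: 'k^'p)) \<longlonglongrightarrow> 0"
proof -
  have "(\<lambda>n. (1/2 :: real) ^ n) \<longlonglongrightarrow> 0" by (rule LIMSEQ_power_zero) simp
  from tendsto_scaleR[OF this tendsto_const[of X]] show ?thesis by simp
qed

lemma power_half_eventually:
  assumes "open N" "0 \<in> N"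
  shows "eventually (\<lambda>n. (1/2) ^ n *\<^sub>R (X :: 'k^'p) \<in> N) sequentially"
  using topological_tendstoD[OF power_half_tendsto assms] .

text \<open>Carries an identity known near 0 to all vectors: (1/2)^n X is near 0 for large n, and n
  doublings lead back to X.\<close>

lemma halving_induct:
  fixes X :: "'k^'p"
  assumes "Q ((1/2) ^ n *\<^sub>R X)" "\<And>X. Q ((1/2) *s X) \<Longrightarrow> Q X"
  shows "Q X"
  using assms(1)
proof (induction n)
  case (Suc n)
  have "(1/2) ^ Suc n *\<^sub>R X = (1/2) *s ((1/2) ^ n *\<^sub>R X)"
    unfolding half_smult scaleR_scaleR power_Suc ..
  hence "Q ((1/2) *s ((1/2) ^ n *\<^sub>R X))" using Suc.prems by (simp only:)
  thus ?case by (rule Suc.IH[OF assms(2)])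
qed simp

text \<open>The uniqueness behind the definite description in \<open>Ad\<close>. The exponential is
  injective only near 0, so the lines are compared at the small parameter (1/2)^n.\<close>

lemma exp_line_inj:
  assumes "\<And>t. lexp G (t *s X) = lexp G (t *s Y)"
  shows "X = Y"
proof -
  obtain U \<phi> N Lg l where "exp_chart U \<phi> N Lg l" using exp_local by (elim exE)
  note N = exp_chartD(3-7)[OF this]
  from eventually_conj[OF power_half_eventually[OF N(1,2), of X] power_half_eventually[OF N(1,2), of Y]]
  obtain n where n: "(1/2) ^ n *\<^sub>R X \<in> N" "(1/2) ^ n *\<^sub>R Y \<in> N"
    by (auto simp: eventually_sequentially)
  have "lexp G ((1/2) ^ n *\<^sub>R X) = lexp G ((1/2) ^ n *\<^sub>R Y)"
    using assms[of "of_real ((1/2) ^ n)"] unfolding of_real_smult .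
  with N(5)[OF n(1)] N(5)[OF n(2)] have "(1/2) ^ n *\<^sub>R X = (1/2) ^ n *\<^sub>R Y" by metis
  thus ?thesis by simp
qed

text \<open>Near \<open>0\<close> write \<open>F = exp \<circ> Y\<close>.  Local injectivity of the exponential map forces \<open>Y X = 2 Y (X / 2)\<close>, so
  \<open>Y\<close> coincides with its derivative at \<open>0\<close>.\<close>

lemma one_parameter_map:
  fixes F :: "'k^'p::finite \<Rightarrow> 'a"
  assumes F: "smooth_map vatl UNIV (atlas G) F"
    and half: "\<And>X. F X = F ((1/2) *s X) \<otimes> F ((1/2) *s X)"
  obtains A where "klinear A" "\<And>X. F X = lexp G (A X)"
proof -
  note Fc = sm_closed[OF F UNIV_I]
  have F0: "F 0 = \<one>" using half[of 0, symmetric] Fc[of 0] l_cancel_one[of "F 0" "F 0"] by simp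
  obtain U \<phi> N Lg l where ec: "exp_chart U \<phi> N Lg l" using exp_local by (elim exE)
  note U = exp_chartD(1,2)[OF ec] and N = exp_chartD(3-7)[OF ec] and l = exp_chartD(8,9)[OF ec]
  have aU: "aopen (atlas G) U" by (rule aopen_chart[OF mfd U(1)])
  define W where "W = F -` U"
  have W: "open W" "0 \<in> W"
    using smooth_map_aopen[OF F chart_inj_vatl _ inj_charts aU] U F0 by (simp_all add: W_def)
  have "smooth_map vatl W (atlas G) F" by (rule smooth_map_subset[OF F]) (use W in auto)
  from smooth_fun_compose[OF this smooth_fun_chart[OF mfd U(1)] _ chart_inj_vatl inj_charts _ aU]
  have sm: "smooth_scalar_on W (\<lambda>X. \<phi> (F X) $ i)" for i using W by (simp add: W_def)
  have "\<forall>i. \<exists>g. kgrad (\<lambda>X. \<phi> (F X) $ i) 0 g"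
    using smooth_scalar_on_gradient_ex[OF sm W(1)] W(2) by (intro allI) (meson bspec)
  from choice[OF this] obtain g where g: "\<And>i. kgrad (\<lambda>X. \<phi> (F X) $ i) 0 (g i)" by blast
  define df where "df h = (\<chi> i. \<Sum>j\<in>UNIV. g i $ j * h $ j)" for h
  have kdf: "klinear df"
    by (rule klinearI) (simp_all add: df_def vec_eq_iff sum.distrib distrib_left sum_distrib_left mult.left_commute)
  have ddf: "((\<lambda>X. \<phi> (F X)) has_derivative df) (at 0)"
    using g by (simp add: vec_has_derivative_iff df_def kgrad_def)
  define Y where "Y X = Lg (\<phi> (F X))" for X
  define A where "A X = l (df X)" for X
  have kA: "klinear A"
    by (rule klinearI) (simp_all add: A_def klinear_add[OF kdf] klinear_smult[OF kdf] klinear_add[OF l(2)] klinear_smult[OF l(2)])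
  have dY: "(Y has_derivative A) (at 0)"
    unfolding Y_def[abs_def] A_def[abs_def]
    by (rule has_derivative_compose[OF ddf]) (use l F0 in simp)
  have Y0: "Y 0 = 0" using N(5)[OF N(2)] by (simp add: Y_def F0)
  have "continuous_on W (\<lambda>X. \<chi> i. \<phi> (F X) $ i)"
    by (intro continuous_on_vec_lambda smooth_scalar_on_continuous sm)
  hence cW: "continuous_on W (\<lambda>X. \<phi> (F X))" by simp
  \<comment> \<open>On \<open>P\<close> the values of F are exponentials of vectors in
    \<open>N\<close>, so \<open>Y\<close> is a genuine logarithm of F there.\<close>
  define P where "P = W \<inter> (\<lambda>X. \<phi> (F X)) -` (\<phi> ` lexp G ` N)"
  have P: "open P" unfolding P_def by (rule continuous_open_preimage[OF cW W(1) N(4)])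
  have P0: "0 \<in> P" using W(2) N(2) F0 by (auto simp: P_def intro!: image_eqI[of _ _ 0])
  have PY: "Y X \<in> N \<and> F X = lexp G (Y X)" if X: "X \<in> P" for X
  proof -
    obtain Z where Z: "Z \<in> N" "\<phi> (F X) = \<phi> (lexp G Z)" using X by (auto simp: P_def)
    have "F X = lexp G Z"
      using Z N(3) X chart_injD[OF inj_charts U(1)] by (auto simp: P_def W_def inj_on_def)
    moreover have "Y X = Z" using Z N(5) by (simp add: Y_def)
    ultimately show ?thesis using Z by simp
  qed
  have cY: "(Y \<longlongrightarrow> 0) (nhds 0)"
    using has_derivative_continuous[OF dY] tendsto_at_iff_tendsto_nhds[of Y 0]
    by (simp add: continuous_within Y0)
  have half0: "((\<lambda>X::'k^'p. (1/2) *\<^sub>R X) \<longlongrightarrow> 0) (nhds 0)"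
    using tendsto_scaleR[OF tendsto_const[of "1/2"] filterlim_ident[of "nhds (0::'k^'p)"]] by simp
  have two: "((\<lambda>X. 2 *\<^sub>R Y ((1/2) *\<^sub>R X)) \<longlongrightarrow> 0) (nhds 0)"
    using tendsto_scaleR[OF tendsto_const[of "2"] filterlim_compose[OF cY half0]] by simp
  have "eventually (\<lambda>X. X \<in> P) (nhds 0)" using P P0 by (simp add: eventually_nhds_in_open)
  moreover have "eventually (\<lambda>X. (1/2) *\<^sub>R X \<in> P) (nhds 0)"
    using topological_tendstoD[OF half0 P P0] .
  moreover have "eventually (\<lambda>X. 2 *\<^sub>R Y ((1/2) *\<^sub>R X) \<in> N) (nhds 0)"
    using topological_tendstoD[OF two N(1,2)] .
  ultimately have "eventually (\<lambda>X. X \<in> P \<and> (1/2) *\<^sub>R X \<in> P \<and> 2 *\<^sub>R Y ((1/2) *\<^sub>R X) \<in> N) (nhds 0)"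
    by eventually_elim simp
  then obtain \<delta> where \<delta>: "\<delta> > 0"
    "\<And>X. norm X < \<delta> \<Longrightarrow> X \<in> P \<and> (1/2) *\<^sub>R X \<in> P \<and> 2 *\<^sub>R Y ((1/2) *\<^sub>R X) \<in> N"
    by (auto simp: eventually_nhds_metric)
  \<comment> \<open>Both Y X and 2 Y (X / 2) lie in \<open>N\<close> and have exponential F X, so
    local injectivity identifies them.\<close>
  have dbl: "Y ((1/2) *\<^sub>R X) = (1/2) *\<^sub>R Y X" if X: "norm X < \<delta>" for X
  proof -
    let ?Z = "2 *\<^sub>R Y ((1/2) *\<^sub>R X)"
    have "lexp G (Y X) = F ((1/2) *\<^sub>R X) \<otimes> F ((1/2) *\<^sub>R X)"
      using PY \<delta>(2)[OF X] half[of X] by (simp add: half_smult)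
    also have "\<dots> = lexp G ?Z" using PY \<delta>(2)[OF X] exp_half[of ?Z] by (simp add: half_smult)
    finally have "Y X = ?Z" using N(5) PY \<delta>(2)[OF X] by metis
    thus ?thesis by simp
  qed
  have pw: "Y ((1/2) ^ n *\<^sub>R X) = (1/2) ^ n *\<^sub>R Y X" if X: "norm X < \<delta>" for X n
  proof (induction n)
    case (Suc n)
    have "norm ((1/2) ^ n *\<^sub>R X) \<le> norm X" by (simp add: mult_left_le_one_le power_le_one)
    from dbl[of "(1/2) ^ n *\<^sub>R X"] this X Suc show ?case by simp
  qed simp
  have YA: "Y X = A X" if X: "norm X < \<delta>" for X
  proof (cases "X = 0")
    case True thus ?thesis by (simp add: Y0 klinear_zero[OF kA])
  next
    case False
    have "filterlim (\<lambda>n. (1/2) ^ n *\<^sub>R X) (at 0) sequentially"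
      unfolding filterlim_at using power_half_tendsto[of X] False by simp
    moreover have "((\<lambda>h. norm (Y (0 + h) - Y 0 - A h) / norm h) \<longlongrightarrow> 0) (at 0)"
      using dY by (simp add: has_derivative_at)
    ultimately have "(\<lambda>n. norm (Y (0 + (1/2) ^ n *\<^sub>R X) - Y 0 - A ((1/2) ^ n *\<^sub>R X)) / norm ((1/2) ^ n *\<^sub>R X)) \<longlonglongrightarrow> 0"
      by (rule filterlim_compose[rotated])
    \<comment> \<open>By homogeneity under halving this difference quotient does not depend on n, so
      its limit 0 is already its value.\<close>
    moreover have "norm (Y (0 + (1/2) ^ n *\<^sub>R X) - Y 0 - A ((1/2) ^ n *\<^sub>R X)) / norm ((1/2) ^ n *\<^sub>R X) = norm (Y X - A X) / norm X" for n
    proof -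
      have "A ((1/2) ^ n *\<^sub>R X) = (1/2) ^ n *\<^sub>R A X"
        unfolding of_real_smult[symmetric] by (rule klinear_smult[OF kA])
      thus ?thesis by (simp add: pw[OF X] Y0 flip: scaleR_diff_right)
    qed
    ultimately have "norm (Y X - A X) / norm X = 0" by (simp add: LIMSEQ_const_iff)
    thus ?thesis using False by simp
  qed
  have "F X = lexp G (A X)" for X
  proof -
    from power_half_eventually[of "ball 0 \<delta>" X] \<delta>(1) obtain n where n: "norm ((1/2) ^ n *\<^sub>R X) < \<delta>"
      by (auto simp: eventually_sequentially)
    have "F ((1/2) ^ n *\<^sub>R X) = lexp G (A ((1/2) ^ n *\<^sub>R X))"
      using PY \<delta>(2)[OF n] YA[OF n] by metis
    thus ?thesis
      by (rule halving_induct[where Q="\<lambda>X. F X = lexp G (A X)"]) (metis half exp_half klinear_smult[OF kA])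
  qed
  with kA show ?thesis by (rule that)
qed

section \<open>The adjoint action\<close>

lemma conj_half:
  assumes g: "g \<in> carrier G"
  shows "g \<otimes> lexp G X \<otimes> inv g =
    (g \<otimes> lexp G ((1/2) *s X) \<otimes> inv g) \<otimes> (g \<otimes> lexp G ((1/2) *s X) \<otimes> inv g)"
proof -
  have c: "inv g \<otimes> (g \<otimes> z) = z" if "z \<in> carrier G" for z
    using g that by (simp add: m_assoc[symmetric])
  have "g \<otimes> (e \<otimes> e) \<otimes> inv g =
    (g \<otimes> e \<otimes> inv g) \<otimes> (g \<otimes> e \<otimes> inv g)" if "e \<in> carrier G" for e
    using g that by (simp add: m_assoc c)
  thus ?thesis unfolding exp_half[of X] by simp
qed

lemma Ad_eqI:
  assumes "\<And>t. g \<otimes> lexp G (t *s X) \<otimes> inv g = lexp G (t *s Y)"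
  shows "Ad G g X = Y"
  unfolding Ad_def
proof (rule the_equality)
  fix Z assume Z: "\<forall>t. g \<otimes> lexp G (t *s X) \<otimes> inv g = lexp G (t *s Z)"
  show "Z = Y" by (rule exp_line_inj) (rule trans[OF sym[OF spec[OF Z]] assms])
qed (intro allI assms)

text \<open>Conjugation respects squares, hence the halving identity, and
  \<open>one_parameter_map\<close> supplies a linear map. This is also the existence behind the
  definite description in \<open>Ad\<close>.\<close>

lemma Ad_linear_exp:
  assumes g: "g \<in> carrier G"
  shows "klinear (Ad G g) \<and> (\<forall>X. g \<otimes> lexp G X \<otimes> inv g = lexp G (Ad G g X))"
proof -
  have "smooth_map vatl UNIV (atlas G) (\<lambda>X. g \<otimes> lexp G X \<otimes> inv g)"
    using g by (intro sm_mult sm_const exp_smooth chart_inj_vatl) auto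
  from one_parameter_map[OF this conj_half[OF g]] obtain A where
    A: "klinear A" "\<And>X. g \<otimes> lexp G X \<otimes> inv g = lexp G (A X)" by metis
  have "Ad G g X = A X" for X by (rule Ad_eqI) (simp add: A(2) klinear_smult[OF A(1)])
  hence "Ad G g = A" by blast
  thus ?thesis using A by simp
qed

lemma Ad_linear: "g \<in> carrier G \<Longrightarrow> klinear (Ad G g)"
  using Ad_linear_exp by blast

lemma Ad_exp: "g \<in> carrier G \<Longrightarrow> g \<otimes> lexp G X \<otimes> inv g = lexp G (Ad G g X)"
  using Ad_linear_exp by blast

lemma mult_exp: "g \<in> carrier G \<Longrightarrow> g \<otimes> lexp G X = lexp G (Ad G g X) \<otimes> g"
  by (simp add: Ad_exp[symmetric] m_assoc)

lemma Ad_mult: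
  assumes "g \<in> carrier G" "h \<in> carrier G"
  shows "Ad G (g \<otimes> h) X = Ad G g (Ad G h X)"
proof (rule Ad_eqI)
  fix t
  have "g \<otimes> h \<otimes> lexp G (t *s X) \<otimes> inv (g \<otimes> h) =
    g \<otimes> (h \<otimes> lexp G (t *s X) \<otimes> inv h) \<otimes> inv g"
    using assms by (simp add: inv_mult_group m_assoc)
  thus "g \<otimes> h \<otimes> lexp G (t *s X) \<otimes> inv (g \<otimes> h) = lexp G (t *s Ad G g (Ad G h X))"
    by (simp add: Ad_exp assms klinear_smult[OF Ad_linear])
qed

lemma Ad_one: "Ad G \<one> X = X"
  by (rule Ad_eqI) simp

lemma Ad_inv: "g \<in> carrier G \<Longrightarrow> Ad G (inv g) (Ad G g X) = X"
  using Ad_mult[of "inv g" g X] by (simp add: Ad_one)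

lemma Ad_inv': "g \<in> carrier G \<Longrightarrow> Ad G g (Ad G (inv g) X) = X"
  using Ad_mult[of g "inv g" X] by (simp add: Ad_one)

lemma Ad_exp_self: "Ad G (lexp G (s *s X)) X = X"
proof (rule Ad_eqI)
  fix t
  have "lexp G (s *s X) \<otimes> lexp G (t *s X) = lexp G (t *s X) \<otimes> lexp G (s *s X)"
    unfolding exp_add[symmetric] by (simp only: add.commute)
  thus "lexp G (s *s X) \<otimes> lexp G (t *s X) \<otimes> inv lexp G (s *s X) = lexp G (t *s X)"
    by (simp add: m_assoc)
qed

text \<open>In the exponential chart \<open>X \<mapsto> g exp X g\<^sup>-\<^sup>1\<close> is the linear map \<open>Ad g\<close>, whence \<open>Ad g\<close> is recovered from the
  derivative of \<open>X \<mapsto> \<phi> (g exp X g\<^sup>-\<^sup>1)\<close> in an arbitrary chart.\<close>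

lemma Ad_smooth: "smooth_fun (atlas G) (carrier G) (\<lambda>g. Ad G g Y $ j)"
proof -
  obtain U \<phi> N Lg l where ec: "exp_chart U \<phi> N Lg l" using exp_local by (elim exE)
  note U = exp_chartD(1,2)[OF ec] and N = exp_chartD(3-7)[OF ec] and l = exp_chartD(8,9)[OF ec]
  let ?\<Gamma> = "\<lambda>X g. g \<otimes> lexp G X \<otimes> inv g"
  have "\<exists>D. (\<forall>g\<in>carrier G. kgrad (\<lambda>X. \<phi> (?\<Gamma> X g) $ i) 0 (D g)) \<and> (\<forall>a. smooth_fun (atlas G) (carrier G) (\<lambda>g. D g $ a))" for i
  proof (rule smooth_parametric_derivative[OF mfd inj_charts aopen_carrier aopen_chart[OF mfd U(1)] _ smooth_fun_chart[OF mfd U(1), of i], where \<Gamma>="?\<Gamma>"], goal_cases)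
    case (1 Z X x) thus ?case by (intro sm_mult sm_exp sm_inv chart_inj_vatl)
  next
    case (2 x) thus ?case using U by simp
  next
    case (3 D) thus ?case by (intro exI[of _ D]) simp
  qed
  hence "\<forall>i. \<exists>D. (\<forall>g\<in>carrier G. kgrad (\<lambda>X. \<phi> (?\<Gamma> X g) $ i) 0 (D g)) \<and> (\<forall>a. smooth_fun (atlas G) (carrier G) (\<lambda>g. D g $ a))" by (rule allI)
  from choice[OF this] obtain D where D: "\<And>i g. g \<in> carrier G \<Longrightarrow> kgrad (\<lambda>X. \<phi> (?\<Gamma> X g) $ i) 0 (D i g)"
    "\<And>i a. smooth_fun (atlas G) (carrier G) (\<lambda>g. D i g $ a)" by blast
  have Ad: "Ad G g h = l (\<chi> i. \<Sum>a\<in>UNIV. D i g $ a * h $ a)" if g: "g \<in> carrier G" for g h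
  proof -
    note A = Ad_linear[OF g]
    have d1: "((\<lambda>X. \<phi> (?\<Gamma> X g)) has_derivative (\<lambda>h. \<chi> i. \<Sum>a\<in>UNIV. D i g $ a * h $ a)) (at 0)"
      using D(1)[OF g] by (simp add: vec_has_derivative_iff kgrad_def)
    have "?\<Gamma> 0 g = \<one>" using g by simp
    with l(1) have d2: "(Lg has_derivative l) (at (\<phi> (?\<Gamma> 0 g)))" by simp
    have d3: "((\<lambda>X. Lg (\<phi> (?\<Gamma> X g))) has_derivative (\<lambda>h. l (\<chi> i. \<Sum>a\<in>UNIV. D i g $ a * h $ a))) (at 0)"
      by (rule has_derivative_compose[OF d1 d2])
    have o: "open (Ad G g -` N)"
      using open_vimage[OF N(1) linear_continuous_on[OF klinear_bounded[OF A]]] .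
    have d4: "(Ad G g has_derivative (\<lambda>h. l (\<chi> i. \<Sum>a\<in>UNIV. D i g $ a * h $ a))) (at 0)"
      by (rule has_derivative_transform_within_open[OF d3 o])
        (use N(2,5) in \<open>simp_all add: klinear_zero[OF A] Ad_exp[OF g]\<close>)
    have "(Ad G g has_derivative Ad G g) (at 0)"
      by (rule bounded_linear_imp_has_derivative[OF klinear_bounded[OF A]])
    from fun_cong[OF has_derivative_unique[OF this d4]] show ?thesis .
  qed
  have e: "(\<Sum>i\<in>UNIV. (\<Sum>a\<in>UNIV. D i g $ a * Y $ a) * l (axis i 1) $ j) = Ad G g Y $ j"
    if "g \<in> carrier G" for g
    unfolding Ad[OF that] by (subst klinear_nth[OF l(2)]) simp
  have "smooth_fun (atlas G) (carrier G) (\<lambda>g. \<Sum>i\<in>UNIV. (\<Sum>a\<in>UNIV. D i g $ a * Y $ a) * l (axis i 1) $ j)"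
    by (intro smooth_fun_sum smooth_fun_mult D(2) smooth_fun_const)
  thus ?thesis
    by (rule smooth_fun_cong[OF inj_charts aopen_carrier, rotated]) (rule e)
qed

text \<open>Existence of the derivatives in \<open>L_deriv\<close> and their smoothness in the
  point. Applied to the entries of Ad at the unit, it also makes \<open>lie_br\<close> a derivative
  that exists.\<close>

lemma left_translation_derivative:
  assumes T: "aopen (atlas G) T" and f: "smooth_fun (atlas G) T f"
  shows "\<exists>D. (\<forall>x\<in>T. kgrad (\<lambda>X. f (lexp G X \<otimes> x)) 0 (D x)) \<and> (\<forall>a. smooth_fun (atlas G) T (\<lambda>x. D x $ a))"
proof (rule smooth_parametric_derivative[OF mfd inj_charts T T _ f, where \<Gamma>="\<lambda>X x. lexp G X \<otimes> x"], goal_cases)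
  case (1 Z X x) thus ?case by (intro sm_mult sm_exp chart_inj_vatl)
next
  case (2 x) thus ?case using aopen_subset_carrier[OF T] by auto
next
  case (3 D) thus ?case by (intro exI[of _ D]) simp
qed

section \<open>The Lie bracket as the derivative of the adjoint action\<close>

text \<open>A gradient in X, rather than derivatives along separate lines, is what makes the bracket
  linear in its first argument.\<close>

lemma lie_br_gradient:
  "\<exists>b. \<forall>j. kgrad (\<lambda>X. Ad G (lexp G X) Y $ j) 0 (b j)"
proof -
  have "\<exists>b. kgrad (\<lambda>X. Ad G (lexp G X) Y $ j) 0 b" for j
  proof -
    obtain D where "\<And>x. x \<in> carrier G \<Longrightarrow> kgrad (\<lambda>X. Ad G (lexp G X \<otimes> x) Y $ j) 0 (D x)"
      using left_translation_derivative[OF aopen_carrier Ad_smooth[of Y j]] by blast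
    from this[OF one_closed] show ?thesis by auto
  qed
  thus ?thesis by metis
qed

lemma Ad_exp_deriv0:
  "((\<lambda>t. Ad G (lexp G (t *s X)) Y $ j) has_field_derivative lie_br G X Y $ j) (at 0)"
proof -
  obtain b where "\<And>j. kgrad (\<lambda>X. Ad G (lexp G X) Y $ j) 0 (b j)" using lie_br_gradient by blast
  from DERIV_deriv_iff_has_field_derivative[THEN iffD2, OF exI, OF kgrad_line[OF this]]
  show ?thesis by (simp add: lie_br_def)
qed

lemma lie_br_linear_left: "klinear (\<lambda>X. lie_br G X Y)"
proof -
  obtain b where b: "\<And>j. kgrad (\<lambda>X. Ad G (lexp G X) Y $ j) 0 (b j)" using lie_br_gradient by blast
  have "lie_br G X Y $ j = (\<Sum>i\<in>UNIV. b j $ i * X $ i)" for X j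
    using DERIV_unique[OF Ad_exp_deriv0 kgrad_line[OF b]] .
  thus ?thesis by (intro klinearI) (simp_all add: vec_eq_iff sum.distrib distrib_left sum_distrib_left mult.left_commute)
qed

lemma lie_br_linear_right: "klinear (lie_br G X)"
proof (rule klinearI; subst vec_eq_iff; intro allI)
  fix Y Z j
  have "((\<lambda>t. Ad G (lexp G (t *s X)) (Y + Z) $ j) has_field_derivative lie_br G X Y $ j + lie_br G X Z $ j) (at 0)"
    using DERIV_add[OF Ad_exp_deriv0[of X Y j] Ad_exp_deriv0[of X Z j]]
    by (simp add: klinear_add[OF Ad_linear])
  from DERIV_unique[OF Ad_exp_deriv0 this] show "lie_br G X (Y + Z) $ j = (lie_br G X Y + lie_br G X Z) $ j" by simp
next
  fix c Y j
  have "((\<lambda>t. Ad G (lexp G (t *s X)) (c *s Y) $ j) has_field_derivative c * lie_br G X Y $ j) (at 0)"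
    using DERIV_cmult[OF Ad_exp_deriv0[of X Y j]] by (simp add: klinear_smult[OF Ad_linear])
  from DERIV_unique[OF Ad_exp_deriv0 this] show "lie_br G X (c *s Y) $ j = (c *s lie_br G X Y) $ j" by simp
qed

lemma lie_br_self: "lie_br G X X = 0"
proof -
  have "lie_br G X X $ j = 0" for j
    by (rule DERIV_unique[OF Ad_exp_deriv0]) (simp add: Ad_exp_self)
  thus ?thesis by (simp add: vec_eq_iff)
qed

lemma lie_br_add_left: "lie_br G (X + Y) Z = lie_br G X Z + lie_br G Y Z"
  using klinear_add[OF lie_br_linear_left] .

lemma lie_br_add_right: "lie_br G X (Y + Z) = lie_br G X Y + lie_br G X Z"
  using klinear_add[OF lie_br_linear_right] .

lemma lie_br_minus_left: "lie_br G (- X) Z = - lie_br G X Z"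
  using klinear_minus[OF lie_br_linear_left] .

lemma lie_br_minus_right: "lie_br G X (- Z) = - lie_br G X Z"
  using klinear_minus[OF lie_br_linear_right] .

lemma lie_br_antisym: "lie_br G X Y = - lie_br G Y X"
proof -
  have "lie_br G X Y + lie_br G Y X = 0"
    using lie_br_self[of "X + Y"]
    unfolding lie_br_add_left lie_br_add_right lie_br_self[of X] lie_br_self[of Y] by (simp add: add.commute)
  thus ?thesis by (simp add: eq_neg_iff_add_eq_0)
qed

lemma lie_br_expand:
  "lie_br G X Y $ k = (\<Sum>a\<in>UNIV. \<Sum>b\<in>UNIV. lie_br G (axis a 1) (axis b 1) $ k * X $ a * Y $ b)"
proof -
  have "lie_br G X Y $ k = (\<Sum>a\<in>UNIV. X $ a * lie_br G (axis a 1) Y $ k)"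
    by (rule klinear_nth[OF lie_br_linear_left])
  also have "\<dots> = (\<Sum>a\<in>UNIV. X $ a * (\<Sum>b\<in>UNIV. Y $ b * lie_br G (axis a 1) (axis b 1) $ k))"
    by (intro sum.cong refl arg_cong2[of _ _ _ _ "(*)"] klinear_nth[OF lie_br_linear_right])
  finally show ?thesis by (simp add: sum_distrib_left mult_ac)
qed

lemma klinear_has_field_derivative:
  assumes "klinear A" "\<And>i. ((\<lambda>t. v t $ i) has_field_derivative w $ i) (at t0)"
  shows "((\<lambda>t. A (v t) $ j) has_field_derivative A w $ j) (at t0)"
proof -
  have "((\<lambda>t. \<Sum>i\<in>UNIV. v t $ i * A (axis i 1) $ j) has_field_derivative (\<Sum>i\<in>UNIV. w $ i * A (axis i 1) $ j)) (at t0)"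
    by (intro DERIV_sum DERIV_cmult_right assms)
  moreover have "(\<lambda>t. A (v t) $ j) = (\<lambda>t. \<Sum>i\<in>UNIV. v t $ i * A (axis i 1) $ j)"
    by (rule ext) (rule klinear_nth[OF assms(1)])
  ultimately show ?thesis by (simp only: klinear_nth[OF assms(1), of w, symmetric])
qed

text \<open>Conjugation by g carries the one-parameter subgroup of X to that of Ad g X; the identity
  \<open>e\<close> that expresses this is differentiated at 0.\<close>

lemma Ad_bracket:
  assumes g: "g \<in> carrier G"
  shows "Ad G g (lie_br G X Y) = lie_br G (Ad G g X) (Ad G g Y)"
proof -
  have e: "Ad G (lexp G (t *s Ad G g X)) (Ad G g Y) = Ad G g (Ad G (lexp G (t *s X)) Y)" for t
    using g mult_exp[OF g, of "t *s X"] by (simp add: Ad_mult[symmetric] klinear_smult[OF Ad_linear])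
  have "Ad G g (lie_br G X Y) $ j = lie_br G (Ad G g X) (Ad G g Y) $ j" for j
    by (rule DERIV_unique[OF klinear_has_field_derivative[OF Ad_linear[OF g] Ad_exp_deriv0] Ad_exp_deriv0[of "Ad G g X" "Ad G g Y" j, unfolded e]])
  thus ?thesis by (simp add: vec_eq_iff)
qed

lemma Ad_exp_deriv:
  "((\<lambda>t. Ad G (lexp G (t *s X)) Y $ j) has_field_derivative Ad G (lexp G (t0 *s X)) (lie_br G X Y) $ j) (at t0)"
proof -
  have "((\<lambda>t. Ad G (lexp G (t0 *s X)) (Ad G (lexp G (t *s X)) Y) $ j) has_field_derivative Ad G (lexp G (t0 *s X)) (lie_br G X Y) $ j) (at 0)"
    by (rule klinear_has_field_derivative[OF Ad_linear Ad_exp_deriv0]) simp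
  hence "((\<lambda>t. Ad G (lexp G ((t + t0) *s X)) Y $ j) has_field_derivative Ad G (lexp G (t0 *s X)) (lie_br G X Y) $ j) (at 0)"
    unfolding add.commute[of _ t0] exp_add by (simp add: Ad_mult)
  thus ?thesis using DERIV_shift[of "\<lambda>t. Ad G (lexp G (t *s X)) Y $ j" _ 0 t0] by simp
qed

section \<open>Induction over a connected group\<close>

lemma topspace_mfd: "topspace (mfd_top (atlas G)) = carrier G"
  unfolding topspace_def openin_mfd_top[OF inj_charts]
  using aopen_carrier aopen_subset_carrier by blast

text \<open>Exponentials times y fill a neighbourhood of y. The set where P holds is therefore open,
  and because steps can be undone its complement is open too.\<close>

lemma connected_exp_induct:
  assumes conn: "lie_connected G" and one: "P \<one>"
    and step: "\<And>x X. x \<in> carrier G \<Longrightarrow> P x \<Longrightarrow> P (lexp G X \<otimes> x)"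
    and x: "x \<in> carrier G"
  shows "P x"
proof -
  obtain U \<phi> N Lg l where ec: "exp_chart U \<phi> N Lg l" using exp_local by (elim exE)
  note U = exp_chartD(1,2)[OF ec] and N = exp_chartD(3-7)[OF ec]
  have aU: "aopen (atlas G) U" by (rule aopen_chart[OF mfd U(1)])
  have "smooth_map (atlas G) U vatl \<phi>"
    using smooth_fun_chart[OF mfd U(1)] by (simp add: smooth_map_vatl[OF aU])
  moreover have "U \<subseteq> \<Union>(fst ` atlas G)" using aU unfolding aopen_def by blast
  ultimately have "aopen (atlas G) (U \<inter> \<phi> -` (\<phi> ` lexp G ` N))"
    using smooth_map_aopen[OF _ inj_charts _ chart_inj_vatl] N(4) by simp
  moreover have "U \<inter> \<phi> -` (\<phi> ` lexp G ` N) = lexp G ` N"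
  proof
    show "lexp G ` N \<subseteq> U \<inter> \<phi> -` (\<phi> ` lexp G ` N)" using N(3) by blast
    show "U \<inter> \<phi> -` (\<phi> ` lexp G ` N) \<subseteq> lexp G ` N"
    proof
      fix y assume "y \<in> U \<inter> \<phi> -` (\<phi> ` lexp G ` N)"
      then obtain z where "y \<in> U" "z \<in> lexp G ` N" "\<phi> y = \<phi> z" by auto
      with N(3) chart_injD[OF inj_charts U(1)] show "y \<in> lexp G ` N" by (metis inj_onD subsetD)
    qed
  qed
  ultimately have aN: "aopen (atlas G) (lexp G ` N)" by simp
  have "smooth_map (atlas G) (carrier G) (atlas G) (\<lambda>y. y)"
    unfolding smooth_map_def
  proof (intro conjI ballI, goal_cases)
    case 1 show ?case by (simp add: carrier_charts)
  next
    case (2 p)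
    have "carrier G \<inter> U = U" if "(U, \<phi>) \<in> atlas G" for U \<phi> using aopen_subset_carrier[OF aopen_chart[OF mfd that]] by blast
    thus ?case using 2 manifold_chart_overlap[OF mfd] by (auto simp: o_def)
  qed
  note idm = this
  have nb: "\<exists>T. aopen (atlas G) T \<and> y \<in> T \<and> (\<forall>z\<in>T. \<exists>X. z = lexp G X \<otimes> y)" if y: "y \<in> carrier G" for y
  proof -
    have "smooth_map (atlas G) (carrier G) (atlas G) (\<lambda>z. z \<otimes> inv y)"
      using y by (intro sm_mult inj_charts idm sm_const aopen_carrier) auto
    from smooth_map_aopen[OF this inj_charts _ inj_charts aN]
    have "aopen (atlas G) (carrier G \<inter> (\<lambda>z. z \<otimes> inv y) -` (lexp G ` N))" by (simp add: carrier_charts)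
    moreover have "y \<in> carrier G \<inter> (\<lambda>z. z \<otimes> inv y) -` (lexp G ` N)"
      using y N(2) by (auto intro!: image_eqI[of _ _ 0])
    moreover have "\<exists>X. z = lexp G X \<otimes> y" if z: "z \<in> carrier G \<inter> (\<lambda>z. z \<otimes> inv y) -` (lexp G ` N)" for z
    proof -
      obtain X where "z \<otimes> inv y = lexp G X" using z by auto
      hence "z = lexp G X \<otimes> y" using z y by (metis IntD1 inv_solve_right' exp_closed)
      thus ?thesis ..
    qed
    ultimately show ?thesis by blast
  qed
  \<comment> \<open>A step by X is undone by a step by -X; this is what makes the complement of
    \<open>S\<close> open.\<close>
  have rev: "P y" if "y \<in> carrier G" "P (lexp G X \<otimes> y)" for y X
    using step[OF _ that(2), of "- X"] that(1) by (simp add: exp_minus m_assoc[symmetric])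
  define S where "S = {y \<in> carrier G. P y}"
  have "aopen (atlas G) S"
  proof (rule aopen_local[OF inj_charts])
    fix y assume y: "y \<in> S"
    with nb[of y] obtain T where T: "aopen (atlas G) T" "y \<in> T" "\<And>z. z \<in> T \<Longrightarrow> \<exists>X. z = lexp G X \<otimes> y"
      by (auto simp: S_def)
    have "T \<subseteq> S" using T(3) aopen_subset_carrier[OF T(1)] step y by (fastforce simp: S_def)
    thus "\<exists>T. aopen (atlas G) T \<and> y \<in> T \<and> T \<subseteq> S" using T by blast
  qed
  moreover have "aopen (atlas G) (carrier G - S)"
  proof (rule aopen_local[OF inj_charts])
    fix y assume y: "y \<in> carrier G - S"
    with nb[of y] obtain T where T: "aopen (atlas G) T" "y \<in> T" "\<And>z. z \<in> T \<Longrightarrow> \<exists>X. z = lexp G X \<otimes> y"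
      by auto
    have "T \<subseteq> carrier G - S"
    proof
      fix z assume z: "z \<in> T"
      from T(3)[OF z] obtain X where "z = lexp G X \<otimes> y" ..
      moreover have "z \<in> carrier G" using aopen_subset_carrier[OF T(1)] z by blast
      ultimately show "z \<in> carrier G - S" using rev[of y X] y by (auto simp: S_def)
    qed
    thus "\<exists>T. aopen (atlas G) T \<and> y \<in> T \<and> T \<subseteq> carrier G - S" using T by blast
  qed
  moreover have "S \<subseteq> carrier G" by (auto simp: S_def)
  ultimately have "S = {} \<or> S = carrier G"
    using conn unfolding lie_connected_def connected_space_clopen_in closedin_def topspace_mfd
      openin_mfd_top[OF inj_charts] by blast
  moreover have "\<one> \<in> S" using one by (simp add: S_def)
  ultimately show ?thesis using x by (auto simp: S_def)
qed

end

text \<open>Both sides generate the same one-parameter subgroup.\<close>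

lemma
  fixes K :: "('b, 'k::{real_normed_field,euclidean_space}, 'm::finite) lie_group_data"
    and G :: "('a, 'k, 'n::finite) lie_group_data"
  assumes S: "lie_subgroup \<iota> d K G"
  shows lie_subgroup_Ad: "g \<in> carrier K \<Longrightarrow> d (Ad K g X) = Ad G (\<iota> g) (d X)"
    and lie_subgroup_br: "d (lie_br K X Y) = lie_br G (d X) (d Y)"
proof -
  have K: "lie K" and G: "lie G" using S by (simp_all add: lie_subgroup_def lie_def)
  interpret K: lie K by (rule K)
  interpret G: lie G by (rule G)
  have h: "\<iota> \<in> hom K G" and ex: "\<And>X. \<iota> (lexp K X) = lexp G (d X)" and d: "klinear d"
    using S by (simp_all add: lie_subgroup_def)
  interpret hom: group_hom K G \<iota>
    by (rule group_hom.intro[OF K.is_group G.is_group group_hom_axioms.intro[OF h]])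
  have A: "d (Ad K g X) = Ad G (\<iota> g) (d X)" if g: "g \<in> carrier K" for g X
  proof (rule G.Ad_eqI[symmetric])
    fix t
    have "\<iota> g \<otimes>\<^bsub>G\<^esub> lexp G (t *s d X) \<otimes>\<^bsub>G\<^esub> inv\<^bsub>G\<^esub> (\<iota> g) = \<iota> (g \<otimes>\<^bsub>K\<^esub> lexp K (t *s X) \<otimes>\<^bsub>K\<^esub> inv\<^bsub>K\<^esub> g)"
      using g by (simp add: ex klinear_smult[OF d])
    also have "\<dots> = lexp G (t *s d (Ad K g X))"
      using g by (simp add: K.Ad_exp ex klinear_smult[OF d] klinear_smult[OF K.Ad_linear])
    finally show "\<iota> g \<otimes>\<^bsub>G\<^esub> lexp G (t *s d X) \<otimes>\<^bsub>G\<^esub> inv\<^bsub>G\<^esub> (\<iota> g) = lexp G (t *s d (Ad K g X))" .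
  qed
  thus "g \<in> carrier K \<Longrightarrow> d (Ad K g X) = Ad G (\<iota> g) (d X)" .
  have e: "d (Ad K (lexp K (t *s X)) Y) = Ad G (lexp G (t *s d X)) (d Y)" for t
    by (simp add: A ex klinear_smult[OF d])
  have "d (lie_br K X Y) $ j = lie_br G (d X) (d Y) $ j" for j
    by (rule DERIV_unique[OF K.klinear_has_field_derivative[OF d K.Ad_exp_deriv0] G.Ad_exp_deriv0[of "d X" "d Y" j, folded e]])
  thus "d (lie_br K X Y) = lie_br G (d X) (d Y)" by (simp add: vec_eq_iff)
qed

section \<open>Reductive Manin triples\<close>

lemma vfst_vjoin [simp]: "vfst (vjoin X \<alpha>) = X"
  and vsnd_vjoin [simp]: "vsnd (vjoin X \<alpha>) = \<alpha>"
  and vjoin_vfst_vsnd [simp]: "vjoin (vfst A) (vsnd A) = A"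
  by (simp_all add: vjoin_def vfst_def vsnd_def vec_eq_iff split: sum.split)

lemma vjoin_eqI: "vfst A = vfst B \<Longrightarrow> vsnd A = vsnd B \<Longrightarrow> A = B"
  by (metis vjoin_vfst_vsnd)

lemma vfst_arith [simp]: "vfst 0 = 0" "vfst (A + B) = vfst A + vfst B" "vfst (A - B) = vfst A - vfst B"
    "vfst (- A) = - vfst A" "vfst (c *s A) = c *s vfst A"
  for A :: "'k::field^('a::finite + 'b::finite)"
  by (simp_all add: vfst_def vec_eq_iff)

lemma vsnd_arith [simp]: "vsnd 0 = 0" "vsnd (A + B) = vsnd A + vsnd B" "vsnd (A - B) = vsnd A - vsnd B"
    "vsnd (- A) = - vsnd A" "vsnd (c *s A) = c *s vsnd A"
  for A :: "'k::field^('a::finite + 'b::finite)"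
  by (simp_all add: vsnd_def vec_eq_iff)

lemma vjoin_split: "vjoin X \<alpha> = vjoin X 0 + vjoin 0 (\<alpha> :: 'k::field^'b)"
  by (rule vjoin_eqI) simp_all

lemma vjoin_zero [simp]: "vjoin 0 0 = (0 :: 'k::field^('a::finite + 'b::finite))"
  by (rule vjoin_eqI) simp_all

lemma pair_arith [simp]:
  "pair 0 X = 0" "pair \<alpha> 0 = 0" "pair (\<alpha> + \<beta>) X = pair \<alpha> X + pair \<beta> X" "pair \<alpha> (X + Y) = pair \<alpha> X + pair \<alpha> Y"
  "pair (- \<alpha>) X = - pair \<alpha> X" "pair \<alpha> (- X) = - pair \<alpha> X"
  "pair (\<alpha> - \<beta>) X = pair \<alpha> X - pair \<beta> X" "pair \<alpha> (X - Y) = pair \<alpha> X - pair \<alpha> Y"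
  "pair (c *s \<alpha>) X = c * pair \<alpha> X" "pair \<alpha> (c *s X) = c * pair \<alpha> X"
  for X :: "'k::field^'a"
  by (simp_all add: pair_def sum.distrib sum_subtractf sum_negf distrib_left distrib_right
      left_diff_distrib right_diff_distrib sum_distrib_left mult_ac)

lemma pair_sum_left: "pair (\<Sum>i\<in>I. f i) X = (\<Sum>i\<in>I. pair (f i) (X :: 'k::field^'a))"
  by (induction I rule: infinite_finite_induct) simp_all

lemma pair_sum_right: "pair X (\<Sum>i\<in>I. f i) = (\<Sum>i\<in>I. pair (X :: 'k::field^'a) (f i))"
  by (induction I rule: infinite_finite_induct) simp_all

lemma sum_axis_left: "(\<Sum>i\<in>UNIV. axis a 1 $ i * f i) = (f a :: 'k::field)"
proof -
  have "(\<Sum>i\<in>UNIV. axis a 1 $ i * f i) = (\<Sum>i\<in>UNIV. if i = a then f i else 0)"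
    by (intro sum.cong) (auto simp: axis_def)
  thus ?thesis by simp
qed

lemma pair_axis_left [simp]: "pair (axis a 1) X = (X $ a :: 'k::field)"
  by (simp add: pair_def sum_axis_left)

lemma pair_axis_right [simp]: "pair X (axis a 1) = (X $ a :: 'k::field)"
  using sum_axis_left[of a "\<lambda>i. X $ i"] by (simp add: pair_def mult.commute)

lemma dpair_vjoin: "dpair (vjoin X \<alpha>) B = pair \<alpha> (vfst B) + pair (vsnd B) X"
  by (simp add: dpair_def)

lemma dpair_commute: "dpair A B = dpair B A"
  by (simp add: dpair_def)

lemma dpair_arith [simp]:
  "dpair 0 B = 0" "dpair A 0 = 0" "dpair (A + A') B = dpair A B + dpair A' B" "dpair A (B + B') = dpair A B + dpair A B'"
  "dpair (- A) B = - dpair A B" "dpair A (- B) = - dpair A B"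
  "dpair (A - A') B = dpair A B - dpair A' B" "dpair A (B - B') = dpair A B - dpair A B'"
  for A :: "'k::field^('a::finite + 'a)"
  by (simp_all add: dpair_def algebra_simps)

lemma dpair_eqI:
  fixes A B :: "'k::field^('a::finite + 'a)"
  assumes "\<And>Y. dpair A (vjoin Y 0) = dpair B (vjoin Y 0)" "\<And>\<beta>. dpair A (vjoin 0 \<beta>) = dpair B (vjoin 0 \<beta>)"
  shows "A = B"
proof (rule vjoin_eqI)
  show "vsnd A = vsnd B" using assms(1)[of "axis _ 1"] by (simp add: dpair_def vec_eq_iff)
  show "vfst A = vfst B" using assms(2)[of "axis _ 1"] by (simp add: dpair_def vec_eq_iff)
qed

lemma dpair_expand:
  "dpair A B = (\<Sum>a\<in>UNIV. A $ Inr a * B $ Inl a) + (\<Sum>a\<in>UNIV. B $ Inr a * A $ Inl a)"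
  by (simp add: dpair_def pair_def vfst_def vsnd_def)

section \<open>From infinitesimal identities to identities for exponentials\<close>

lemma constant_if_zero_derivative:
  fixes F :: "'k::{real_normed_field,euclidean_space} \<Rightarrow> 'k"
  assumes "\<And>t. (F has_field_derivative 0) (at t)"
  shows "F t = F 0"
proof -
  have "\<exists>c. \<forall>x\<in>UNIV. F x = c"
    by (rule has_field_derivative_zero_constant) (use assms in auto)
  thus ?thesis by auto
qed

lemma Ad_exp_bracket_commute:
  assumes "lie G"
  shows "Ad G (lexp G (t *s X)) (lie_br G X Y) = lie_br G X (Ad G (lexp G (t *s X)) Y)"
  using lie.Ad_bracket[OF assms lie.exp_closed[OF assms], of "t *s X" X Y]
  by (simp add: lie.Ad_exp_self[OF assms])

text \<open>Along t X and t X' both sides solve v' = [X', v] with the same initial value. Uniqueness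
  is obtained by applying the backward flow \<open>E t\<close>: the product \<open>E t (v t)\<close>
  has derivative zero.\<close>

lemma Ad_exp_intertwine:
  fixes G :: "('a, 'k::{real_normed_field,euclidean_space}, 'n::finite) lie_group_data"
    and G' :: "('b, 'k, 'm::finite) lie_group_data"
  assumes G: "lie G" and G': "lie G'" and f: "klinear f"
    and br: "\<And>Y. f (lie_br G X Y) = lie_br G' X' (f Y)"
  shows "f (Ad G (lexp G X) Y) = Ad G' (lexp G' X') (f Y)"
proof -
  interpret G: lie G by (rule G)
  interpret G': lie G' by (rule G')
  define v where "v t = f (Ad G (lexp G (t *s X)) Y)" for t
  define E where "E t = Ad G' (lexp G' (t *s (- X')))" for t
  have klE: "klinear (E t)" for t unfolding E_def by (rule G'.Ad_linear) simp
  have dv: "((\<lambda>t. v t $ i) has_field_derivative lie_br G' X' (v t) $ i) (at t)" for t i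
    using G.klinear_has_field_derivative[OF f G.Ad_exp_deriv[of X Y _ t], of i]
    unfolding Ad_exp_bracket_commute[OF G] br v_def .
  have dE: "((\<lambda>t. E t Z $ j) has_field_derivative - E t (lie_br G' X' Z) $ j) (at t)" for t Z j
    using G'.Ad_exp_deriv[of "- X'" Z j t] unfolding E_def G'.lie_br_minus_left
    by (simp add: klinear_minus[OF G'.Ad_linear])
  have z: "((\<lambda>t. E t (v t) $ j) has_field_derivative 0) (at t)" for t j
  proof -
    have e: "(\<lambda>t. E t (v t) $ j) = (\<lambda>t. \<Sum>i\<in>UNIV. v t $ i * E t (axis i 1) $ j)"
      by (rule ext) (rule klinear_nth[OF klE])
    have "((\<lambda>t. E t (v t) $ j) has_field_derivative
       (\<Sum>i\<in>UNIV. lie_br G' X' (v t) $ i * E t (axis i 1) $ j + - E t (lie_br G' X' (axis i 1)) $ j * v t $ i)) (at t)"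
      unfolding e by (intro DERIV_sum DERIV_mult dv dE)
    moreover have "(\<Sum>i\<in>UNIV. lie_br G' X' (v t) $ i * E t (axis i 1) $ j + - E t (lie_br G' X' (axis i 1)) $ j * v t $ i) = 0"
    proof -
      have k: "klinear (\<lambda>Z. E t (lie_br G' X' Z))"
        by (rule klinearI) (simp_all add: klinear_add[OF klE] klinear_smult[OF klE]
            klinear_add[OF G'.lie_br_linear_right] klinear_smult[OF G'.lie_br_linear_right])
      show ?thesis
        using klinear_nth[OF klE[of t], of "lie_br G' X' (v t)" j] klinear_nth[OF k, of "v t" j]
        by (simp add: sum.distrib sum_subtractf sum_negf mult.commute)
    qed
    ultimately show ?thesis by simp
  qed
  have "E 1 (v 1) = E 0 (v 0)"
    unfolding vec_eq_iff by (intro allI constant_if_zero_derivative[OF z])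
  hence "Ad G' (inv\<^bsub>G'\<^esub> (lexp G' X')) (f (Ad G (lexp G X) Y)) = f Y"
    by (simp add: E_def v_def G'.exp_minus G.Ad_one G'.Ad_one)
  thus ?thesis using G'.Ad_inv'[of "lexp G' X'" "f (Ad G (lexp G X) Y)"] by simp
qed

text \<open>Invariance makes the map [X, _] skew for the scalar product, so the scalar product of
  two vectors moved by Ad (exp (t X)) has derivative zero.\<close>

lemma Ad_exp_isometry:
  fixes G :: "('a, 'k::{real_normed_field,euclidean_space}, 'm::finite + 'm) lie_group_data"
  assumes G: "lie G" and inv: "\<And>A B C. dpair (lie_br G A B) C = dpair A (lie_br G B C)"
  shows "dpair (Ad G (lexp G X) A) (Ad G (lexp G X) B) = dpair A B"
proof -
  interpret G: lie G by (rule G)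
  define a where "a t = Ad G (lexp G (t *s X)) A" for t
  define b where "b t = Ad G (lexp G (t *s X)) B" for t
  have d: "((\<lambda>t. Ad G (lexp G (t *s X)) C $ i) has_field_derivative lie_br G X (Ad G (lexp G (t *s X)) C) $ i) (at t)" for t C i
    using G.Ad_exp_deriv[of X C i t] unfolding Ad_exp_bracket_commute[OF G] .
  have z: "((\<lambda>t. dpair (a t) (b t)) has_field_derivative 0) (at t)" for t
  proof -
    have "((\<lambda>t. dpair (a t) (b t)) has_field_derivative
      (\<Sum>i\<in>UNIV. lie_br G X (a t) $ Inr i * b t $ Inl i + lie_br G X (b t) $ Inl i * a t $ Inr i) +
      (\<Sum>i\<in>UNIV. lie_br G X (b t) $ Inr i * a t $ Inl i + lie_br G X (a t) $ Inl i * b t $ Inr i)) (at t)"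
      unfolding dpair_expand a_def b_def by (intro DERIV_add DERIV_sum DERIV_mult d)
    moreover have "(\<Sum>i\<in>UNIV. lie_br G X (a t) $ Inr i * b t $ Inl i + lie_br G X (b t) $ Inl i * a t $ Inr i) +
      (\<Sum>i\<in>UNIV. lie_br G X (b t) $ Inr i * a t $ Inl i + lie_br G X (a t) $ Inl i * b t $ Inr i) =
      dpair (lie_br G X (a t)) (b t) + dpair (a t) (lie_br G X (b t))"
      by (simp add: dpair_expand sum.distrib mult.commute add_ac)
    moreover have "dpair (lie_br G X (a t)) (b t) = - dpair (a t) (lie_br G X (b t))"
      using inv[of "a t" X "b t"] by (subst G.lie_br_antisym) simp
    ultimately show ?thesis by simp
  qed
  from constant_if_zero_derivative[OF z, of 1] show ?thesis by (simp add: a_def b_def G.Ad_one)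
qed

text \<open>The Lie-theoretic data of K, H and their doubles, with h written as
  \<open>range dH\<close>. The matrix C enters in \<open>dynamical_data\<close>, the group G and the
  given r-matrix in \<open>reduction\<close>.\<close>

locale reductive_data =
  fixes K :: "('g, 'k::{real_normed_field,euclidean_space}, 'm::finite) lie_group_data"
    and H :: "('g, 'k, 'h::finite) lie_group_data"
    and Ks :: "('s, 'k, 'm) lie_group_data"
    and Hs :: "('s, 'k, 'h) lie_group_data"
    and D :: "('d, 'k, 'm + 'm) lie_group_data"
    and DH :: "('e, 'k, 'h + 'h) lie_group_data"
    and dH :: "'k^'h \<Rightarrow> 'k^'m" and dHs :: "'k^'h \<Rightarrow> 'k^'m"
    and \<iota>K :: "'g \<Rightarrow> 'd" and \<iota>Ks :: "'s \<Rightarrow> 'd"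
    and \<iota>H :: "'g \<Rightarrow> 'e" and \<iota>Hs :: "'s \<Rightarrow> 'e"
    and \<mm> :: "('k^'m) set"
  assumes D: "drinfeld_double K Ks D \<iota>K \<iota>Ks"
    and HK: "lie_subgroup (\<lambda>x. x) dH H K"
    and mm: "vec.subspace \<mm>" "range dH \<inter> \<mm> = {0}" "{X + Y | X Y. X \<in> range dH \<and> Y \<in> \<mm>} = UNIV"
    and hperp_ideal: "\<And>\<alpha> \<beta>. \<beta> \<in> perp (range dH) \<Longrightarrow> lie_br Ks \<alpha> \<beta> \<in> perp (range dH)"
    and reductive: "\<And>X Y. X \<in> range dH \<Longrightarrow> Y \<in> \<mm> \<Longrightarrow> lie_br K X Y \<in> \<mm>"
    and Hs: "lie_subgroup (\<lambda>x. x) dHs Hs Ks" "lie_connected Hs" "range dHs = perp \<mm>"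
      "\<And>\<alpha> X. pair (dHs \<alpha>) (dH X) = pair \<alpha> X"
    and DH: "drinfeld_double H Hs DH \<iota>H \<iota>Hs"
begin

lemma K_in_D: "lie_subgroup \<iota>K (\<lambda>X. vjoin X 0) K D"
  and Ks_in_D: "lie_subgroup \<iota>Ks (\<lambda>\<alpha>. vjoin 0 \<alpha>) Ks D"
  and dpair_inv: "dpair (lie_br D A B) C = dpair A (lie_br D B C)"
  using D by (simp_all add: drinfeld_double_def)

lemma H_in_DH: "lie_subgroup \<iota>H (\<lambda>X. vjoin X 0) H DH"
  and Hs_in_DH: "lie_subgroup \<iota>Hs (\<lambda>\<alpha>. vjoin 0 \<alpha>) Hs DH"
  and dpair_inv_H: "dpair (lie_br DH A' B') C' = dpair A' (lie_br DH B' C')"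
  using DH by (simp_all add: drinfeld_double_def)

lemma lie_groups: "lie K" "lie D" "lie Ks" "lie H" "lie Hs" "lie DH"
  using K_in_D Ks_in_D H_in_DH Hs_in_DH by (simp_all add: lie_subgroup_def lie_def)

end

sublocale reductive_data \<subseteq> K: lie K + D: lie D + Ks: lie Ks + H: lie H + Hs: lie Hs + DH: lie DH
  by (rule lie_groups)+

context reductive_data begin

lemma dH_linear: "klinear dH"
  using HK by (simp add: lie_subgroup_def)

lemma dHs_linear: "klinear dHs" and dHs_inj: "inj dHs"
  using Hs(1) by (simp_all add: lie_subgroup_def)

lemma br_kk: "lie_br D (vjoin X 0) (vjoin Y 0) = vjoin (lie_br K X Y) 0"
  using lie_subgroup_br[OF K_in_D] by simp

lemma br_ss: "lie_br D (vjoin 0 \<alpha>) (vjoin 0 \<beta>) = vjoin 0 (lie_br Ks \<alpha> \<beta>)"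
  using lie_subgroup_br[OF Ks_in_D] by simp

lemma br_hh: "lie_br DH (vjoin X 0) (vjoin Y 0) = vjoin (lie_br H X Y) 0"
  using lie_subgroup_br[OF H_in_DH] by simp

lemma br_hshs: "lie_br DH (vjoin 0 \<alpha>) (vjoin 0 \<beta>) = vjoin 0 (lie_br Hs \<alpha> \<beta>)"
  using lie_subgroup_br[OF Hs_in_DH] by simp

lemma dH_br: "dH (lie_br H X Y) = lie_br K (dH X) (dH Y)"
  using lie_subgroup_br[OF HK] .

lemma dHs_br: "dHs (lie_br Hs X Y) = lie_br Ks (dHs X) (dHs Y)"
  using lie_subgroup_br[OF Hs(1)] .

section \<open>The projections of k and k* onto their components\<close>

text \<open>\<open>hcomp\<close> and \<open>hscomp\<close> are the transposes of \<open>dHs\<close>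
  and \<open>dH\<close>. Since h* annihilates m and pairs with h canonically, they are left inverses
  of \<open>dH\<close> and \<open>dHs\<close> with kernels m and h-perp, so they compute components
  in the coordinates of h.\<close>

definition hcomp :: "'k^'m \<Rightarrow> 'k^'h" where "hcomp X = (\<chi> a. pair (dHs (axis a 1)) X)"

definition hscomp :: "'k^'m \<Rightarrow> 'k^'h" where "hscomp \<alpha> = (\<chi> a. pair \<alpha> (dH (axis a 1)))"

definition mcomp :: "'k^'m \<Rightarrow> 'k^'m" where "mcomp X = X - dH (hcomp X)"

definition mscomp :: "'k^'m \<Rightarrow> 'k^'m" where "mscomp \<alpha> = \<alpha> - dHs (hscomp \<alpha>)"

lemma pair_klinear:
  fixes f :: "'k^'q \<Rightarrow> 'k^'p"
  shows "klinear f \<Longrightarrow> pair \<beta> (f X) = pair (\<chi> a. pair \<beta> (f (axis a 1))) X"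
proof -
  assume f: "klinear f"
  have "f X = (\<Sum>a\<in>UNIV. X $ a *s f (axis a 1))"
    by (subst vec_eq_iff) (simp add: klinear_nth[OF f, of X])
  hence "pair \<beta> (f X) = (\<Sum>a\<in>UNIV. X $ a * pair \<beta> (f (axis a 1)))" by (simp only: pair_sum_right pair_arith)
  thus ?thesis by (simp add: pair_def[of _ X] mult.commute)
qed

lemma pair_hscomp: "pair \<alpha> (dH X) = pair (hscomp \<alpha>) X"
  unfolding hscomp_def by (rule pair_klinear[OF dH_linear])

lemma pair_commute: "pair X Y = pair Y (X :: 'k^'q)"
  by (simp add: pair_def mult.commute)

lemma pair_hcomp: "pair (dHs \<alpha>) X = pair \<alpha> (hcomp X)"
  using pair_klinear[OF dHs_linear, of X \<alpha>] by (simp add: hcomp_def pair_commute)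

lemma pair_eqI: "(\<And>X. pair \<alpha> X = pair \<beta> X) \<Longrightarrow> \<alpha> = (\<beta> :: 'k^'q)"
  by (metis pair_axis_right vec_eq_iff)

lemma hcomp_dH [simp]: "hcomp (dH X) = X"
  by (rule pair_eqI) (metis Hs(4) pair_hcomp pair_commute)

lemma hscomp_dHs [simp]: "hscomp (dHs \<alpha>) = \<alpha>"
  by (rule pair_eqI) (metis Hs(4) pair_hscomp)

lemma perp_mm: "\<alpha> \<in> perp \<mm> \<longleftrightarrow> \<alpha> \<in> range dHs"
  using Hs(3) by simp

lemma pair_dHs_mm: "X \<in> \<mm> \<Longrightarrow> pair (dHs \<alpha>) X = 0"
  using Hs(3) unfolding perp_def by blast

lemma mm_iff: "X \<in> \<mm> \<longleftrightarrow> hcomp X = 0"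
proof
  assume "X \<in> \<mm>" thus "hcomp X = 0" by (simp add: hcomp_def pair_dHs_mm vec_eq_iff)
next
  assume h: "hcomp X = 0"
  have "X \<in> {X + Y | X Y. X \<in> range dH \<and> Y \<in> \<mm>}" using mm(3) by simp
  then obtain y Y where XY: "X = dH y + Y" "Y \<in> \<mm>" by blast
  have "pair \<alpha> y = pair (dHs \<alpha>) X" for \<alpha> using XY by (simp add: Hs(4) pair_dHs_mm)
  hence "pair \<alpha> y = 0" for \<alpha> by (simp add: pair_hcomp h)
  hence "y = 0" by (metis pair_commute pair_eqI pair_arith(1))
  thus "X \<in> \<mm>" using XY by (simp add: klinear_zero[OF dH_linear])
qed

lemma hperp_iff: "\<alpha> \<in> perp (range dH) \<longleftrightarrow> hscomp \<alpha> = 0"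
proof
  assume "\<alpha> \<in> perp (range dH)" thus "hscomp \<alpha> = 0" by (simp add: perp_def hscomp_def vec_eq_iff)
next
  assume "hscomp \<alpha> = 0" thus "\<alpha> \<in> perp (range dH)" unfolding perp_def by (auto simp: pair_hscomp)
qed

lemma hcomp_linear: "klinear hcomp" by (rule klinearI) (simp_all add: hcomp_def vec_eq_iff)

lemma hscomp_linear: "klinear hscomp" by (rule klinearI) (simp_all add: hscomp_def vec_eq_iff)

lemma mcomp_in: "mcomp X \<in> \<mm>"
  by (simp add: mm_iff mcomp_def klinear_diff[OF hcomp_linear])

lemma hscomp_mscomp [simp]: "hscomp (mscomp \<alpha>) = 0"
  by (simp add: mscomp_def klinear_diff[OF hscomp_linear])

lemma mscomp_in: "mscomp \<alpha> \<in> perp (range dH)"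
  by (simp add: hperp_iff)

lemma mscomp_dHs [simp]: "mscomp (dHs \<alpha>) = 0"
  by (simp add: mscomp_def)

lemma mscomp_add: "mscomp (\<alpha> + \<beta>) = mscomp \<alpha> + mscomp \<beta>"
  by (simp add: mscomp_def klinear_add[OF hscomp_linear] klinear_add[OF dHs_linear])

lemma mscomp_id: "hscomp \<alpha> = 0 \<Longrightarrow> mscomp \<alpha> = \<alpha>"
  by (simp add: mscomp_def klinear_zero[OF dHs_linear])

lemma pair_hperp: "hscomp \<alpha> = 0 \<Longrightarrow> pair \<alpha> (dH X) = 0"
  by (simp add: pair_hscomp)

lemma pair_mscomp: "X \<in> \<mm> \<Longrightarrow> pair \<alpha> X = pair (mscomp \<alpha>) X"
  by (simp add: mscomp_def pair_dHs_mm)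

section \<open>Embedding the double of h into the double of k\<close>

definition \<Psi> :: "'k^('h + 'h) \<Rightarrow> 'k^('m + 'm)" where "\<Psi> A = vjoin (dH (vfst A)) (dHs (vsnd A))"

lemma \<Psi>_linear: "klinear \<Psi>"
  by (rule klinearI; rule vjoin_eqI)
    (simp_all add: \<Psi>_def klinear_add[OF dH_linear] klinear_add[OF dHs_linear] klinear_smult[OF dH_linear] klinear_smult[OF dHs_linear])

lemma \<Psi>_isometry: "dpair (\<Psi> A) (\<Psi> B) = dpair A B"
  by (simp add: \<Psi>_def dpair_def Hs(4))

text \<open>Invariance expresses a mixed bracket through the brackets of the two halves, so both
  sides are compared by pairing. Against k, the m-part contributes nothing because [h, m]
  \<subseteq> m; against k*, the h-perp part contributes nothing because h-perp is an ideal.\<close>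

lemma \<Psi>_bracket_mixed:
  "\<Psi> (lie_br DH (vjoin X 0) (vjoin 0 \<alpha>)) = lie_br D (vjoin (dH X) 0) (vjoin 0 (dHs \<alpha>))"
proof (rule dpair_eqI)
  let ?B = "lie_br DH (vjoin X 0) (vjoin 0 \<alpha>)" and ?W = "lie_br D (vjoin (dH X) 0) (vjoin 0 (dHs \<alpha>))"
  have W: "dpair ?W (vjoin Y 0) = - pair (dHs \<alpha>) (lie_br K (dH X) Y)" for Y
    by (subst D.lie_br_antisym) (simp add: dpair_inv br_kk dpair_vjoin)
  have B: "dpair ?B (vjoin y 0) = - pair \<alpha> (lie_br H X y)" for y
    by (subst DH.lie_br_antisym) (simp add: dpair_inv_H br_hh dpair_vjoin)
  fix Y
  let ?y = "hcomp Y" and ?Y = "mcomp Y"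
  have Y: "vjoin Y 0 = \<Psi> (vjoin ?y 0) + vjoin ?Y 0"
    by (rule vjoin_eqI) (simp_all add: \<Psi>_def mcomp_def klinear_zero[OF dHs_linear])
  have "dpair (\<Psi> ?B) (vjoin ?Y 0) = 0"
    unfolding \<Psi>_def by (simp add: dpair_vjoin pair_dHs_mm[OF mcomp_in])
  hence "dpair (\<Psi> ?B) (vjoin Y 0) = - pair \<alpha> (lie_br H X ?y)"
    unfolding Y by (simp add: \<Psi>_isometry B)
  also have "\<dots> = - pair (dHs \<alpha>) (lie_br K (dH X) (dH ?y))" by (simp only: dH_br[symmetric] Hs(4))
  also have "\<dots> = - pair (dHs \<alpha>) (lie_br K (dH X) (dH ?y + ?Y))"
    by (simp add: K.lie_br_add_right pair_dHs_mm reductive mcomp_in)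
  finally show "dpair (\<Psi> ?B) (vjoin Y 0) = dpair ?W (vjoin Y 0)" unfolding W by (simp add: mcomp_def)
next
  let ?B = "lie_br DH (vjoin X 0) (vjoin 0 \<alpha>)" and ?W = "lie_br D (vjoin (dH X) 0) (vjoin 0 (dHs \<alpha>))"
  have W: "dpair ?W (vjoin 0 \<beta>) = pair (lie_br Ks (dHs \<alpha>) \<beta>) (dH X)" for \<beta>
    by (simp add: dpair_inv br_ss dpair_vjoin)
  have B: "dpair ?B (vjoin 0 b) = pair (lie_br Hs \<alpha> b) X" for b
    by (simp add: dpair_inv_H br_hshs dpair_vjoin)
  fix \<beta>
  let ?b = "hscomp \<beta>" and ?\<beta> = "mscomp \<beta>"
  have Y: "vjoin 0 \<beta> = \<Psi> (vjoin 0 ?b) + vjoin 0 ?\<beta>"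
    by (rule vjoin_eqI) (simp_all add: \<Psi>_def mscomp_def klinear_zero[OF dH_linear])
  have "dpair (\<Psi> ?B) (vjoin 0 ?\<beta>) = 0"
    unfolding \<Psi>_def by (simp add: dpair_vjoin pair_hperp)
  hence "dpair (\<Psi> ?B) (vjoin 0 \<beta>) = pair (lie_br Hs \<alpha> ?b) X"
    unfolding Y by (simp add: \<Psi>_isometry B)
  also have "\<dots> = pair (lie_br Ks (dHs \<alpha>) (dHs ?b)) (dH X)" by (simp only: dHs_br[symmetric] Hs(4))
  also have "\<dots> = pair (lie_br Ks (dHs \<alpha>) (dHs ?b + ?\<beta>)) (dH X)"
  proof -
    have "pair (lie_br Ks (dHs \<alpha>) ?\<beta>) (dH X) = 0"
      using hperp_ideal[OF mscomp_in] by (intro pair_hperp) (simp add: hperp_iff)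
    thus ?thesis by (simp add: Ks.lie_br_add_right)
  qed
  finally show "dpair (\<Psi> ?B) (vjoin 0 \<beta>) = dpair ?W (vjoin 0 \<beta>)" unfolding W by (simp add: mscomp_def)
qed

lemma \<Psi>_bracket: "\<Psi> (lie_br DH A B) = lie_br D (\<Psi> A) (\<Psi> B)"
proof -
  have h: "\<Psi> (vjoin X 0) = vjoin (dH X) 0" "\<Psi> (vjoin 0 \<alpha>) = vjoin 0 (dHs \<alpha>)" for X \<alpha>
    by (simp_all add: \<Psi>_def klinear_zero[OF dH_linear] klinear_zero[OF dHs_linear])
  have m: "\<Psi> (lie_br DH (vjoin 0 \<alpha>) (vjoin X 0)) = lie_br D (vjoin 0 (dHs \<alpha>)) (vjoin (dH X) 0)" for X \<alpha>
    using \<Psi>_bracket_mixed[of X \<alpha>]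
    by (subst DH.lie_br_antisym, subst D.lie_br_antisym) (simp add: klinear_minus[OF \<Psi>_linear])
  have "\<Psi> (lie_br DH (vjoin X 0 + vjoin 0 \<alpha>) (vjoin Y 0 + vjoin 0 \<beta>)) =
    lie_br D (\<Psi> (vjoin X 0 + vjoin 0 \<alpha>)) (\<Psi> (vjoin Y 0 + vjoin 0 \<beta>))" for X Y \<alpha> \<beta>
    unfolding DH.lie_br_add_left DH.lie_br_add_right klinear_add[OF \<Psi>_linear] h
      D.lie_br_add_left D.lie_br_add_right \<Psi>_bracket_mixed m br_hh br_hshs br_kk br_ss dH_br dHs_br by (rule refl)
  from this[of "vfst A" "vsnd A" "vfst B" "vsnd B"] show ?thesis by (simp add: vjoin_split[symmetric])
qed

section \<open>The action of H* on the double of k\<close>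

abbreviation AdL :: "'s \<Rightarrow> 'k^('m + 'm) \<Rightarrow> 'k^('m + 'm)" where "AdL l \<equiv> Ad D (\<iota>Ks l)"

lemma Hs_Ks: "l \<in> carrier Hs \<Longrightarrow> l \<in> carrier Ks" "lexp Hs \<alpha> = lexp Ks (dHs \<alpha>)"
  "l \<in> carrier Hs \<Longrightarrow> l' \<in> carrier Hs \<Longrightarrow> l \<otimes>\<^bsub>Hs\<^esub> l' = l \<otimes>\<^bsub>Ks\<^esub> l'"
  using Hs(1) by (auto simp: lie_subgroup_def hom_def)

lemma \<iota>Ks_closed [simp]: "l \<in> carrier Ks \<Longrightarrow> \<iota>Ks l \<in> carrier D"
  and \<iota>Ks_mult: "l \<in> carrier Ks \<Longrightarrow> l' \<in> carrier Ks \<Longrightarrow> \<iota>Ks (l \<otimes>\<^bsub>Ks\<^esub> l') = \<iota>Ks l \<otimes>\<^bsub>D\<^esub> \<iota>Ks l'"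
  and \<iota>Ks_exp: "\<iota>Ks (lexp Ks \<alpha>) = lexp D (vjoin 0 \<alpha>)"
  using Ks_in_D by (auto simp: lie_subgroup_def hom_def)

lemma \<iota>Hs_closed [simp]: "l \<in> carrier Hs \<Longrightarrow> \<iota>Hs l \<in> carrier DH"
  and \<iota>Hs_mult: "l \<in> carrier Hs \<Longrightarrow> l' \<in> carrier Hs \<Longrightarrow> \<iota>Hs (l \<otimes>\<^bsub>Hs\<^esub> l') = \<iota>Hs l \<otimes>\<^bsub>DH\<^esub> \<iota>Hs l'"
  and \<iota>Hs_exp: "\<iota>Hs (lexp Hs a) = lexp DH (vjoin 0 a)"
  using Hs_in_DH by (auto simp: lie_subgroup_def hom_def)

lemma one_Hs: "\<iota>Ks \<one>\<^bsub>Hs\<^esub> = \<one>\<^bsub>D\<^esub>" "\<iota>Hs \<one>\<^bsub>Hs\<^esub> = \<one>\<^bsub>DH\<^esub>"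
proof -
  have "\<iota>Ks (lexp Hs 0) = \<one>\<^bsub>D\<^esub>" unfolding Hs_Ks(2) \<iota>Ks_exp by (simp add: klinear_zero[OF dHs_linear])
  thus "\<iota>Ks \<one>\<^bsub>Hs\<^esub> = \<one>\<^bsub>D\<^esub>" by simp
  have "\<iota>Hs (lexp Hs 0) = \<one>\<^bsub>DH\<^esub>" unfolding \<iota>Hs_exp by simp
  thus "\<iota>Hs \<one>\<^bsub>Hs\<^esub> = \<one>\<^bsub>DH\<^esub>" by simp
qed

lemma exp_mult_Hs: "l \<in> carrier Hs \<Longrightarrow> lexp Hs a \<otimes>\<^bsub>Hs\<^esub> l = lexp Ks (dHs a) \<otimes>\<^bsub>Ks\<^esub> l"
  using Hs_Ks(3)[OF Hs.exp_closed, of l a] by (simp only: Hs_Ks(2))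

lemma AdL_exp: "l \<in> carrier Hs \<Longrightarrow> AdL (lexp Hs a \<otimes>\<^bsub>Hs\<^esub> l) A = Ad D (lexp D (vjoin 0 (dHs a))) (AdL l A)"
  by (simp only: exp_mult_Hs) (simp add: Hs_Ks(1) \<iota>Ks_mult \<iota>Ks_exp D.Ad_mult)

text \<open>Infinitesimally this is \<open>\<Psi>_bracket\<close>. \<open>Ad_exp_intertwine\<close>
  integrates it over one exponential, and connectedness of H* reaches every l. In particular Ad l
  preserves h + h*.\<close>

lemma AdL_\<Psi>: "l \<in> carrier Hs \<Longrightarrow> AdL l (\<Psi> A) = \<Psi> (Ad DH (\<iota>Hs l) A)"
proof -
  have "\<forall>A. AdL l (\<Psi> A) = \<Psi> (Ad DH (\<iota>Hs l) A)" if "l \<in> carrier Hs"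
  proof (rule Hs.connected_exp_induct[OF Hs(2) _ _ that])
    show "\<forall>A. AdL \<one>\<^bsub>Hs\<^esub> (\<Psi> A) = \<Psi> (Ad DH (\<iota>Hs \<one>\<^bsub>Hs\<^esub>) A)" by (simp add: one_Hs D.Ad_one DH.Ad_one)
  next
    fix x a assume x: "x \<in> carrier Hs" and IH: "\<forall>A. AdL x (\<Psi> A) = \<Psi> (Ad DH (\<iota>Hs x) A)"
    have "\<Psi> (Ad DH (lexp DH (vjoin 0 a)) B) = Ad D (lexp D (vjoin 0 (dHs a))) (\<Psi> B)" for B
      by (rule Ad_exp_intertwine[OF lie_groups(6,2) \<Psi>_linear])
        (simp add: \<Psi>_bracket, simp add: \<Psi>_def klinear_zero[OF dH_linear])
    thus "\<forall>A. AdL (lexp Hs a \<otimes>\<^bsub>Hs\<^esub> x) (\<Psi> A) = \<Psi> (Ad DH (\<iota>Hs (lexp Hs a \<otimes>\<^bsub>Hs\<^esub> x)) A)"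
      using x IH by (simp add: AdL_exp \<iota>Hs_mult \<iota>Hs_exp DH.Ad_mult)
  qed
  thus "l \<in> carrier Hs \<Longrightarrow> ?thesis" by blast
qed

lemma AdL_isometry: "l \<in> carrier Hs \<Longrightarrow> dpair (AdL l A) (AdL l B) = dpair A B"
proof -
  have "\<forall>A B. dpair (AdL l A) (AdL l B) = dpair A B" if "l \<in> carrier Hs"
  proof (rule Hs.connected_exp_induct[OF Hs(2) _ _ that])
    show "\<forall>A B. dpair (AdL \<one>\<^bsub>Hs\<^esub> A) (AdL \<one>\<^bsub>Hs\<^esub> B) = dpair A B" by (simp add: one_Hs D.Ad_one)
  next
    fix x a assume x: "x \<in> carrier Hs" and IH: "\<forall>A B. dpair (AdL x A) (AdL x B) = dpair A B"
    thus "\<forall>A B. dpair (AdL (lexp Hs a \<otimes>\<^bsub>Hs\<^esub> x) A) (AdL (lexp Hs a \<otimes>\<^bsub>Hs\<^esub> x) B) = dpair A B"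
      by (simp add: AdL_exp Ad_exp_isometry[OF lie_groups(2) dpair_inv])
  qed
  thus "l \<in> carrier Hs \<Longrightarrow> ?thesis" by blast
qed

lemma AdL_linear: "l \<in> carrier Hs \<Longrightarrow> klinear (AdL l)"
  by (simp add: D.Ad_linear Hs_Ks)

lemma AdL_inv: "l \<in> carrier Hs \<Longrightarrow> Ad D (inv\<^bsub>D\<^esub> (\<iota>Ks l)) (AdL l A) = A"
  "l \<in> carrier Hs \<Longrightarrow> AdL l (Ad D (inv\<^bsub>D\<^esub> (\<iota>Ks l)) A) = A"
  by (simp_all add: D.Ad_inv D.Ad_inv' Hs_Ks)

lemma AdL_inv_\<Psi>: 
  assumes l: "l \<in> carrier Hs"
  shows "Ad D (inv\<^bsub>D\<^esub> (\<iota>Ks l)) (\<Psi> A) = \<Psi> (Ad DH (inv\<^bsub>DH\<^esub> (\<iota>Hs l)) A)"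
  using AdL_\<Psi>[OF l, of "Ad DH (inv\<^bsub>DH\<^esub> (\<iota>Hs l)) A", symmetric]
  by (simp add: DH.Ad_inv' l AdL_inv)

lemma AdL_s: "l \<in> carrier Ks \<Longrightarrow> AdL l (vjoin 0 \<alpha>) = vjoin 0 (Ad Ks l \<alpha>)"
  using lie_subgroup_Ad[OF Ks_in_D, of l \<alpha>] by simp

text \<open>The orthogonal complement of h + h*, the range of \<open>\<Psi>\<close>, is m + m*,
  because m and h-perp are the annihilators of h* and h.\<close>

lemma AdL_mm_aux:
  assumes "\<And>A. dpair Z (\<Psi> A) = 0"
  shows "vfst Z \<in> \<mm>" "hscomp (vsnd Z) = 0"
proof -
  have "pair (dHs \<alpha>) (vfst Z) = 0" for \<alpha>
    using assms[of "vjoin 0 \<alpha>"] by (simp add: \<Psi>_def dpair_def klinear_zero[OF dH_linear])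
  thus "vfst Z \<in> \<mm>" by (simp add: mm_iff hcomp_def vec_eq_iff)
  have "pair (vsnd Z) (dH X) = 0" for X
    using assms[of "vjoin X 0"] by (simp add: \<Psi>_def dpair_def klinear_zero[OF dHs_linear])
  thus "hscomp (vsnd Z) = 0" by (simp add: hscomp_def vec_eq_iff)
qed

text \<open>On H* and m the projections in \<open>m_part\<close> and \<open>mstar_part\<close>
  thereby reduce to \<open>vfst\<close> and \<open>vsnd\<close>.\<close>

lemma AdL_mm:
  assumes l: "l \<in> carrier Hs" and X: "X \<in> \<mm>"
  shows "vfst (AdL l (vjoin X 0)) \<in> \<mm>" "hscomp (vsnd (AdL l (vjoin X 0))) = 0"
proof -
  have "dpair (AdL l (vjoin X 0)) (\<Psi> A) = 0" for A
  proof -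
    have "dpair (AdL l (vjoin X 0)) (\<Psi> A) = dpair (vjoin X 0) (\<Psi> (Ad DH (inv\<^bsub>DH\<^esub> (\<iota>Hs l)) A))"
      using AdL_isometry[OF l, of "vjoin X 0" "Ad D (inv\<^bsub>D\<^esub> (\<iota>Ks l)) (\<Psi> A)", unfolded AdL_inv(2)[OF l]] by (simp add: l AdL_inv_\<Psi>)
    thus ?thesis using X by (simp add: \<Psi>_def dpair_vjoin pair_dHs_mm)
  qed
  thus "vfst (AdL l (vjoin X 0)) \<in> \<mm>" "hscomp (vsnd (AdL l (vjoin X 0))) = 0" by (rule AdL_mm_aux)+
qed

lemma component_mm:
  assumes "X \<in> \<mm>"
  shows "component \<mm> (range dH) X = X"
  unfolding component_def
proof (rule the_equality)
  show "X \<in> \<mm> \<and> X - X \<in> range dH" using assms klinear_zero[OF dH_linear] by (auto intro: range_eqI[of _ _ 0])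
next
  fix Y assume Y: "Y \<in> \<mm> \<and> X - Y \<in> range dH"
  then obtain y where y: "X - Y = dH y" by blast
  have "hcomp (X - Y) = 0" using Y assms by (simp add: mm_iff klinear_diff[OF hcomp_linear])
  thus "Y = X" using y by (simp add: klinear_zero[OF dH_linear])
qed

lemma component_mstar:
  assumes "hscomp \<alpha> = 0"
  shows "component (perp (range dH)) (perp \<mm>) \<alpha> = \<alpha>"
  unfolding component_def
proof (rule the_equality)
  show "\<alpha> \<in> perp (range dH) \<and> \<alpha> - \<alpha> \<in> perp \<mm>" using assms by (simp add: hperp_iff) (simp add: perp_def)
next
  fix \<beta> assume b: "\<beta> \<in> perp (range dH) \<and> \<alpha> - \<beta> \<in> perp \<mm>"
  then obtain y where y: "\<alpha> - \<beta> = dHs y" by (auto simp: perp_mm)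
  have "hscomp (\<alpha> - \<beta>) = 0" using b assms by (simp add: hperp_iff klinear_diff[OF hscomp_linear])
  thus "\<beta> = \<alpha>" using y by (simp add: klinear_zero[OF dHs_linear])
qed

lemma m_part_eq: "l \<in> carrier Hs \<Longrightarrow> X \<in> \<mm> \<Longrightarrow> m_part D \<iota>Ks (range dH) \<mm> l X = vfst (AdL l (vjoin X 0))"
  by (simp add: m_part_def component_mm AdL_mm)

lemma mstar_part_eq: "l \<in> carrier Hs \<Longrightarrow> X \<in> \<mm> \<Longrightarrow> mstar_part D \<iota>Ks (range dH) \<mm> l X = vsnd (AdL l (vjoin X 0))"
  by (simp add: mstar_part_def component_mstar AdL_mm)

end

section \<open>The inverse of the matrix \<open>C\<close> and its derivatives\<close>

context reductive_data begin

section \<open>The invariant trilinear form and its isotropic subspaces\<close>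

lemma lie_br_zero [simp]: "lie_br K 0 X = 0" "lie_br K X 0 = 0" "lie_br Ks 0 \<alpha> = 0" "lie_br Ks \<alpha> 0 = 0"
  "lie_br D 0 A = 0" "lie_br D A 0 = 0"
  using klinear_zero[OF K.lie_br_linear_left] klinear_zero[OF K.lie_br_linear_right]
    klinear_zero[OF Ks.lie_br_linear_left] klinear_zero[OF Ks.lie_br_linear_right]
    klinear_zero[OF D.lie_br_linear_left] klinear_zero[OF D.lie_br_linear_right] by simp_all

text \<open>Invariance moves every bracket of the double onto two arguments from the same half, so
  the trilinear form is expressed by the brackets of k and of k* alone.\<close>

lemma dpair_triple:
  "dpair (vjoin X \<xi>) (lie_br D (vjoin Y \<eta>) (vjoin Z \<zeta>)) =
    pair \<xi> (lie_br K Y Z) + pair (lie_br Ks \<eta> \<zeta>) X - pair \<zeta> (lie_br K Y X) + pair \<eta> (lie_br K Z X)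
    - pair (lie_br Ks \<xi> \<zeta>) Y + pair (lie_br Ks \<xi> \<eta>) Z"
proof -
  have mixed: "dpair (vjoin X \<xi>) (lie_br D (vjoin 0 \<eta>) (vjoin Z 0)) = pair \<eta> (lie_br K Z X) + pair (lie_br Ks \<xi> \<eta>) Z"
    for X \<xi> \<eta> Z
  proof -
    have "dpair (vjoin X 0) (lie_br D (vjoin 0 \<eta>) (vjoin Z 0)) = pair \<eta> (lie_br K Z X)"
      by (subst dpair_commute) (simp add: dpair_inv br_kk dpair_vjoin)
    moreover have "dpair (vjoin 0 \<xi>) (lie_br D (vjoin 0 \<eta>) (vjoin Z 0)) = pair (lie_br Ks \<xi> \<eta>) Z"
      by (subst dpair_inv[symmetric]) (simp add: br_ss dpair_vjoin)
    ultimately show ?thesis by (subst vjoin_split) simp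
  qed
  have mixed': "dpair (vjoin X \<xi>) (lie_br D (vjoin Y 0) (vjoin 0 \<zeta>)) = - pair \<zeta> (lie_br K Y X) - pair (lie_br Ks \<xi> \<zeta>) Y"
    by (subst D.lie_br_antisym) (simp add: mixed)
  have kk: "dpair (vjoin X \<xi>) (lie_br D (vjoin Y 0) (vjoin Z 0)) = pair \<xi> (lie_br K Y Z)"
    and ss: "dpair (vjoin X \<xi>) (lie_br D (vjoin 0 \<eta>) (vjoin 0 \<zeta>)) = pair (lie_br Ks \<eta> \<zeta>) X"
    by (simp_all add: br_kk br_ss dpair_vjoin)
  show ?thesis
    unfolding vjoin_split[of Y \<eta>] vjoin_split[of Z \<zeta>] D.lie_br_add_left D.lie_br_add_right dpair_arith
      mixed mixed' kk ss by (simp add: algebra_simps)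
qed

lemma AdL_isotropic:
  assumes l: "l \<in> carrier Hs"
  shows "dpair (AdL l (vjoin X 0)) (lie_br D (AdL l (vjoin Y 0)) (AdL l (vjoin Z 0))) = 0"
  using l by (simp add: D.Ad_bracket[symmetric] Hs_Ks(1) AdL_isometry br_kk dpair_vjoin)

lemma pair_dHs_bracket: "X \<in> \<mm> \<Longrightarrow> pair (lie_br Ks (dHs a) (dHs b)) X = 0"
  by (simp only: dHs_br[symmetric] pair_dHs_mm)

text \<open>The terms with one argument in \<open>\<hh>\<^sup>*\<close> cancel in pairs; the remaining ones form the isotropy condition.\<close>

lemma manin_cyclic_identity:
  assumes iso: "dpair (vjoin X \<xi>) (lie_br D (vjoin Y \<eta>) (vjoin Z \<zeta>)) = 0"
    and m: "X \<in> \<mm>" "Y \<in> \<mm>" "Z \<in> \<mm>"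
    and \<alpha>: "\<alpha> = dHs a + \<xi>" and \<beta>: "\<beta> = dHs b + \<eta>" and \<gamma>: "\<gamma> = dHs c + \<zeta>"
  shows "(pair (lie_br Ks \<beta> \<gamma>) X - pair \<beta> (lie_br K X Z) - dpair (vjoin Z \<zeta>) (lie_br D (vjoin 0 (dHs a)) (vjoin Y \<eta>))) +
    (pair (lie_br Ks \<gamma> \<alpha>) Y - pair \<gamma> (lie_br K Y X) - dpair (vjoin X \<xi>) (lie_br D (vjoin 0 (dHs b)) (vjoin Z \<zeta>))) +
    (pair (lie_br Ks \<alpha> \<beta>) Z - pair \<alpha> (lie_br K Z Y) - dpair (vjoin Y \<eta>) (lie_br D (vjoin 0 (dHs c)) (vjoin X \<xi>))) = 0"
proof -
  note K_anti = K.lie_br_antisym[of Y X] K.lie_br_antisym[of Z X] K.lie_br_antisym[of Z Y]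
  note Ks_anti = Ks.lie_br_antisym[of \<eta> \<xi>] Ks.lie_br_antisym[of \<zeta> \<xi>] Ks.lie_br_antisym[of \<zeta> \<eta>]
    Ks.lie_br_antisym[of \<xi> "dHs b"] Ks.lie_br_antisym[of \<xi> "dHs c"] Ks.lie_br_antisym[of \<eta> "dHs a"]
    Ks.lie_br_antisym[of \<eta> "dHs c"] Ks.lie_br_antisym[of \<zeta> "dHs a"] Ks.lie_br_antisym[of \<zeta> "dHs b"]
  show ?thesis
    using iso unfolding dpair_triple \<alpha> \<beta> \<gamma>
    by (simp add: Ks.lie_br_add_left Ks.lie_br_add_right pair_dHs_bracket m K_anti Ks_anti algebra_simps)
qed

end

text \<open>\<open>Cinv\<close> is specified pointwise as an inverse matrix, so smooth dependence on
  l has to be derived.\<close>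

locale dynamical_data = reductive_data K H Ks Hs D DH dH dHs \<iota>K \<iota>Ks \<iota>H \<iota>Hs \<mm>
  for K :: "('g, 'k::{real_normed_field,euclidean_space}, 'm::finite) lie_group_data"
    and H :: "('g, 'k, 'h::finite) lie_group_data"
    and Ks :: "('s, 'k, 'm) lie_group_data"
    and Hs :: "('s, 'k, 'h) lie_group_data"
    and D :: "('d, 'k, 'm + 'm) lie_group_data"
    and DH :: "('e, 'k, 'h + 'h) lie_group_data"
    and dH dHs \<iota>K \<iota>Ks \<iota>H \<iota>Hs \<mm> +
  fixes J :: "'i set" and M :: "'i \<Rightarrow> 'k^'m" and Cinv :: "'s \<Rightarrow> 'i \<Rightarrow> 'i \<Rightarrow> 'k" and V :: "'s set"
  assumes J: "finite J" and M: "vec.span (M ` J) = \<mm>"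
    and V: "aopen (atlas Hs) V"
    and C: "\<And>l. l \<in> V \<Longrightarrow> inverse_matrix_on J (C_matrix D \<iota>Ks (range dH) \<mm> M l) (Cinv l)"
begin

lemma V_carrier: "l \<in> V \<Longrightarrow> l \<in> carrier Hs"
  using Hs.aopen_subset_carrier[OF V] by blast

lemma M_in: "j \<in> J \<Longrightarrow> M j \<in> \<mm>"
  using M vec.span_base by blast

section \<open>The graph description of Ad l m\<close>

text \<open>For j in J the vectors N l j + B l j span Ad l m inside m + m*. This subspace is
  isotropic, which is the content of \<open>B_antisym\<close>.\<close>

definition N :: "'s \<Rightarrow> 'i \<Rightarrow> 'k^'m" where "N l j = vfst (AdL l (vjoin (M j) 0))"

definition B :: "'s \<Rightarrow> 'i \<Rightarrow> 'k^'m" where "B l j = vsnd (AdL l (vjoin (M j) 0))"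

text \<open>\<open>T l\<close> is the tensor \<open>r\<^sup>* - r\<close> at \<open>l\<close>, before the inclusion of \<open>\<kk>\<close> into \<open>\<gg>\<close>.\<close>

definition T :: "'s \<Rightarrow> 'k^'m^'m" where
  "T l = (\<chi> a b. \<Sum>i\<in>J. \<Sum>j\<in>J. Cinv l i j * N l i $ a * N l j $ b)"

text \<open>The map \<rho> of the overview, on all of k*; by \<open>rs_mscomp\<close> it depends
  only on the m*-component of its argument.\<close>

definition rs :: "'s \<Rightarrow> 'k^'m \<Rightarrow> 'k^'m" where "rs l \<beta> = (\<chi> b. \<Sum>a\<in>UNIV. \<beta> $ a * T l $ a $ b)"

lemma rs_linear: "klinear (rs l)"
  by (rule klinearI) (simp_all add: rs_def vec_eq_iff sum.distrib distrib_right sum_distrib_left mult.assoc)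

lemma rs_eq: "rs l \<beta> = (\<Sum>j\<in>J. (\<Sum>i\<in>J. Cinv l i j * pair \<beta> (N l i)) *s N l j)"
proof -
  have "rs l \<beta> $ b = (\<Sum>j\<in>J. (\<Sum>i\<in>J. Cinv l i j * pair \<beta> (N l i)) *s N l j) $ b" for b
  proof -
    have "rs l \<beta> $ b = (\<Sum>a\<in>UNIV. \<Sum>j\<in>J. \<Sum>i\<in>J. \<beta> $ a * (Cinv l i j * N l i $ a * N l j $ b))"
      unfolding rs_def T_def vec_lambda_beta by (subst sum.swap[of _ J J]) (simp only: sum_distrib_left)
    also have "\<dots> = (\<Sum>j\<in>J. \<Sum>i\<in>J. \<Sum>a\<in>UNIV. \<beta> $ a * (Cinv l i j * N l i $ a * N l j $ b))"
      by (subst sum.swap) (intro sum.cong refl sum.swap)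
    finally show ?thesis by (simp add: pair_def sum_distrib_left sum_distrib_right mult_ac)
  qed
  thus ?thesis by (simp add: vec_eq_iff)
qed

lemma N_in: "l \<in> V \<Longrightarrow> j \<in> J \<Longrightarrow> N l j \<in> \<mm>"
  unfolding N_def by (rule AdL_mm(1)[OF V_carrier M_in])

lemma B_antisym:
  assumes "l \<in> V"
  shows "pair (B l i) (N l j) = - pair (B l j) (N l i)"
  using AdL_isometry[OF V_carrier[OF assms], of "vjoin (M i) 0" "vjoin (M j) 0"]
  by (simp add: dpair_def B_def N_def eq_neg_iff_add_eq_0)

lemma C_eq: "l \<in> V \<Longrightarrow> i \<in> J \<Longrightarrow> j \<in> J \<Longrightarrow> C_matrix D \<iota>Ks (range dH) \<mm> M l i j = pair (B l j) (N l i)"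
  by (simp add: C_matrix_def m_part_eq mstar_part_eq V_carrier M_in B_def N_def dpair_vjoin)

lemma C_inv:
  assumes "l \<in> V" "i \<in> J" "j \<in> J"
  shows "(\<Sum>k\<in>J. pair (B l k) (N l i) * Cinv l k j) = (if i = j then 1 else 0)"
    "(\<Sum>k\<in>J. Cinv l i k * pair (B l j) (N l k)) = (if i = j then 1 else 0)"
proof -
  have "(\<Sum>k\<in>J. C_matrix D \<iota>Ks (range dH) \<mm> M l i k * Cinv l k j) = (if i = j then 1 else 0)"
    "(\<Sum>k\<in>J. Cinv l i k * C_matrix D \<iota>Ks (range dH) \<mm> M l k j) = (if i = j then 1 else 0)"
    using C[OF assms(1)] assms(2,3) unfolding inverse_matrix_on_def by blast+
  moreover have "(\<Sum>k\<in>J. C_matrix D \<iota>Ks (range dH) \<mm> M l i k * Cinv l k j) = (\<Sum>k\<in>J. pair (B l k) (N l i) * Cinv l k j)"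
    "(\<Sum>k\<in>J. Cinv l i k * C_matrix D \<iota>Ks (range dH) \<mm> M l k j) = (\<Sum>k\<in>J. Cinv l i k * pair (B l j) (N l k))"
    by (intro sum.cong refl; simp add: C_eq assms)+
  ultimately show "(\<Sum>k\<in>J. pair (B l k) (N l i) * Cinv l k j) = (if i = j then 1 else 0)"
    "(\<Sum>k\<in>J. Cinv l i k * pair (B l j) (N l k)) = (if i = j then 1 else 0)" by simp_all
qed

text \<open>C is antisymmetric by \<open>B_antisym\<close>, and inverses inherit this. A Kronecker
  delta is written as Cinv times C; exchanging the indices of C lets the other factor Cinv contract
  with it instead.\<close>

lemma Cinv_antisym:
  assumes l: "l \<in> V" and ij: "i \<in> J" "j \<in> J"
  shows "Cinv l i j = - Cinv l j i"
proof -
  have d: "(\<Sum>p\<in>J. Cinv l j p * pair (B l k) (N l p)) = (if j = k then 1 else 0)" if "k \<in> J" for k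
    by (rule C_inv(2)[OF l ij(2) that])
  have "- Cinv l i j = (\<Sum>k\<in>J. - Cinv l i k * (if j = k then 1 else 0))"
    using ij J by (simp add: if_distrib cong: if_cong)
  also have "\<dots> = (\<Sum>k\<in>J. - Cinv l i k * (\<Sum>p\<in>J. Cinv l j p * pair (B l k) (N l p)))"
    by (intro sum.cong refl) (simp only: d)
  also have "\<dots> = (\<Sum>k\<in>J. \<Sum>p\<in>J. Cinv l i k * Cinv l j p * pair (B l p) (N l k))"
    unfolding sum_distrib_left
  proof (intro sum.cong refl)
    fix k p show "- Cinv l i k * (Cinv l j p * pair (B l k) (N l p)) = Cinv l i k * Cinv l j p * pair (B l p) (N l k)"
      by (subst B_antisym[OF l, of k p]) simp
  qed
  also have "\<dots> = (\<Sum>p\<in>J. Cinv l j p * (\<Sum>k\<in>J. Cinv l i k * pair (B l p) (N l k)))"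
    by (subst sum.swap) (simp add: sum_distrib_left mult_ac)
  also have "\<dots> = (\<Sum>p\<in>J. Cinv l j p * (if i = p then 1 else 0))"
    by (intro sum.cong refl) (simp only: C_inv(2)[OF l ij(1)])
  also have "\<dots> = Cinv l j i" using ij J by (simp add: if_distrib cong: if_cong)
  finally show ?thesis by (rule minus_equation_iff[THEN iffD1, symmetric])
qed

text \<open>\<open>rs\<close> contracts the first index of \<open>Cinv\<close>, while the inverse
  relation in \<open>C_inv\<close> contracts the second. Exchanging the two by antisymmetry produces
  the minus sign.\<close>

lemma rs_B:
  assumes l: "l \<in> V" and k: "k \<in> J"
  shows "rs l (B l k) = - N l k"
proof -
  have "(\<Sum>i\<in>J. Cinv l i j * pair (B l k) (N l i)) = - (if j = k then 1 else 0)" if j: "j \<in> J" for j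
  proof -
    have "(\<Sum>i\<in>J. Cinv l i j * pair (B l k) (N l i)) = - (\<Sum>i\<in>J. Cinv l j i * pair (B l k) (N l i))"
      unfolding sum_negf[symmetric]
    proof (rule sum.cong[OF refl])
      fix i assume "i \<in> J"
      thus "Cinv l i j * pair (B l k) (N l i) = - (Cinv l j i * pair (B l k) (N l i))"
        using Cinv_antisym[OF l _ j, of i] by simp
    qed
    thus ?thesis using C_inv(2)[OF l j k] by simp
  qed
  hence "rs l (B l k) = (\<Sum>j\<in>J. (- (if j = k then 1 else 0)) *s N l j)"
    unfolding rs_eq by (intro sum.cong) simp_all
  also have "\<dots> = (\<Sum>j\<in>J. if j = k then - N l j else 0)" by (intro sum.cong) simp_all
  also have "\<dots> = - N l k" using k J by simp
  finally show ?thesis .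
qed

lemma rs_AdL:
  assumes l: "l \<in> V" and Y: "Y \<in> \<mm>"
  shows "rs l (vsnd (AdL l (vjoin Y 0))) = - vfst (AdL l (vjoin Y 0))"
proof -
  define F where "F Y = rs l (vsnd (AdL l (vjoin Y 0))) + vfst (AdL l (vjoin Y 0))" for Y :: "'k^'m"
  note kl = AdL_linear[OF V_carrier[OF l]]
  have add: "vjoin (x + y) 0 = vjoin x 0 + (vjoin y 0 :: 'k^('m+'m))" for x y :: "'k^'m" by (rule vjoin_eqI) simp_all
  have sm: "vjoin (c *s x) 0 = c *s (vjoin x 0 :: 'k^('m+'m))" for c and x :: "'k^'m" by (rule vjoin_eqI) simp_all
  have F: "klinear F"
    by (rule klinearI) (simp_all add: F_def add sm klinear_add[OF kl] klinear_smult[OF kl]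
        klinear_add[OF rs_linear] klinear_smult[OF rs_linear] vec.scale_right_distrib)
  have "Y \<in> vec.span (M ` J)" using Y M by simp
  hence "F Y = 0"
  proof (rule vec.span_induct)
    show "vec.subspace {x. F x = 0}"
      by (rule vec.subspaceI) (simp_all add: klinear_zero[OF F] klinear_add[OF F] klinear_smult[OF F])
  next
    fix x assume "x \<in> M ` J"
    then obtain j where "j \<in> J" "x = M j" by blast
    thus "F x = 0" using rs_B[OF l, of j] by (simp add: F_def N_def B_def)
  qed
  thus ?thesis by (simp add: F_def eq_neg_iff_add_eq_0)
qed

lemma rs_in: "l \<in> V \<Longrightarrow> rs l \<beta> \<in> \<mm>"
proof -
  assume l: "l \<in> V"
  have "hcomp (rs l \<beta>) = (\<Sum>j\<in>J. (\<Sum>i\<in>J. Cinv l i j * pair \<beta> (N l i)) *s hcomp (N l j))"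
    unfolding rs_eq klinear_sum[OF hcomp_linear] klinear_smult[OF hcomp_linear] ..
  also have "\<dots> = (\<Sum>j\<in>J. 0)" using N_in[OF l] by (intro sum.cong refl) (simp add: mm_iff)
  finally show ?thesis by (simp add: mm_iff)
qed

lemma rs_mscomp: "l \<in> V \<Longrightarrow> rs l (mscomp \<beta>) = rs l \<beta>"
  unfolding rs_eq using N_in by (intro sum.cong refl) (simp add: pair_mscomp[symmetric])

lemma rs_antisym:
  assumes l: "l \<in> V"
  shows "pair \<gamma> (rs l \<beta>) = - pair \<beta> (rs l \<gamma>)"
proof -
  have "pair \<gamma> (rs l \<beta>) = (\<Sum>j\<in>J. \<Sum>i\<in>J. Cinv l i j * pair \<beta> (N l i) * pair \<gamma> (N l j))"
    by (simp add: rs_eq pair_sum_right sum_distrib_right)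
  also have "\<dots> = (\<Sum>j\<in>J. \<Sum>i\<in>J. - (Cinv l j i * pair \<gamma> (N l j) * pair \<beta> (N l i)))"
  proof (intro sum.cong refl)
    fix i j assume "i \<in> J" "j \<in> J"
    thus "Cinv l i j * pair \<beta> (N l i) * pair \<gamma> (N l j) = - (Cinv l j i * pair \<gamma> (N l j) * pair \<beta> (N l i))"
      using Cinv_antisym[OF l, of i j] by simp
  qed
  also have "\<dots> = - (\<Sum>i\<in>J. \<Sum>j\<in>J. Cinv l j i * pair \<gamma> (N l j) * pair \<beta> (N l i))"
    by (subst sum.swap) (simp add: sum_negf)
  also have "\<dots> = - pair \<beta> (rs l \<gamma>)"
    by (simp add: rs_eq pair_sum_right sum_distrib_right)
  finally show ?thesis .
qed

text \<open>The inverse of \<open>Q l\<close> expresses \<open>rs l\<close> through the smooth matrix of \<open>Q l\<close> by Cramer's rule.\<close>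

definition Q :: "'s \<Rightarrow> 'k^'m \<Rightarrow> 'k^'m" where
  "Q l x = vsnd (AdL l (vjoin (mcomp x) 0)) + dHs (hcomp x)"

lemma vjoin_mcomp_linear: "klinear (\<lambda>x. vjoin (mcomp x) 0 :: 'k^('m+'m))"
  by (rule klinearI; rule vjoin_eqI)
    (simp_all add: mcomp_def klinear_add[OF hcomp_linear] klinear_smult[OF hcomp_linear]
      klinear_add[OF dH_linear] klinear_smult[OF dH_linear] vec.scale_right_diff_distrib)

lemma AdL_mcomp_linear: "l \<in> carrier Hs \<Longrightarrow> klinear (\<lambda>x. AdL l (vjoin (mcomp x) 0))"
  by (rule klinearI) (simp_all add: klinear_add[OF vjoin_mcomp_linear] klinear_smult[OF vjoin_mcomp_linear]
      klinear_add[OF AdL_linear] klinear_smult[OF AdL_linear])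

lemma Q_linear: "l \<in> V \<Longrightarrow> klinear (Q l)"
  by (rule klinearI) (simp_all add: Q_def klinear_add[OF AdL_mcomp_linear[OF V_carrier]] klinear_smult[OF AdL_mcomp_linear[OF V_carrier]]
      klinear_add[OF hcomp_linear] klinear_smult[OF hcomp_linear] klinear_add[OF dHs_linear] klinear_smult[OF dHs_linear]
      vec.scale_right_distrib)

lemma mscomp_Q: "l \<in> V \<Longrightarrow> mscomp (Q l x) = vsnd (AdL l (vjoin (mcomp x) 0))"
  using AdL_mm(2)[OF V_carrier mcomp_in] by (simp add: Q_def mscomp_add mscomp_id)

lemma mscomp_zero: "mscomp 0 = 0"
  by (simp add: mscomp_def klinear_zero[OF hscomp_linear] klinear_zero[OF dHs_linear])

text \<open>This is where non-degeneracy of C is felt: if the m*-part of Ad l Y vanishes, so does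
  its m-part by \<open>rs_AdL\<close>, and Y = 0. The summand \<open>dHs (hcomp x)\<close> of
  \<open>Q\<close> extends this injection of m into m* to a map between spaces of the same
  coordinate dimension, so that determinants apply.\<close>

lemma Q_zero_imp:
  assumes l: "l \<in> V" and x: "Q l x = 0"
  shows "x = 0"
proof -
  have s: "vsnd (AdL l (vjoin (mcomp x) 0)) = 0" using mscomp_Q[OF l, of x] x by (simp add: mscomp_zero)
  hence "dHs (hcomp x) = 0" using x by (simp add: Q_def)
  hence h: "hcomp x = 0" using dHs_inj klinear_zero[OF dHs_linear] by (metis injD)
  have "vfst (AdL l (vjoin (mcomp x) 0)) = 0"
    using rs_AdL[OF l mcomp_in, of x] s by (simp add: klinear_zero[OF rs_linear])
  with s have "AdL l (vjoin (mcomp x) 0) = 0" by (metis vjoin_vfst_vsnd vjoin_zero)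
  hence "vjoin (mcomp x) 0 = (0 :: 'k^('m+'m))"
    using AdL_inv(1)[OF V_carrier[OF l], of "vjoin (mcomp x) 0"] V_carrier[OF l]
    by (simp add: klinear_zero[OF D.Ad_linear] Hs_Ks(1))
  hence "mcomp x = 0" by (metis vfst_vjoin vfst_arith(1))
  thus ?thesis using h by (simp add: mcomp_def klinear_zero[OF dH_linear])
qed

lemma det_Q: "l \<in> V \<Longrightarrow> det (matrix (Q l)) \<noteq> 0"
proof -
  assume l: "l \<in> V"
  have "\<exists>B. B ** matrix (Q l) = mat 1"
    unfolding matrix_left_invertible_ker using Q_zero_imp[OF l] matrix_works[OF Q_linear[OF l]] by simp
  hence "invertible (matrix (Q l))" by (simp add: invertible_left_inverse)
  thus ?thesis by (simp add: invertible_det_nz)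
qed

definition Qinv :: "'s \<Rightarrow> 'k^'m \<Rightarrow> 'k^'m" where
  "Qinv l b = (\<chi> k. det (\<chi> i j. if j = k then b $ i else matrix (Q l) $ i $ j) / det (matrix (Q l)))"

lemma Q_Qinv: "l \<in> V \<Longrightarrow> Q l (Qinv l b) = b"
  using cramer[OF det_Q, of l "Qinv l b" b] matrix_works[OF Q_linear] by (simp add: Qinv_def)

lemma rs_Qinv: "l \<in> V \<Longrightarrow> rs l \<beta> = - vfst (AdL l (vjoin (mcomp (Qinv l \<beta>)) 0))"
  using mscomp_Q[of l "Qinv l \<beta>"] rs_AdL[OF _ mcomp_in, of l "Qinv l \<beta>"] rs_mscomp[of l \<beta>] by (simp add: Q_Qinv)

text \<open>The m*-component of any covector is the m*-part of a point of Ad l m. These are the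
  points to which isotropy is applied later.\<close>

lemma rs_graph:
  assumes "l \<in> V"
  obtains Y where "Y \<in> \<mm>" "AdL l (vjoin Y 0) = vjoin (- rs l \<beta>) (mscomp \<beta>)"
proof
  show "mcomp (Qinv l \<beta>) \<in> \<mm>" by (rule mcomp_in)
  show "AdL l (vjoin (mcomp (Qinv l \<beta>)) 0) = vjoin (- rs l \<beta>) (mscomp \<beta>)"
    using rs_Qinv[OF assms, of \<beta>] mscomp_Q[OF assms, of "Qinv l \<beta>"] by (intro vjoin_eqI) (simp_all add: Q_Qinv assms)
qed

lemma Hs_incl_smooth: "smooth_map (atlas Hs) (carrier Hs) (atlas Ks) (\<lambda>x. x)"
  using Hs(1) by (simp add: lie_subgroup_def)

lemma AdL_smooth: "smooth_fun (atlas Hs) V (\<lambda>l. AdL l A $ i)"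
proof -
  have i: "smooth_map (atlas Ks) (carrier Ks) (atlas D) \<iota>Ks" using Ks_in_D by (simp add: lie_subgroup_def)
  have "smooth_map (atlas Hs) (carrier Hs) (atlas D) (\<lambda>l. \<iota>Ks l)"
    by (rule smooth_map_compose[OF Hs_incl_smooth i _ Hs.inj_charts Ks.inj_charts]) (use Hs_Ks(1) in blast)
  from smooth_fun_compose[OF this D.Ad_smooth _ Hs.inj_charts D.inj_charts Hs.aopen_carrier D.aopen_carrier]
  have "smooth_fun (atlas Hs) (carrier Hs) (\<lambda>l. AdL l A $ i)" using Hs_Ks(1) by (simp add: image_subset_iff)
  thus ?thesis by (rule smooth_fun_subset) (use V_carrier in blast)
qed

lemma det_smooth:
  assumes "\<And>i j. smooth_fun A S (\<lambda>l. F l $ i $ j)"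
  shows "smooth_fun A S (\<lambda>l. det (F l :: 'k^'q^'q))"
  unfolding det_def by (intro smooth_fun_sum smooth_fun_mult smooth_fun_const smooth_fun_prod assms)

lemma Q_smooth: "smooth_fun (atlas Hs) V (\<lambda>l. matrix (Q l) $ i $ j)"
  unfolding matrix_def Q_def vec_lambda_beta vector_add_component vsnd_def
  by (intro smooth_fun_add smooth_fun_const AdL_smooth)

text \<open>The entries of \<open>Cinv\<close> are bypassed: \<open>rs_Qinv\<close> expresses
  \<open>T\<close> by entries of \<open>AdL\<close> and Cramer quotients, whose denominator has no
  zero on V.\<close>

lemma T_smooth: "smooth_fun (atlas Hs) V (\<lambda>l. T l $ a $ b)"
proof -
  define s where "s l k = Qinv l (axis a 1) $ k" for l k
  have s: "smooth_fun (atlas Hs) V (\<lambda>l. s l k)" for k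
  proof -
    have e: "smooth_fun (atlas Hs) V (\<lambda>l. (\<chi> i j. if j = k then axis a 1 $ i else matrix (Q l) $ i $ j) $ i $ j)" for i j
      by (cases "j = k") (simp_all add: smooth_fun_const Q_smooth)
    show ?thesis unfolding s_def Qinv_def vec_lambda_beta
      by (intro smooth_fun_divide[OF Hs.inj_charts] det_smooth Q_smooth det_Q e)
  qed
  have A: "smooth_fun (atlas Hs) V (\<lambda>l. - (\<Sum>k\<in>UNIV. s l k * AdL l (vjoin (mcomp (axis k 1)) 0) $ Inl b))"
    by (intro smooth_fun_minus smooth_fun_sum smooth_fun_mult s AdL_smooth)
  have e: "- (\<Sum>k\<in>UNIV. s l k * AdL l (vjoin (mcomp (axis k 1)) 0) $ Inl b) = T l $ a $ b" if l: "l \<in> V" for l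
  proof -
    have "T l $ a $ b = rs l (axis a 1) $ b" by (simp add: rs_def sum_axis_left)
    also have "\<dots> = - AdL l (vjoin (mcomp (Qinv l (axis a 1))) 0) $ Inl b"
      by (simp add: rs_Qinv[OF l] vfst_def)
    also have "\<dots> = - (\<Sum>k\<in>UNIV. s l k * AdL l (vjoin (mcomp (axis k 1)) 0) $ Inl b)"
      unfolding s_def by (subst klinear_nth[OF AdL_mcomp_linear[OF V_carrier[OF l]]]) (rule refl)
    finally show ?thesis by simp
  qed
  show ?thesis by (rule smooth_fun_cong[OF Hs.inj_charts V e A])
qed

section \<open>Derivatives along right-invariant vector fields on H*\<close>

lemma AdL_deriv:
  assumes l: "l \<in> V"
  shows "((\<lambda>t. AdL (lexp Hs (t *s a) \<otimes>\<^bsub>Hs\<^esub> l) A $ i) has_field_derivative lie_br D (vjoin 0 (dHs a)) (AdL l A) $ i) (at 0)"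
proof -
  have v: "(vjoin 0 (dHs (t *s a)) :: 'k^('m + 'm)) = t *s vjoin 0 (dHs a)" for t
    by (rule vjoin_eqI) (simp_all add: klinear_smult[OF dHs_linear])
  have "(\<lambda>t. AdL (lexp Hs (t *s a) \<otimes>\<^bsub>Hs\<^esub> l) A $ i) = (\<lambda>t. Ad D (lexp D (t *s vjoin 0 (dHs a))) (AdL l A) $ i)"
    by (simp only: AdL_exp[OF V_carrier[OF l]] v)
  thus ?thesis using D.Ad_exp_deriv0 by simp
qed

text \<open>The relations for \<open>rs\<close> hold on V only. Openness makes them available along
  exp(t a) l for t near 0, as differentiation requires.\<close>

lemma exp_in_V:
  assumes l: "l \<in> V"
  shows "eventually (\<lambda>t. lexp Hs (t *s a) \<otimes>\<^bsub>Hs\<^esub> l \<in> V) (nhds 0)"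
proof -
  have "smooth_map vatl UNIV (atlas Hs) (\<lambda>X. lexp Hs X \<otimes>\<^bsub>Hs\<^esub> l)"
    using V_carrier[OF l] by (intro Hs.sm_mult Hs.exp_smooth Hs.sm_const chart_inj_vatl) auto
  from smooth_map_aopen[OF this chart_inj_vatl _ Hs.inj_charts V]
  have o: "open ((\<lambda>X. lexp Hs X \<otimes>\<^bsub>Hs\<^esub> l) -` V)" by simp
  have "continuous_on UNIV (\<lambda>t. t *s a)"
    using continuous_on_vec_lambda[of UNIV "\<lambda>i t. t * a $ i"] by (simp add: vector_scalar_mult_def continuous_on_mult_right)
  from open_vimage[OF o this] have "open ((\<lambda>t. t *s a) -` ((\<lambda>X. lexp Hs X \<otimes>\<^bsub>Hs\<^esub> l) -` V))" .
  moreover have "0 \<in> (\<lambda>t. t *s a) -` ((\<lambda>X. lexp Hs X \<otimes>\<^bsub>Hs\<^esub> l) -` V)"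
    using l V_carrier[OF l] by simp
  ultimately have "eventually (\<lambda>t. t \<in> (\<lambda>t. t *s a) -` ((\<lambda>X. lexp Hs X \<otimes>\<^bsub>Hs\<^esub> l) -` V)) (nhds 0)"
    by (rule eventually_nhds_in_open)
  thus ?thesis by simp
qed

lemma T_deriv:
  assumes l: "l \<in> V"
  obtains T' where "\<And>p q. ((\<lambda>t. T (lexp Hs (t *s a) \<otimes>\<^bsub>Hs\<^esub> l) $ p $ q) has_field_derivative T' p q) (at 0)"
proof -
  have "\<exists>d. ((\<lambda>t. T (lexp Hs (t *s a) \<otimes>\<^bsub>Hs\<^esub> l) $ p $ q) has_field_derivative d) (at 0)" for p q
  proof -
    from Hs.left_translation_derivative[OF V T_smooth[of p q]] l
    obtain g where "kgrad (\<lambda>X. T (lexp Hs X \<otimes>\<^bsub>Hs\<^esub> l) $ p $ q) 0 g" by blast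
    from kgrad_line[OF this] show ?thesis by blast
  qed
  thus ?thesis using that by metis
qed

text \<open>Differentiate the relation \<open>rs (B Y) = - A Y\<close>, where \<open>\<lambda> Y \<lambda>\<^sup>-\<^sup>1 = A Y + B Y\<close>.\<close>

lemma rs_deriv:
  assumes l: "l \<in> V"
  shows "((\<lambda>t. pair \<gamma> (rs (lexp Hs (t *s a) \<otimes>\<^bsub>Hs\<^esub> l) \<beta>)) has_field_derivative
    - dpair (vjoin (- rs l \<gamma>) (mscomp \<gamma>)) (lie_br D (vjoin 0 (dHs a)) (vjoin (- rs l \<beta>) (mscomp \<beta>)))) (at 0)"
proof -
  define lt where "lt t = lexp Hs (t *s a) \<otimes>\<^bsub>Hs\<^esub> l" for t
  have lt0: "lt 0 = l" using V_carrier[OF l] by (simp add: lt_def)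
  obtain T' where T': "\<And>p q. ((\<lambda>t. T (lt t) $ p $ q) has_field_derivative T' p q) (at 0)"
    using T_deriv[OF l, of a] unfolding lt_def by blast
  obtain Y where Y: "Y \<in> \<mm>" "AdL l (vjoin Y 0) = vjoin (- rs l \<beta>) (mscomp \<beta>)" using rs_graph[OF l] .
  define W where "W = lie_br D (vjoin 0 (dHs a)) (vjoin (- rs l \<beta>) (mscomp \<beta>))"
  have dA: "((\<lambda>t. AdL (lt t) (vjoin Y 0) $ i) has_field_derivative W $ i) (at 0)" for i
    using AdL_deriv[OF l, of a "vjoin Y 0" i] unfolding lt_def W_def Y(2) .
  have ev: "eventually (\<lambda>t. lt t \<in> V) (nhds 0)" unfolding lt_def by (rule exp_in_V[OF l])
  have rs_sum: "pair \<gamma> (rs l' \<eta>) = (\<Sum>q\<in>UNIV. \<Sum>p\<in>UNIV. \<gamma> $ q * (\<eta> $ p * T l' $ p $ q))" for l' \<eta>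
    by (simp add: pair_def rs_def sum_distrib_left)
  \<comment> \<open>The wanted derivative, with the argument of \<open>rs\<close> held fixed. It is
    found by differentiating the graph relation along exp(t a) l in two ways, where the moving
    argument adds a term with \<open>vsnd W\<close>.\<close>
  define \<tau> where "\<tau> = (\<Sum>q\<in>UNIV. \<Sum>p\<in>UNIV. \<gamma> $ q * (mscomp \<beta> $ p * T' p q))"
  have d1: "((\<lambda>t. pair \<gamma> (rs (lt t) (mscomp \<beta>))) has_field_derivative \<tau>) (at 0)"
    unfolding rs_sum \<tau>_def by (intro DERIV_sum DERIV_cmult T')
  have d2: "((\<lambda>t. pair \<gamma> (rs (lt t) \<beta>)) has_field_derivative \<tau>) (at 0)"
  proof (rule DERIV_cong_ev[THEN iffD1, OF refl _ refl d1])
    show "eventually (\<lambda>t. pair \<gamma> (rs (lt t) (mscomp \<beta>)) = pair \<gamma> (rs (lt t) \<beta>)) (nhds 0)"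
      using ev by eventually_elim (simp add: rs_mscomp)
  qed
  have "((\<lambda>t. pair \<gamma> (rs (lt t) (vsnd (AdL (lt t) (vjoin Y 0))))) has_field_derivative
     (\<Sum>q\<in>UNIV. \<Sum>p\<in>UNIV. \<gamma> $ q * (W $ Inr p * T (lt 0) $ p $ q + T' p q * AdL (lt 0) (vjoin Y 0) $ Inr p))) (at 0)"
    unfolding rs_sum vsnd_def vec_lambda_beta by (intro DERIV_sum DERIV_cmult DERIV_mult dA T')
  moreover have "(\<Sum>q\<in>UNIV. \<Sum>p\<in>UNIV. \<gamma> $ q * (W $ Inr p * T (lt 0) $ p $ q + T' p q * AdL (lt 0) (vjoin Y 0) $ Inr p)) =
     pair \<gamma> (rs l (vsnd W)) + \<tau>"
  proof -
    have "AdL l (vjoin Y 0) $ Inr p = mscomp \<beta> $ p" for p unfolding Y(2) by (simp add: vjoin_def)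
    thus ?thesis unfolding rs_sum \<tau>_def
      by (simp add: lt0 vsnd_def distrib_left sum.distrib mult.commute[of "T' _ _"])
  qed
  ultimately have d3: "((\<lambda>t. pair \<gamma> (rs (lt t) (vsnd (AdL (lt t) (vjoin Y 0))))) has_field_derivative pair \<gamma> (rs l (vsnd W)) + \<tau>) (at 0)"
    by simp
  have d4: "((\<lambda>t. - (\<Sum>q\<in>UNIV. \<gamma> $ q * AdL (lt t) (vjoin Y 0) $ Inl q)) has_field_derivative - (\<Sum>q\<in>UNIV. \<gamma> $ q * W $ Inl q)) (at 0)"
    by (intro DERIV_minus DERIV_sum DERIV_cmult dA)
  have "((\<lambda>t. pair \<gamma> (rs (lt t) (vsnd (AdL (lt t) (vjoin Y 0))))) has_field_derivative - pair \<gamma> (vfst W)) (at 0)"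
  proof (rule DERIV_cong_ev[THEN iffD1, OF refl _ _ d4])
    show "eventually (\<lambda>t. - (\<Sum>q\<in>UNIV. \<gamma> $ q * AdL (lt t) (vjoin Y 0) $ Inl q) = pair \<gamma> (rs (lt t) (vsnd (AdL (lt t) (vjoin Y 0))))) (nhds 0)"
      using ev by eventually_elim (simp add: rs_AdL Y(1), simp add: pair_def vfst_def)
    show "- (\<Sum>q\<in>UNIV. \<gamma> $ q * W $ Inl q) = - pair \<gamma> (vfst W)" by (simp add: pair_def vfst_def)
  qed
  from DERIV_unique[OF d3 this] have \<tau>: "\<tau> = - pair \<gamma> (vfst W) - pair \<gamma> (rs l (vsnd W))" by (simp add: algebra_simps)
  \<comment> \<open>\<open>vfst W\<close> lies in m: by invariance its pairing with h* is a bracket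
    of h* with itself, tested on an element of m. Hence \<gamma> may be replaced by its
    m*-component.\<close>
  have "pair (dHs b) (vfst W) = 0" for b
  proof -
    have "pair (dHs b) (vfst W) = dpair (vjoin 0 (dHs b)) W" by (simp add: dpair_vjoin)
    also have "\<dots> = dpair (lie_br D (vjoin 0 (dHs b)) (vjoin 0 (dHs a))) (vjoin (- rs l \<beta>) (mscomp \<beta>))"
      unfolding W_def by (simp only: dpair_inv)
    also have "\<dots> = 0" by (simp add: br_ss dpair_vjoin pair_dHs_bracket rs_in[OF l])
    finally show ?thesis .
  qed
  hence "vfst W \<in> \<mm>" by (simp add: mm_iff hcomp_def vec_eq_iff)
  hence "\<tau> = - dpair (vjoin (- rs l \<gamma>) (mscomp \<gamma>)) W"
    unfolding \<tau> dpair_vjoin using rs_antisym[OF l, of \<gamma> "vsnd W"] by (simp add: pair_mscomp[of "vfst W" \<gamma>])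
  thus ?thesis using d2 unfolding lt_def W_def by simp
qed

text \<open>In a dressing direction a = X - Ad l Y the second summand contributes nothing, because
  Ad l k is an isotropic subalgebra. The action of X in h remains, which is the equivariance of
  \<rho>.\<close>

lemma rs_dress_deriv:
  assumes l: "l \<in> V" and a: "vjoin 0 (dHs a) = vjoin (dH X) 0 - AdL l (vjoin Y 0)"
  shows "((\<lambda>t. pair \<gamma> (rs (lexp Hs (t *s a) \<otimes>\<^bsub>Hs\<^esub> l) \<beta>)) has_field_derivative
    pair \<gamma> (lie_br K (dH X) (rs l \<beta>)) - pair \<beta> (lie_br K (dH X) (rs l \<gamma>))) (at 0)"
proof -
  obtain P where P: "AdL l (vjoin P 0) = vjoin (- rs l \<beta>) (mscomp \<beta>)" using rs_graph[OF l] by metis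
  obtain S where S: "AdL l (vjoin S 0) = vjoin (- rs l \<gamma>) (mscomp \<gamma>)" using rs_graph[OF l] by metis
  have "dpair (vjoin (- rs l \<gamma>) (mscomp \<gamma>)) (lie_br D (AdL l (vjoin Y 0)) (vjoin (- rs l \<beta>) (mscomp \<beta>))) = 0"
    using AdL_isotropic[OF V_carrier[OF l], of S Y P] by (simp add: P S)
  hence "dpair (vjoin (- rs l \<gamma>) (mscomp \<gamma>)) (lie_br D (vjoin 0 (dHs a)) (vjoin (- rs l \<beta>) (mscomp \<beta>))) =
    dpair (vjoin (- rs l \<gamma>) (mscomp \<gamma>)) (lie_br D (vjoin (dH X) 0) (vjoin (- rs l \<beta>) (mscomp \<beta>)))"
    unfolding a diff_conv_add_uminus D.lie_br_add_left D.lie_br_minus_left by simp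
  also have "\<dots> = - pair (mscomp \<gamma>) (lie_br K (dH X) (rs l \<beta>)) + pair (mscomp \<beta>) (lie_br K (dH X) (rs l \<gamma>))"
  proof -
    have "pair (lie_br Ks (mscomp \<gamma>) (mscomp \<beta>)) (dH X) = 0"
      using hperp_ideal[OF mscomp_in] by (intro pair_hperp) (simp add: hperp_iff)
    thus ?thesis unfolding dpair_triple by (simp add: K.lie_br_minus_right)
  qed
  finally show ?thesis using rs_deriv[OF l, of \<gamma> a \<beta>] reductive[OF rangeI rs_in[OF l]]
    by (simp add: pair_mscomp[symmetric])
qed

end

section \<open>Contractions of tensors\<close>

text \<open>Tensor identities are verified on arbitrary covectors, where index sums become pairings
  with \<open>sharp\<close> and \<open>rsharp\<close>.\<close>

definition con2 :: "'k::field^'n^'n \<Rightarrow> 'k^'n \<Rightarrow> 'k^'n \<Rightarrow> 'k" where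
  "con2 T p q = (\<Sum>i\<in>UNIV. \<Sum>j\<in>UNIV. p $ i * q $ j * T $ i $ j)"

definition con3 :: "'k::field^'n^'n^'n \<Rightarrow> 'k^'n \<Rightarrow> 'k^'n \<Rightarrow> 'k^'n \<Rightarrow> 'k" where
  "con3 T p q s = (\<Sum>i\<in>UNIV. \<Sum>j\<in>UNIV. \<Sum>k\<in>UNIV. p $ i * q $ j * s $ k * T $ i $ j $ k)"

definition sharp :: "'k::field^'n^'n \<Rightarrow> 'k^'n \<Rightarrow> 'k^'n" where
  "sharp T p = (\<chi> j. \<Sum>i\<in>UNIV. p $ i * T $ i $ j)"

definition rsharp :: "'k::field^'n^'n \<Rightarrow> 'k^'n \<Rightarrow> 'k^'n" where
  "rsharp T q = (\<chi> i. \<Sum>j\<in>UNIV. q $ j * T $ i $ j)"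

lemma con2_axis: "con2 T (axis i 1) (axis j 1) = T $ i $ j"
proof -
  have "con2 T (axis i 1) (axis j 1) = (\<Sum>a\<in>UNIV. axis i 1 $ a * (\<Sum>b\<in>UNIV. axis j 1 $ b * T $ a $ b))"
    by (simp add: con2_def sum_distrib_left mult.assoc)
  thus ?thesis by (simp only: sum_axis_left)
qed

lemma con3_axis: "con3 T (axis i 1) (axis j 1) (axis k 1) = T $ i $ j $ k"
proof -
  have "con3 T (axis i 1) (axis j 1) (axis k 1) =
    (\<Sum>a\<in>UNIV. axis i 1 $ a * (\<Sum>b\<in>UNIV. axis j 1 $ b * (\<Sum>c\<in>UNIV. axis k 1 $ c * T $ a $ b $ c)))"
    by (simp add: con3_def sum_distrib_left mult.assoc)
  thus ?thesis by (simp only: sum_axis_left)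
qed

lemma con2_eqI: "(\<And>p q. con2 S p q = con2 T p q) \<Longrightarrow> S = T"
  by (simp add: vec_eq_iff) (metis con2_axis)

lemma con3_eqI: "(\<And>p q s. con3 S p q s = con3 T p q s) \<Longrightarrow> S = T"
  by (simp add: vec_eq_iff) (metis con3_axis)

lemma con2_sharp: "con2 T p q = pair q (sharp T p)"
proof -
  have "con2 T p q = (\<Sum>j\<in>UNIV. \<Sum>i\<in>UNIV. p $ i * q $ j * T $ i $ j)" unfolding con2_def by (rule sum.swap)
  thus ?thesis by (simp add: pair_def sharp_def sum_distrib_left mult_ac)
qed

lemma con2_add: "con2 (S + T) p q = con2 S p q + con2 T p q"
  by (simp add: con2_def distrib_left sum.distrib)

lemma con3_add: "con3 (S + T) p q s = con3 S p q s + con3 T p q s"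
  by (simp add: con3_def distrib_left sum.distrib)

lemma sharp_add: "sharp (S + T) p = sharp S p + sharp T p"
  by (simp add: sharp_def vec_eq_iff distrib_left sum.distrib)

lemma rsharp_antisym: "antisym2 T \<Longrightarrow> rsharp T q = - sharp T q"
proof -
  assume T: "antisym2 T"
  have "q $ j * T $ i $ j = - (q $ j * T $ j $ i)" for i j using T unfolding antisym2_def by (metis mult_minus_right)
  thus ?thesis by (simp add: rsharp_def sharp_def vec_eq_iff flip: sum_negf)
qed

lemma antisym2_add: "antisym2 S \<Longrightarrow> antisym2 T \<Longrightarrow> antisym2 (S + T)"
proof -
  assume S: "antisym2 S" and T: "antisym2 T"
  have "(S + T) $ i $ j = - (S + T) $ j $ i" for i j
  proof -
    have s: "S $ i $ j = - S $ j $ i" and t: "T $ i $ j = - T $ j $ i" using S T unfolding antisym2_def by blast+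
    show ?thesis unfolding vector_add_component s t by simp
  qed
  thus ?thesis unfolding antisym2_def by blast
qed

lemma con3_cyc3: "con3 (cyc3 T) p q s = con3 T p q s + con3 T q s p + con3 T s p q"
proof -
  have "con3 T q s p = (\<Sum>i\<in>UNIV. \<Sum>j\<in>UNIV. \<Sum>k\<in>UNIV. p $ i * q $ j * s $ k * T $ j $ k $ i)"
  proof -
    have "con3 T q s p = (\<Sum>j\<in>UNIV. \<Sum>i\<in>UNIV. \<Sum>k\<in>UNIV. q $ j * s $ k * p $ i * T $ j $ k $ i)"
      unfolding con3_def by (intro sum.cong refl sum.swap)
    also have "\<dots> = (\<Sum>i\<in>UNIV. \<Sum>j\<in>UNIV. \<Sum>k\<in>UNIV. q $ j * s $ k * p $ i * T $ j $ k $ i)"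
      by (rule sum.swap)
    finally show ?thesis by (simp add: mult_ac)
  qed
  moreover have "con3 T s p q = (\<Sum>i\<in>UNIV. \<Sum>j\<in>UNIV. \<Sum>k\<in>UNIV. p $ i * q $ j * s $ k * T $ k $ i $ j)"
  proof -
    have "con3 T s p q = (\<Sum>i\<in>UNIV. \<Sum>k\<in>UNIV. \<Sum>j\<in>UNIV. s $ k * p $ i * q $ j * T $ k $ i $ j)"
      unfolding con3_def by (rule sum.swap)
    also have "\<dots> = (\<Sum>i\<in>UNIV. \<Sum>j\<in>UNIV. \<Sum>k\<in>UNIV. s $ k * p $ i * q $ j * T $ k $ i $ j)"
      by (intro sum.cong refl sum.swap)
    finally show ?thesis by (simp add: mult_ac)
  qed
  ultimately show ?thesis
    by (simp add: con3_def cyc3_def distrib_left sum.distrib)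
qed

lemma con3_outer:
  "con3 (\<chi> i j k. \<Sum>a\<in>UNIV. v a $ i * F a $ j $ k) p q s = (\<Sum>a\<in>UNIV. pair p (v a) * con2 (F a) q s)"
proof -
  let ?t = "\<lambda>i j k a. p $ i * q $ j * s $ k * (v a $ i * F a $ j $ k)"
  have "con3 (\<chi> i j k. \<Sum>a\<in>UNIV. v a $ i * F a $ j $ k) p q s =
    (\<Sum>i\<in>UNIV. \<Sum>j\<in>UNIV. \<Sum>a\<in>UNIV. \<Sum>k\<in>UNIV. ?t i j k a)"
    unfolding con3_def vec_lambda_beta sum_distrib_left by (intro sum.cong refl sum.swap)
  also have "\<dots> = (\<Sum>i\<in>UNIV. \<Sum>a\<in>UNIV. \<Sum>j\<in>UNIV. \<Sum>k\<in>UNIV. ?t i j k a)"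
    by (intro sum.cong refl sum.swap)
  also have "\<dots> = (\<Sum>a\<in>UNIV. \<Sum>i\<in>UNIV. \<Sum>j\<in>UNIV. \<Sum>k\<in>UNIV. ?t i j k a)"
    by (rule sum.swap)
  also have "\<dots> = (\<Sum>a\<in>UNIV. pair p (v a) * con2 (F a) q s)"
    unfolding pair_def con2_def sum_distrib_right unfolding sum_distrib_left by (simp only: mult_ac)
  finally show ?thesis .
qed

lemma con2_tmap2:
  "con2 (tmap2 L T) p q = con2 T (\<chi> a. pair p (L (axis a 1))) (\<chi> a. pair q (L (axis a 1)))"
proof -
  let ?t = "\<lambda>i j a b. (p $ i * L (axis a 1) $ i) * (q $ j * L (axis b 1) $ j) * T $ a $ b"
  have "con2 (tmap2 L T) p q = (\<Sum>i\<in>UNIV. \<Sum>j\<in>UNIV. \<Sum>a\<in>UNIV. \<Sum>b\<in>UNIV. ?t i j a b)"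
    by (simp add: con2_def tmap2_def sum_distrib_left mult_ac)
  also have "\<dots> = (\<Sum>i\<in>UNIV. \<Sum>a\<in>UNIV. \<Sum>j\<in>UNIV. \<Sum>b\<in>UNIV. ?t i j a b)"
    by (intro sum.cong refl sum.swap)
  also have "\<dots> = (\<Sum>a\<in>UNIV. \<Sum>i\<in>UNIV. \<Sum>j\<in>UNIV. \<Sum>b\<in>UNIV. ?t i j a b)"
    by (rule sum.swap)
  also have "\<dots> = (\<Sum>a\<in>UNIV. \<Sum>i\<in>UNIV. \<Sum>b\<in>UNIV. \<Sum>j\<in>UNIV. ?t i j a b)"
    by (intro sum.cong refl sum.swap)
  also have "\<dots> = (\<Sum>a\<in>UNIV. \<Sum>b\<in>UNIV. \<Sum>i\<in>UNIV. \<Sum>j\<in>UNIV. ?t i j a b)"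
    by (intro sum.cong refl sum.swap)
  also have "\<dots> = (\<Sum>a\<in>UNIV. \<Sum>b\<in>UNIV. (\<Sum>i\<in>UNIV. p $ i * L (axis a 1) $ i) * (\<Sum>j\<in>UNIV. q $ j * L (axis b 1) $ j) * T $ a $ b)"
    unfolding sum_product unfolding sum_distrib_right ..
  finally show ?thesis by (simp add: con2_def pair_def)
qed

lemma con2_has_field_derivative:
  fixes F :: "'k::real_normed_field \<Rightarrow> 'k^'n^'n"
  assumes "\<And>i j. ((\<lambda>t. F t $ i $ j) has_field_derivative F' $ i $ j) (at t0)"
  shows "((\<lambda>t. con2 (F t) p q) has_field_derivative con2 F' p q) (at t0)"
  unfolding con2_def by (intro DERIV_sum DERIV_cmult assms)

context lie begin

section \<open>Contractions of brackets and of derivatives on a Lie group\<close>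

lemma con3_br12_23: "con3 (br12_23 G S T) p q s = pair q (lie_br G (sharp S p) (rsharp T s))"
proof -
  let ?t = "\<lambda>i j k a b. q $ j * (lie_br G (axis a 1) (axis b 1) $ j * (p $ i * S $ i $ a) * (s $ k * T $ b $ k))"
  have "con3 (br12_23 G S T) p q s = (\<Sum>i\<in>UNIV. \<Sum>j\<in>UNIV. \<Sum>k\<in>UNIV. \<Sum>a\<in>UNIV. \<Sum>b\<in>UNIV.
     ?t i j k a b)"
    by (simp add: con3_def br12_23_def sum_distrib_left mult_ac)
  also have "\<dots> = (\<Sum>j\<in>UNIV. \<Sum>i\<in>UNIV. \<Sum>k\<in>UNIV. \<Sum>a\<in>UNIV. \<Sum>b\<in>UNIV.
     ?t i j k a b)"
    by (rule sum.swap)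
  also have "\<dots> = (\<Sum>j\<in>UNIV. \<Sum>i\<in>UNIV. \<Sum>a\<in>UNIV. \<Sum>k\<in>UNIV. \<Sum>b\<in>UNIV.
     ?t i j k a b)"
    by (intro sum.cong refl sum.swap)
  also have "\<dots> = (\<Sum>j\<in>UNIV. \<Sum>a\<in>UNIV. \<Sum>i\<in>UNIV. \<Sum>k\<in>UNIV. \<Sum>b\<in>UNIV.
     ?t i j k a b)"
    by (intro sum.cong refl sum.swap)
  also have "\<dots> = (\<Sum>j\<in>UNIV. \<Sum>a\<in>UNIV. \<Sum>i\<in>UNIV. \<Sum>b\<in>UNIV. \<Sum>k\<in>UNIV.
     ?t i j k a b)"
    by (intro sum.cong refl sum.swap)
  also have "\<dots> = (\<Sum>j\<in>UNIV. \<Sum>a\<in>UNIV. \<Sum>b\<in>UNIV. \<Sum>i\<in>UNIV. \<Sum>k\<in>UNIV.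
     ?t i j k a b)"
    by (intro sum.cong refl sum.swap)
  also have "\<dots> = (\<Sum>j\<in>UNIV. q $ j * (\<Sum>a\<in>UNIV. \<Sum>b\<in>UNIV.
     lie_br G (axis a 1) (axis b 1) $ j * (sharp S p $ a * rsharp T s $ b)))"
    unfolding sharp_def rsharp_def vec_lambda_beta sum_product unfolding sum_distrib_left by (simp only: mult_ac)
  finally show ?thesis unfolding pair_def lie_br_expand[of "sharp S p" "rsharp T s"] mult.assoc .
qed

lemma con2_ad2: "con2 (ad2 G x T) p q = pair p (lie_br G x (rsharp T q)) + pair q (lie_br G x (sharp T p))"
proof -
  have "con2 (\<chi> i j. \<Sum>a\<in>UNIV. lie_br G x (axis a 1) $ i * T $ a $ j) p q = pair p (lie_br G x (rsharp T q))"
  proof -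
    have "con2 (\<chi> i j. \<Sum>a\<in>UNIV. lie_br G x (axis a 1) $ i * T $ a $ j) p q =
      (\<Sum>i\<in>UNIV. \<Sum>a\<in>UNIV. \<Sum>j\<in>UNIV. p $ i * q $ j * (lie_br G x (axis a 1) $ i * T $ a $ j))"
      unfolding con2_def vec_lambda_beta sum_distrib_left by (intro sum.cong refl sum.swap)
    also have "\<dots> = (\<Sum>i\<in>UNIV. p $ i * (\<Sum>a\<in>UNIV. rsharp T q $ a * lie_br G x (axis a 1) $ i))"
      by (simp add: rsharp_def sum_distrib_left sum_distrib_right mult_ac)
    finally show ?thesis unfolding pair_def klinear_nth[OF lie_br_linear_right, of x "rsharp T q"] .
  qed
  moreover have "con2 (\<chi> i j. \<Sum>a\<in>UNIV. lie_br G x (axis a 1) $ j * T $ i $ a) p q = pair q (lie_br G x (sharp T p))"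
  proof -
    have "con2 (\<chi> i j. \<Sum>a\<in>UNIV. lie_br G x (axis a 1) $ j * T $ i $ a) p q =
      (\<Sum>j\<in>UNIV. \<Sum>i\<in>UNIV. \<Sum>a\<in>UNIV. p $ i * q $ j * (lie_br G x (axis a 1) $ j * T $ i $ a))"
      unfolding con2_def vec_lambda_beta sum_distrib_left by (rule sum.swap)
    also have "\<dots> = (\<Sum>j\<in>UNIV. \<Sum>a\<in>UNIV. \<Sum>i\<in>UNIV. p $ i * q $ j * (lie_br G x (axis a 1) $ j * T $ i $ a))"
      by (intro sum.cong refl sum.swap)
    also have "\<dots> = (\<Sum>j\<in>UNIV. q $ j * (\<Sum>a\<in>UNIV. sharp T p $ a * lie_br G x (axis a 1) $ j))"
      by (simp add: sharp_def sum_distrib_left sum_distrib_right mult_ac)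
    finally show ?thesis unfolding pair_def klinear_nth[OF lie_br_linear_right, of x "sharp T p"] .
  qed
  moreover have "ad2 G x T = (\<chi> i j. \<Sum>a\<in>UNIV. lie_br G x (axis a 1) $ i * T $ a $ j) + (\<chi> i j. \<Sum>a\<in>UNIV. lie_br G x (axis a 1) $ j * T $ i $ a)"
    by (simp add: ad2_def vec_eq_iff)
  ultimately show ?thesis by (simp add: con2_add)
qed

lemma con2_ad2_antisym:
  "antisym2 T \<Longrightarrow> con2 (ad2 G x T) p q = - pair p (lie_br G x (sharp T q)) + pair q (lie_br G x (sharp T p))"
  by (simp add: con2_ad2 rsharp_antisym lie_br_minus_right)

text \<open>The derivative at the unit of the coboundary bivector; for T = R it determines the
  bracket of the dual.\<close>

lemma tmap2_Ad_deriv: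
  "((\<lambda>t. tmap2 (Ad G (lexp G (t *s X))) T $ i $ j) has_field_derivative ad2 G X T $ i $ j) (at 0)"
proof -
  have "((\<lambda>t. \<Sum>a\<in>UNIV. \<Sum>b\<in>UNIV. Ad G (lexp G (t *s X)) (axis a 1) $ i * Ad G (lexp G (t *s X)) (axis b 1) $ j * T $ a $ b)
     has_field_derivative (\<Sum>a\<in>UNIV. \<Sum>b\<in>UNIV. (lie_br G X (axis a 1) $ i * Ad G (lexp G (0 *s X)) (axis b 1) $ j
       + lie_br G X (axis b 1) $ j * Ad G (lexp G (0 *s X)) (axis a 1) $ i) * T $ a $ b)) (at 0)"
    by (intro DERIV_sum DERIV_cmult_right DERIV_mult Ad_exp_deriv0)
  moreover have "(\<Sum>a\<in>UNIV. \<Sum>b\<in>UNIV. (lie_br G X (axis a 1) $ i * Ad G (lexp G (0 *s X)) (axis b 1) $ j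
       + lie_br G X (axis b 1) $ j * Ad G (lexp G (0 *s X)) (axis a 1) $ i) * T $ a $ b) = ad2 G X T $ i $ j"
  proof -
    have ax: "axis b (1::'k) $ j = axis j 1 $ b" for b j :: 'n by (simp add: axis_def)
    have "(\<Sum>a\<in>UNIV. \<Sum>b\<in>UNIV. lie_br G X (axis a 1) $ i * axis b 1 $ j * T $ a $ b) = (\<Sum>a\<in>UNIV. lie_br G X (axis a 1) $ i * T $ a $ j)"
    proof (intro sum.cong refl)
      fix a show "(\<Sum>b\<in>UNIV. lie_br G X (axis a 1) $ i * axis b 1 $ j * T $ a $ b) = lie_br G X (axis a 1) $ i * T $ a $ j"
        using sum_axis_left[of j "\<lambda>b. lie_br G X (axis a 1) $ i * T $ a $ b"] by (simp add: ax mult_ac)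
    qed
    moreover have "(\<Sum>a\<in>UNIV. \<Sum>b\<in>UNIV. lie_br G X (axis b 1) $ j * axis a 1 $ i * T $ a $ b) = (\<Sum>b\<in>UNIV. lie_br G X (axis b 1) $ j * T $ i $ b)"
    proof (subst sum.swap, intro sum.cong refl)
      fix b show "(\<Sum>a\<in>UNIV. lie_br G X (axis b 1) $ j * axis a 1 $ i * T $ a $ b) = lie_br G X (axis b 1) $ j * T $ i $ b"
        using sum_axis_left[of i "\<lambda>a. lie_br G X (axis b 1) $ j * T $ a $ b"] by (simp add: ax mult_ac)
    qed
    ultimately show ?thesis by (simp add: ad2_def Ad_one distrib_right sum.distrib)
  qed
  ultimately show ?thesis by (simp add: tmap2_def)
qed

lemma regular_gradient:
  assumes "regular_at (atlas G) f x"
  shows "\<exists>g. \<forall>i j. kgrad (\<lambda>X. f (lexp G X \<otimes> x) $ i $ j) 0 (g i j)"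
proof -
  have "\<exists>g. kgrad (\<lambda>X. f (lexp G X \<otimes> x) $ i $ j) 0 g" for i j
  proof -
    obtain W where W: "aopen (atlas G) W" "x \<in> W" "smooth_fun (atlas G) W (\<lambda>y. f y $ i $ j)"
      using assms unfolding regular_at_def smooth_at_def openin_mfd_top[OF inj_charts] by blast
    from left_translation_derivative[OF W(1,3)] W(2) show ?thesis by blast
  qed
  thus ?thesis by metis
qed

lemma L_deriv_gradient:
  assumes "\<And>i j. kgrad (\<lambda>X. f (lexp G X \<otimes> x) $ i $ j) 0 (g i j)"
  shows "((\<lambda>t. f (lexp G (t *s \<alpha>) \<otimes> x) $ i $ j) has_field_derivative L_deriv G \<alpha> f x $ i $ j) (at 0)"
    "L_deriv G \<alpha> f x $ i $ j = pair (g i j) \<alpha>"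
proof -
  note d = kgrad_line[OF assms, of \<alpha> i j]
  show e: "L_deriv G \<alpha> f x $ i $ j = pair (g i j) \<alpha>"
    using DERIV_imp_deriv[OF d] by (simp add: L_deriv_def pair_def)
  show "((\<lambda>t. f (lexp G (t *s \<alpha>) \<otimes> x) $ i $ j) has_field_derivative L_deriv G \<alpha> f x $ i $ j) (at 0)"
    using d by (simp add: e pair_def)
qed

text \<open>Linearity in the direction comes from the gradient that regularity provides; derivatives
  along separate lines would not yield it. The last part collapses the sum over dual bases in the
  Yang-Baxter equation.\<close>

lemma con2_L_deriv:
  assumes "regular_at (atlas G) f x"
  shows "((\<lambda>t. con2 (f (lexp G (t *s \<alpha>) \<otimes> x)) p q) has_field_derivative con2 (L_deriv G \<alpha> f x) p q) (at 0)"
    "con2 (L_deriv G (\<alpha> + \<beta>) f x) p q = con2 (L_deriv G \<alpha> f x) p q + con2 (L_deriv G \<beta> f x) p q"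
    "con2 (L_deriv G (- \<alpha>) f x) p q = - con2 (L_deriv G \<alpha> f x) p q"
    "(\<Sum>a\<in>UNIV. \<alpha> $ a * con2 (L_deriv G (axis a 1) f x) p q) = con2 (L_deriv G \<alpha> f x) p q"
proof -
  obtain g where g: "\<And>i j. kgrad (\<lambda>X. f (lexp G X \<otimes> x) $ i $ j) 0 (g i j)"
    using regular_gradient[OF assms] by blast
  note L = L_deriv_gradient[OF g]
  show "((\<lambda>t. con2 (f (lexp G (t *s \<alpha>) \<otimes> x)) p q) has_field_derivative con2 (L_deriv G \<alpha> f x) p q) (at 0)"
    by (rule con2_has_field_derivative[OF L(1)])
  show "con2 (L_deriv G (\<alpha> + \<beta>) f x) p q = con2 (L_deriv G \<alpha> f x) p q + con2 (L_deriv G \<beta> f x) p q"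
    by (simp add: con2_def L(2) distrib_left sum.distrib)
  show "con2 (L_deriv G (- \<alpha>) f x) p q = - con2 (L_deriv G \<alpha> f x) p q"
    by (simp add: con2_def L(2) sum_negf)
  have "(\<Sum>a\<in>UNIV. \<alpha> $ a * con2 (L_deriv G (axis a 1) f x) p q) =
    (\<Sum>a\<in>UNIV. \<Sum>i\<in>UNIV. \<Sum>j\<in>UNIV. p $ i * q $ j * (g i j $ a * \<alpha> $ a))"
    by (simp add: con2_def L(2) sum_distrib_left mult_ac)
  also have "\<dots> = (\<Sum>i\<in>UNIV. \<Sum>a\<in>UNIV. \<Sum>j\<in>UNIV. p $ i * q $ j * (g i j $ a * \<alpha> $ a))" by (rule sum.swap)
  also have "\<dots> = (\<Sum>i\<in>UNIV. \<Sum>j\<in>UNIV. \<Sum>a\<in>UNIV. p $ i * q $ j * (g i j $ a * \<alpha> $ a))" by (intro sum.cong refl sum.swap)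
  finally show "(\<Sum>a\<in>UNIV. \<alpha> $ a * con2 (L_deriv G (axis a 1) f x) p q) = con2 (L_deriv G \<alpha> f x) p q"
    by (simp add: con2_def L(2) pair_def sum_distrib_left)
qed

text \<open>x exp(t \<alpha>) = exp(t Ad x \<alpha>) x, which brings the curves of
  \<open>dress_deriv\<close> into the form used by \<open>L_deriv\<close>.\<close>

lemma right_translation_L_deriv:
  assumes "x \<in> carrier G"
  shows "(\<chi> i j. deriv (\<lambda>t. f (x \<otimes> lexp G (t *s \<alpha>)) $ i $ j) 0) = L_deriv G (Ad G x \<alpha>) f x"
  by (simp add: L_deriv_def mult_exp assms klinear_smult[OF Ad_linear])

end

section \<open>The reduced r-matrix\<close>

lemma con2_sum: "con2 (\<Sum>i\<in>A. F i) p q = (\<Sum>i\<in>A. con2 (F i) p q)"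
  by (induction A rule: infinite_finite_induct) (simp_all add: con2_add, simp_all add: con2_def)

lemma con2_tscale_tensor: "con2 (tscale c (tensor X Y)) p q = c * pair p X * pair q Y"
proof -
  have "pair p X * pair q Y = (\<Sum>i\<in>UNIV. \<Sum>j\<in>UNIV. p $ i * X $ i * (q $ j * Y $ j))"
    by (simp only: pair_def sum_product)
  thus ?thesis by (simp add: con2_def tscale_def tensor_def sum_distrib_left mult_ac)
qed

text \<open>The denominator q is kept, so the density of its nonvanishing set carries over.\<close>

lemma meromorphic_fun_add_smooth:
  assumes "meromorphic_fun A S f" "smooth_fun A S g" "\<And>x. x \<in> S \<Longrightarrow> h x = f x + g x"
  shows "meromorphic_fun A S h"
  unfolding meromorphic_fun_def
proof
  fix x assume "x \<in> S"
  then obtain W p q where W: "openin (mfd_top A) W" "x \<in> W" "W \<subseteq> S" "smooth_fun A W p" "smooth_fun A W q"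
    "W \<subseteq> mfd_top A closure_of {y \<in> W. q y \<noteq> 0}" "\<And>y. y \<in> W \<Longrightarrow> q y \<noteq> 0 \<Longrightarrow> f y = p y / q y"
    using assms(1) unfolding meromorphic_fun_def by meson
  have "smooth_fun A W (\<lambda>y. p y + g y * q y)"
    by (intro smooth_fun_add smooth_fun_mult W smooth_fun_subset[OF assms(2) W(3)])
  moreover have "h y = (p y + g y * q y) / q y" if "y \<in> W" "q y \<noteq> 0" for y
    using assms(3)[of y] W(3,7) that by (auto simp: field_simps)
  ultimately show "\<exists>W p q. openin (mfd_top A) W \<and> x \<in> W \<and> W \<subseteq> S \<and> smooth_fun A W p \<and> smooth_fun A W q \<and>
     W \<subseteq> mfd_top A closure_of {y \<in> W. q y \<noteq> 0} \<and> (\<forall>y\<in>W. q y \<noteq> 0 \<longrightarrow> h y = p y / q y)"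
    using W(1,2,3,5,6) by blast
qed

locale reduction = dynamical_data K H Ks Hs D DH dH dHs \<iota>K \<iota>Ks \<iota>H \<iota>Hs \<mm> J M Cinv V
  for K :: "('g, 'k::{real_normed_field,euclidean_space}, 'm::finite) lie_group_data"
    and H :: "('g, 'k, 'h::finite) lie_group_data"
    and Ks :: "('s, 'k, 'm) lie_group_data"
    and Hs :: "('s, 'k, 'h) lie_group_data"
    and D :: "('d, 'k, 'm + 'm) lie_group_data"
    and DH :: "('e, 'k, 'h + 'h) lie_group_data"
    and dH dHs \<iota>K \<iota>Ks \<iota>H \<iota>Hs \<mm>
    and J :: "'i set" and M Cinv V +
  fixes G :: "('g, 'k, 'n::finite) lie_group_data"
    and R :: "'k^'n^'n" and I :: "'k^'n^'n^'n" and dK :: "'k^'m \<Rightarrow> 'k^'n" and \<pi>K :: "'g \<Rightarrow> 'k^'m^'m"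
    and U :: "'s set" and r :: "'s \<Rightarrow> 'k^'n^'n" and mode :: admissibility
  assumes G: "coboundary_PL_group G R I"
    and KG: "PL_subgroup dK K \<pi>K G (coboundary_bivector G R)"
    and KKs: "dual_PL_group K \<pi>K Ks"
    and r: "triangular_PL_dynamical_r_matrix mode G R I dK Ks D \<iota>Ks U r"
    and VU: "V \<subseteq> U"
    and restr: "restrictable mode (atlas Ks) (atlas Hs) V r"
begin

lemma lie_G: "lie G"
  using G by (simp add: coboundary_PL_group_def lie_def)

lemma K_sub_G: "lie_subgroup (\<lambda>x. x) dK K G"
  using KG by (simp add: PL_subgroup_def)

end

sublocale reduction \<subseteq> G: lie G by (rule lie_G)

context reduction begin

lemma dK_linear: "klinear dK" and dK_inj: "inj dK"
  using K_sub_G by (simp_all add: lie_subgroup_def)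

lemma dK_br: "dK (lie_br K X Y) = lie_br G (dK X) (dK Y)"
  using lie_subgroup_br[OF K_sub_G] .

section \<open>Restriction of covectors to k and the cobracket\<close>

definition dKT :: "'k^'n \<Rightarrow> 'k^'m" where "dKT p = (\<chi> a. pair p (dK (axis a 1)))"

lemma pair_dK: "pair p (dK X) = pair (dKT p) X"
  unfolding dKT_def by (rule pair_klinear[OF dK_linear])

lemma con2_dK: "con2 (tmap2 dK S) p q = con2 S (dKT p) (dKT q)"
  unfolding dKT_def by (rule con2_tmap2)

text \<open>Restriction of covectors from g to k is onto because \<open>dK\<close> is injective.
  Extensions of the dual basis read off the entries of \<open>\<pi>K\<close> from the bivector of G,
  which is known to be differentiable.\<close>

lemma dKT_left_inverse: "\<exists>b. \<forall>a. dKT (b a) = axis a 1"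
proof -
  have "inj ((*v) (matrix dK))" using dK_inj by (simp add: matrix_works[OF dK_linear] inj_def)
  then obtain B where B: "B ** matrix dK = mat 1" using matrix_left_invertible_injective[of "matrix dK"] by (metis inj_def)
  have "dKT (B $ a) = axis a 1" for a
  proof -
    have "dKT (B $ a) $ c = axis a 1 $ c" for c
    proof -
      have "dKT (B $ a) $ c = (B ** matrix dK) $ a $ c"
        by (simp add: dKT_def pair_def matrix_matrix_mult_def matrix_def)
      also have "\<dots> = axis a 1 $ c" unfolding B by (simp add: mat_def axis_def)
      finally show ?thesis .
    qed
    thus ?thesis by (simp add: vec_eq_iff)
  qed
  thus ?thesis by blast
qed

text \<open>On K the coboundary bivector of R is the image of \<open>\<pi>K\<close>, and the dual
  bracket is minus the derivative of \<open>\<pi>K\<close> at the unit. Thus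
  [X \<otimes> 1 + 1 \<otimes> X, R] for X in k depends on the restrictions of covectors to k
  alone.\<close>

lemma cobracket: "con2 (ad2 G (dK X) R) p q = - pair (lie_br Ks (dKT p) (dKT q)) X"
proof -
  obtain b where b: "\<And>a. dKT (b a) = axis a 1" using dKT_left_inverse by blast
  define F where "F t = tmap2 (Ad G (lexp G (t *s dK X))) R - R" for t
  have F: "F t = tmap2 dK (\<pi>K (lexp K (t *s X)))" for t
  proof -
    have "lexp K (t *s X) = lexp G (t *s dK X)"
      using K_sub_G klinear_smult[OF dK_linear] by (simp add: lie_subgroup_def)
    moreover have "coboundary_bivector G R (lexp K (t *s X)) = tmap2 dK (\<pi>K (lexp K (t *s X)))"
      using KG K.exp_closed unfolding PL_subgroup_def by blast
    ultimately show ?thesis by (simp add: F_def coboundary_bivector_def)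
  qed
  have dF: "((\<lambda>t. con2 (F t) p q) has_field_derivative con2 (ad2 G (dK X) R) p q) (at 0)" for p q
  proof (rule con2_has_field_derivative)
    fix i j
    show "((\<lambda>t. F t $ i $ j) has_field_derivative ad2 G (dK X) R $ i $ j) (at 0)"
      using DERIV_diff[OF G.tmap2_Ad_deriv[of "dK X" R i j] DERIV_const[of "R $ i $ j"]] by (simp add: F_def)
  qed
  have comp: "con2 (F t) (b a) (b c) = \<pi>K (lexp K (t *s X)) $ a $ c" for a c t
    by (simp add: F con2_dK b con2_axis)
  have br: "pair (lie_br Ks (axis a 1) (axis c 1)) X = - con2 (ad2 G (dK X) R) (b a) (b c)" for a c
  proof -
    have "pair (lie_br Ks (axis a 1) (axis c 1)) X = - deriv (\<lambda>t. \<pi>K (lexp K (t *s X)) $ a $ c) 0"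
      using KKs unfolding dual_PL_group_def by blast
    thus ?thesis using DERIV_imp_deriv[OF dF[of "b a" "b c"]] by (simp add: comp)
  qed
  have "con2 (F t) p q = (\<Sum>a\<in>UNIV. \<Sum>c\<in>UNIV. dKT p $ a * dKT q $ c * con2 (F t) (b a) (b c))" for t
    by (simp add: F con2_dK b con2_axis) (simp add: con2_def)
  hence e: "(\<lambda>t. con2 (F t) p q) = (\<lambda>t. \<Sum>a\<in>UNIV. \<Sum>c\<in>UNIV. dKT p $ a * dKT q $ c * con2 (F t) (b a) (b c))" by blast
  have "((\<lambda>t. con2 (F t) p q) has_field_derivative
     (\<Sum>a\<in>UNIV. \<Sum>c\<in>UNIV. dKT p $ a * dKT q $ c * con2 (ad2 G (dK X) R) (b a) (b c))) (at 0)"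
    unfolding e by (intro DERIV_sum DERIV_cmult dF)
  from DERIV_unique[OF dF this]
  have "con2 (ad2 G (dK X) R) p q = (\<Sum>a\<in>UNIV. \<Sum>c\<in>UNIV. dKT p $ a * dKT q $ c * con2 (ad2 G (dK X) R) (b a) (b c))" .
  also have "\<dots> = - (\<Sum>a\<in>UNIV. \<Sum>c\<in>UNIV. dKT p $ a * dKT q $ c * pair (lie_br Ks (axis a 1) (axis c 1)) X)"
    by (simp add: br sum_negf)
  also have "(\<Sum>a\<in>UNIV. \<Sum>c\<in>UNIV. dKT p $ a * dKT q $ c * pair (lie_br Ks (axis a 1) (axis c 1)) X) = pair (lie_br Ks (dKT p) (dKT q)) X"
  proof -
    have "lie_br Ks (dKT p) (dKT q) = (\<Sum>a\<in>UNIV. \<Sum>c\<in>UNIV. (dKT p $ a * dKT q $ c) *s lie_br Ks (axis a 1) (axis c 1))"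
      unfolding vec_eq_iff by (intro allI) (simp add: Ks.lie_br_expand[of "dKT p" "dKT q"] mult_ac)
    thus ?thesis by (simp only: pair_sum_left pair_arith)
  qed
  finally show ?thesis .
qed

section \<open>The reduced tensor and its equivariance\<close>

definition rstar :: "'s \<Rightarrow> 'k^'n^'n" where
  "rstar l = r l + (\<Sum>i\<in>J. \<Sum>j\<in>J. tscale (Cinv l i j)
     (tensor (dK (m_part D \<iota>Ks (range dH) \<mm> l (M i))) (dK (m_part D \<iota>Ks (range dH) \<mm> l (M j)))))"

lemma con2_T: "con2 (T l) \<beta> \<gamma> = pair \<gamma> (rs l \<beta>)"
  by (simp add: con2_sharp sharp_def rs_def)

lemma con2_rho: "con2 (tmap2 dK (T l)) p q = pair (dKT q) (rs l (dKT p))"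
  by (simp add: con2_dK con2_T)

lemma rstar_eq: "l \<in> carrier Hs \<Longrightarrow> rstar l = r l + tmap2 dK (T l)"
proof (rule con2_eqI)
  fix p q assume l: "l \<in> carrier Hs"
  have "con2 (rstar l) p q = con2 (r l) p q + (\<Sum>i\<in>J. \<Sum>j\<in>J. Cinv l i j * pair (dKT p) (N l i) * pair (dKT q) (N l j))"
    unfolding rstar_def con2_add con2_sum con2_tscale_tensor pair_dK
    by (intro arg_cong2[of _ _ _ _ "(+)"] sum.cong refl) (simp add: m_part_eq[OF l M_in] N_def)
  moreover have "pair (dKT q) (rs l (dKT p)) = (\<Sum>i\<in>J. \<Sum>j\<in>J. Cinv l i j * pair (dKT p) (N l i) * pair (dKT q) (N l j))"
    by (subst sum.swap) (simp add: rs_eq pair_sum_right sum_distrib_right)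
  ultimately show "con2 (rstar l) p q = con2 (r l + tmap2 dK (T l)) p q" by (simp add: con2_add con2_rho)
qed

lemma sharp_rho: "sharp (tmap2 dK (T l)) p = dK (rs l (dKT p))"
proof (rule pair_eqI)
  fix q
  have "pair q (sharp (tmap2 dK (T l)) p) = pair q (dK (rs l (dKT p)))"
    unfolding con2_sharp[symmetric] con2_rho pair_dK ..
  thus "pair (sharp (tmap2 dK (T l)) p) q = pair (dK (rs l (dKT p))) q" by (simp only: pair_commute)
qed

lemma rho_antisym:
  assumes "l \<in> V"
  shows "antisym2 (tmap2 dK (T l))"
  unfolding antisym2_def
proof (intro allI)
  fix i j
  show "tmap2 dK (T l) $ i $ j = - tmap2 dK (T l) $ j $ i"
    using rs_antisym[OF assms, of "dKT (axis j 1)" "dKT (axis i 1)"]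
    unfolding con2_axis[of "tmap2 dK (T l)", symmetric] con2_rho .
qed

lemma r_antisym: "l \<in> V \<Longrightarrow> antisym2 (r l)"
  using r VU unfolding triangular_PL_dynamical_r_matrix_def by blast

lemma R_antisym: "antisym2 R"
  using G by (simp add: coboundary_PL_group_def)

lemma r_dress: "l \<in> V \<Longrightarrow> regular_at (atlas Ks) r l \<Longrightarrow> dress_deriv Ks D \<iota>Ks X r l = ad2 G (dK X) (r l)"
  using r VU unfolding triangular_PL_dynamical_r_matrix_def by blast

lemma r_cdybe:
  "l \<in> V \<Longrightarrow> regular_at (atlas Ks) r l \<Longrightarrow> cyc3 (br12_23 G (R + r l) (R + r l) +
     (\<chi> i j k. \<Sum>a\<in>UNIV. dK (axis a 1) $ i * L_deriv Ks (axis a 1) r l $ j $ k)) = I"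
  using r VU unfolding triangular_PL_dynamical_r_matrix_def by blast

lemma dress_deriv_Ks:
  assumes "l \<in> carrier Ks"
  shows "dress_deriv Ks D \<iota>Ks X f l = L_deriv Ks (Ad Ks l (vsnd (Ad D (inv\<^bsub>D\<^esub> (\<iota>Ks l)) (vjoin X 0)))) f l"
  unfolding dress_deriv_def Let_def by (rule Ks.right_translation_L_deriv[OF assms])

lemma dress_deriv_Hs:
  assumes "l \<in> carrier Hs"
  shows "dress_deriv Hs DH \<iota>Hs X f l = L_deriv Hs (Ad Hs l (vsnd (Ad DH (inv\<^bsub>DH\<^esub> (\<iota>Hs l)) (vjoin X 0)))) f l"
  unfolding dress_deriv_def Let_def by (rule Hs.right_translation_L_deriv[OF assms])

text \<open>Splitting the derivative requires r to be differentiable by itself. Where only the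
  restricted sum is regular, r may still have a pole on K*; hence the two regularity assumptions
  here and below.\<close>

lemma L_deriv_rstar:
  assumes l: "l \<in> V" and reg: "regular_at (atlas Ks) r l" "regular_at (atlas Hs) rstar l"
    and d: "((\<lambda>t. pair (dKT q) (rs (lexp Hs (t *s a) \<otimes>\<^bsub>Hs\<^esub> l) (dKT p))) has_field_derivative d) (at 0)"
  shows "con2 (L_deriv Hs a rstar l) p q = con2 (L_deriv Ks (dHs a) r l) p q + d"
proof -
  have "con2 (rstar (lexp Hs (t *s a) \<otimes>\<^bsub>Hs\<^esub> l)) p q =
    con2 (r (lexp Ks (t *s dHs a) \<otimes>\<^bsub>Ks\<^esub> l)) p q + pair (dKT q) (rs (lexp Hs (t *s a) \<otimes>\<^bsub>Hs\<^esub> l) (dKT p))" for t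
    using V_carrier[OF l]
    by (simp only: rstar_eq Hs.m_closed Hs.exp_closed con2_add con2_rho)
      (simp only: exp_mult_Hs klinear_smult[OF dHs_linear])
  hence e: "(\<lambda>t. con2 (rstar (lexp Hs (t *s a) \<otimes>\<^bsub>Hs\<^esub> l)) p q) = (\<lambda>t.
    con2 (r (lexp Ks (t *s dHs a) \<otimes>\<^bsub>Ks\<^esub> l)) p q + pair (dKT q) (rs (lexp Hs (t *s a) \<otimes>\<^bsub>Hs\<^esub> l) (dKT p)))" by blast
  have "((\<lambda>t. con2 (rstar (lexp Hs (t *s a) \<otimes>\<^bsub>Hs\<^esub> l)) p q) has_field_derivative con2 (L_deriv Ks (dHs a) r l) p q + d) (at 0)"
    unfolding e by (rule DERIV_add[OF Ks.con2_L_deriv(1)[OF reg(1)] d])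
  from DERIV_unique[OF Hs.con2_L_deriv(1)[OF reg(2)] this] show ?thesis .
qed

text \<open>For X in h the dressing fields of H* and of K* agree along H*, because
  \<open>\<Psi>\<close> intertwines the adjoint actions. So r contributes its own equivariance and
  \<rho> that of \<open>rs_dress_deriv\<close>.\<close>

lemma rstar_dress:
  assumes l: "l \<in> V" and reg: "regular_at (atlas Ks) r l" "regular_at (atlas Hs) rstar l"
  shows "dress_deriv Hs DH \<iota>Hs X rstar l = ad2 G ((dK \<circ> dH) X) (rstar l)"
proof (rule con2_eqI)
  fix p q
  note lc = V_carrier[OF l]
  define v where "v = vsnd (Ad DH (inv\<^bsub>DH\<^esub> (\<iota>Hs l)) (vjoin X 0))"
  define a where "a = Ad Hs l v"
  \<comment> \<open>\<open>Z\<close> is l^-1 X l in the double of k. It lies in h + h*, and applying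
    Ad l to its h*-part writes the dressing direction as X minus an element of Ad l k.\<close>
  define Z where "Z = Ad D (inv\<^bsub>D\<^esub> (\<iota>Ks l)) (vjoin (dH X) 0)"
  have "\<Psi> (vjoin X 0) = vjoin (dH X) 0" by (simp add: \<Psi>_def klinear_zero[OF dHs_linear])
  with AdL_inv_\<Psi>[OF lc, of "vjoin X 0"] have vZ: "vsnd Z = dHs v"
    by (simp add: Z_def v_def \<Psi>_def)
  have a: "dHs a = Ad Ks l (dHs v)" unfolding a_def using lie_subgroup_Ad[OF Hs(1) lc] by simp
  have "vjoin 0 (dHs a) = AdL l (vjoin 0 (dHs v))" by (simp add: a AdL_s Hs_Ks(1) lc)
  also have "vjoin 0 (dHs v) = Z - vjoin (vfst Z) 0" by (rule vjoin_eqI) (simp_all add: vZ)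
  also have "AdL l (Z - vjoin (vfst Z) 0) = vjoin (dH X) 0 - AdL l (vjoin (vfst Z) 0)"
    unfolding klinear_diff[OF AdL_linear[OF lc]] by (simp add: Z_def AdL_inv(2) lc)
  finally have az: "vjoin 0 (dHs a) = vjoin (dH X) 0 - AdL l (vjoin (vfst Z) 0)" .
  have "con2 (dress_deriv Hs DH \<iota>Hs X rstar l) p q = con2 (L_deriv Ks (dHs a) r l) p q +
     (pair (dKT q) (lie_br K (dH X) (rs l (dKT p))) - pair (dKT p) (lie_br K (dH X) (rs l (dKT q))))"
    unfolding dress_deriv_Hs[OF lc] v_def[symmetric] a_def[symmetric]
    by (rule L_deriv_rstar[OF l reg rs_dress_deriv[OF l az]])
  also have "L_deriv Ks (dHs a) r l = ad2 G (dK (dH X)) (r l)"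
    using r_dress[OF l reg(1), of "dH X"] unfolding dress_deriv_Ks[OF Hs_Ks(1)[OF lc]] Z_def[symmetric] vZ a .
  also have "pair (dKT q) (lie_br K (dH X) (rs l (dKT p))) - pair (dKT p) (lie_br K (dH X) (rs l (dKT q))) =
     con2 (ad2 G (dK (dH X)) (tmap2 dK (T l))) p q"
    by (simp add: G.con2_ad2_antisym[OF rho_antisym[OF l]] sharp_rho pair_dK flip: dK_br)
  also have "con2 (ad2 G (dK (dH X)) (r l)) p q + con2 (ad2 G (dK (dH X)) (tmap2 dK (T l))) p q = con2 (ad2 G ((dK \<circ> dH) X) (rstar l)) p q"
    by (simp add: rstar_eq lc G.con2_ad2_antisym antisym2_add rho_antisym r_antisym l sharp_add G.lie_br_add_right)
  finally show "con2 (dress_deriv Hs DH \<iota>Hs X rstar l) p q = con2 (ad2 G ((dK \<circ> dH) X) (rstar l)) p q" .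
qed

section \<open>The Yang-Baxter equation at points where r is regular\<close>

text \<open>With X = - rs l \<beta> and \<xi> the m*-part of \<beta>, the graph relation Ad l Y = X
  + \<xi> gives l^-1 X l = Y - l^-1 \<xi> l. The dressing field of X at l is therefore the
  right-invariant field of -\<xi>, and equivariance of r computes the derivatives transverse to
  H*.\<close>

lemma L_deriv_mstar:
  assumes l: "l \<in> V" and reg: "regular_at (atlas Ks) r l"
  shows "con2 (L_deriv Ks (mscomp \<beta>) r l) p q = con2 (ad2 G (dK (rs l \<beta>)) (r l)) p q"
proof -
  note lc = V_carrier[OF l] and lk = Hs_Ks(1)[OF V_carrier[OF l]]
  define \<mu> where "\<mu> = Ad Ks (inv\<^bsub>Ks\<^esub> l) (mscomp \<beta>)"
  obtain Y where Y: "AdL l (vjoin Y 0) = vjoin (- rs l \<beta>) (mscomp \<beta>)" using rs_graph[OF l] by metis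
  have "AdL l (vjoin Y (- \<mu>)) = AdL l (vjoin Y 0 - vjoin 0 \<mu>)"
    by (rule arg_cong[where f="AdL l"], rule vjoin_eqI) simp_all
  also have "\<dots> = vjoin (- rs l \<beta>) (mscomp \<beta>) - vjoin 0 (mscomp \<beta>)"
    unfolding klinear_diff[OF AdL_linear[OF lc]] by (simp add: Y AdL_s[OF lk] \<mu>_def Ks.Ad_inv'[OF lk])
  also have "\<dots> = vjoin (- rs l \<beta>) 0" by (rule vjoin_eqI) simp_all
  finally have "Ad D (inv\<^bsub>D\<^esub> (\<iota>Ks l)) (vjoin (- rs l \<beta>) 0) = vjoin Y (- \<mu>)"
    using AdL_inv(1)[OF lc, of "vjoin Y (- \<mu>)"] by simp
  moreover have "Ad Ks l (- \<mu>) = - mscomp \<beta>"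
    by (simp add: klinear_minus[OF Ks.Ad_linear[OF lk]] \<mu>_def Ks.Ad_inv'[OF lk])
  ultimately have "L_deriv Ks (- mscomp \<beta>) r l = ad2 G (dK (- rs l \<beta>)) (r l)"
    using r_dress[OF l reg, of "- rs l \<beta>"] unfolding dress_deriv_Ks[OF lk] by simp
  hence "con2 (L_deriv Ks (- mscomp \<beta>) r l) p q = con2 (ad2 G (- dK (rs l \<beta>)) (r l)) p q"
    by (simp add: klinear_minus[OF dK_linear])
  hence "- con2 (L_deriv Ks (mscomp \<beta>) r l) p q = - con2 (ad2 G (dK (rs l \<beta>)) (r l)) p q"
    unfolding Ks.con2_L_deriv(3)[OF reg] by (simp add: G.con2_ad2 G.lie_br_minus_left)
  thus ?thesis by (simp only: neg_equal_iff_equal)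
qed

lemma con3_cdybe_K:
  assumes l: "l \<in> V" and reg: "regular_at (atlas Ks) r l"
  shows "con3 (br12_23 G (R + r l) (R + r l) + (\<chi> i j k. \<Sum>a\<in>UNIV. dK (axis a 1) $ i * L_deriv Ks (axis a 1) r l $ j $ k)) p q s =
    - pair q (lie_br G (sharp (R + r l) p) (sharp (R + r l) s)) + con2 (L_deriv Ks (dKT p) r l) q s"
proof -
  have "(\<Sum>a\<in>UNIV. pair p (dK (axis a 1)) * con2 (L_deriv Ks (axis a 1) r l) q s) = con2 (L_deriv Ks (dKT p) r l) q s"
    using Ks.con2_L_deriv(4)[OF reg, of "dKT p"] by (simp add: dKT_def)
  thus ?thesis
    by (simp add: con3_add con3_outer G.con3_br12_23 rsharp_antisym antisym2_add R_antisym r_antisym[OF l] G.lie_br_minus_right)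
qed

lemma rstar_antisym: "l \<in> V \<Longrightarrow> antisym2 (rstar l)"
  by (simp add: rstar_eq V_carrier antisym2_add r_antisym rho_antisym)

lemma con3_cdybe_H:
  assumes l: "l \<in> V" and reg: "regular_at (atlas Hs) rstar l"
  shows "con3 (br12_23 G (R + rstar l) (R + rstar l) +
      (\<chi> i j k. \<Sum>a\<in>UNIV. (dK \<circ> dH) (axis a 1) $ i * L_deriv Hs (axis a 1) rstar l $ j $ k)) p q s =
    - pair q (lie_br G (sharp (R + rstar l) p) (sharp (R + rstar l) s)) + con2 (L_deriv Hs (hscomp (dKT p)) rstar l) q s"
proof -
  have "hscomp (dKT p) = (\<chi> a. pair p ((dK \<circ> dH) (axis a 1)))" by (simp add: hscomp_def pair_dK)
  hence "(\<Sum>a\<in>UNIV. pair p ((dK \<circ> dH) (axis a 1)) * con2 (L_deriv Hs (axis a 1) rstar l) q s) = con2 (L_deriv Hs (hscomp (dKT p)) rstar l) q s"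
    using Hs.con2_L_deriv(4)[OF reg, of "hscomp (dKT p)"] by simp
  thus ?thesis
    by (simp add: con3_add con3_outer G.con3_br12_23 rsharp_antisym antisym2_add R_antisym rstar_antisym[OF l] G.lie_br_minus_right)
qed

text \<open>Up to a term with vanishing cyclic sum, the two Yang-Baxter expressions differ by one summand of
  \<open>manin_cyclic_identity\<close>.\<close>

lemma cdybe_difference:
  fixes p q s :: "'k^'n"
  assumes l: "l \<in> V" and reg: "regular_at (atlas Ks) r l" "regular_at (atlas Hs) rstar l"
  defines "x \<equiv> \<lambda>p. - rs l (dKT p)"
  shows "(- pair q (lie_br G (sharp (R + rstar l) p) (sharp (R + rstar l) s)) + con2 (L_deriv Hs (hscomp (dKT p)) rstar l) q s)
      - (- pair q (lie_br G (sharp (R + r l) p) (sharp (R + r l) s)) + con2 (L_deriv Ks (dKT p) r l) q s) =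
    pair q (lie_br G (sharp (R + r l) p) (dK (x s))) - pair s (lie_br G (sharp (R + r l) q) (dK (x p)))
    + (pair (lie_br Ks (dKT q) (dKT s)) (x p) - pair (dKT q) (lie_br K (x p) (x s))
      - dpair (vjoin (x s) (mscomp (dKT s))) (lie_br D (vjoin 0 (dHs (hscomp (dKT p)))) (vjoin (x q) (mscomp (dKT q)))))"
proof -
  let ?dp = "dpair (vjoin (x s) (mscomp (dKT s))) (lie_br D (vjoin 0 (dHs (hscomp (dKT p)))) (vjoin (x q) (mscomp (dKT q))))"
  have sh: "sharp (R + rstar l) p = sharp (R + r l) p - dK (x p)" for p
    by (simp add: rstar_eq[OF V_carrier[OF l]] sharp_add sharp_rho x_def klinear_minus[OF dK_linear])
  have L1: "con2 (L_deriv Hs (hscomp (dKT p)) rstar l) q s = con2 (L_deriv Ks (dHs (hscomp (dKT p))) r l) q s - ?dp"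
    using L_deriv_rstar[OF l reg rs_deriv[OF l]] by (simp add: x_def)
  have "dKT p = dHs (hscomp (dKT p)) + mscomp (dKT p)" by (simp add: mscomp_def)
  hence "con2 (L_deriv Ks (dKT p) r l) q s =
      con2 (L_deriv Ks (dHs (hscomp (dKT p))) r l) q s + con2 (L_deriv Ks (mscomp (dKT p)) r l) q s"
    using Ks.con2_L_deriv(2)[OF reg(1), of "dHs (hscomp (dKT p))" "mscomp (dKT p)"] by simp
  also have "con2 (L_deriv Ks (mscomp (dKT p)) r l) q s = - con2 (ad2 G (dK (x p)) (r l)) q s"
    by (simp add: L_deriv_mstar[OF l reg(1)] x_def klinear_minus[OF dK_linear] G.con2_ad2 G.lie_br_minus_left)
  also have "- con2 (ad2 G (dK (x p)) (r l)) q s =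
      pair q (lie_br G (dK (x p)) (sharp (r l) s)) - pair s (lie_br G (dK (x p)) (sharp (r l) q))"
    by (simp add: G.con2_ad2_antisym r_antisym[OF l])
  finally have L2: "con2 (L_deriv Ks (dKT p) r l) q s = con2 (L_deriv Ks (dHs (hscomp (dKT p))) r l) q s +
      (pair q (lie_br G (dK (x p)) (sharp (r l) s)) - pair s (lie_br G (dK (x p)) (sharp (r l) q)))" .
  \<comment> \<open>Through the cobracket the terms with R become a bracket in k*, the form in which
    they enter the isotropy condition.\<close>
  have L3: "pair (lie_br Ks (dKT q) (dKT s)) (x p) =
      pair q (lie_br G (dK (x p)) (sharp R s)) - pair s (lie_br G (dK (x p)) (sharp R q))"
  proof -
    have "pair (lie_br Ks (dKT q) (dKT s)) (x p) = - con2 (ad2 G (dK (x p)) R) q s"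
      by (simp only: cobracket minus_minus)
    thus ?thesis by (simp add: G.con2_ad2_antisym R_antisym)
  qed
  have L4: "pair (dKT q) (lie_br K (x p) (x s)) = pair q (lie_br G (dK (x p)) (dK (x s)))"
    by (simp add: pair_dK flip: dK_br)
  have L5: "pair s (lie_br G (sharp (R + r l) q) (dK (x p))) =
      - pair s (lie_br G (dK (x p)) (sharp R q)) - pair s (lie_br G (dK (x p)) (sharp (r l) q))"
    by (subst G.lie_br_antisym) (simp add: sharp_add G.lie_br_add_right)
  show ?thesis unfolding sh L1 L2 L3 L4 L5 diff_conv_add_uminus G.lie_br_add_left G.lie_br_add_right
      G.lie_br_minus_left G.lie_br_minus_right
    by (simp add: sharp_add G.lie_br_add_right G.lie_br_add_left algebra_simps)
qed

text \<open>In \<open>cdybe_difference\<close> the first two terms have the form A(p, q, s) - A(q,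
  s, p), so they telescope in the cyclic sum. The rest is \<open>manin_cyclic_identity\<close> for
  the points of Ad l m belonging to the restrictions of p, q and s.\<close>

lemma rstar_cdybe:
  assumes l: "l \<in> V" and reg: "regular_at (atlas Ks) r l" "regular_at (atlas Hs) rstar l"
  shows "cyc3 (br12_23 G (R + rstar l) (R + rstar l) +
     (\<chi> i j k. \<Sum>a\<in>UNIV. (dK \<circ> dH) (axis a 1) $ i * L_deriv Hs (axis a 1) rstar l $ j $ k)) = I"
proof (rule con3_eqI)
  fix p q s :: "'k^'n"
  let ?x = "\<lambda>p. - rs l (dKT p)"
  have iso: "dpair (vjoin (?x p) (mscomp (dKT p))) (lie_br D (vjoin (?x q) (mscomp (dKT q))) (vjoin (?x s) (mscomp (dKT s)))) = 0"
  proof -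
    obtain P where P: "AdL l (vjoin P 0) = vjoin (?x p) (mscomp (dKT p))" using rs_graph[OF l] by metis
    obtain Q where Q: "AdL l (vjoin Q 0) = vjoin (?x q) (mscomp (dKT q))" using rs_graph[OF l] by metis
    obtain S where S: "AdL l (vjoin S 0) = vjoin (?x s) (mscomp (dKT s))" using rs_graph[OF l] by metis
    show ?thesis using AdL_isotropic[OF V_carrier[OF l], of P Q S] by (simp only: P Q S)
  qed
  have m: "?x p \<in> \<mm>" for p using rs_in[OF l, of "dKT p"] by (simp add: mm_iff klinear_minus[OF hcomp_linear])
  have dec: "dKT p = dHs (hscomp (dKT p)) + mscomp (dKT p)" for p by (simp add: mscomp_def)
  note core = manin_cyclic_identity[OF iso m m m dec dec dec]
  have K: "con3 I p q s =
    (- pair q (lie_br G (sharp (R + r l) p) (sharp (R + r l) s)) + con2 (L_deriv Ks (dKT p) r l) q s) +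
    (- pair s (lie_br G (sharp (R + r l) q) (sharp (R + r l) p)) + con2 (L_deriv Ks (dKT q) r l) s p) +
    (- pair p (lie_br G (sharp (R + r l) s) (sharp (R + r l) q)) + con2 (L_deriv Ks (dKT s) r l) p q)"
    unfolding r_cdybe[OF l reg(1), symmetric] con3_cyc3 con3_cdybe_K[OF l reg(1)] ..
  show "con3 (cyc3 (br12_23 G (R + rstar l) (R + rstar l) +
     (\<chi> i j k. \<Sum>a\<in>UNIV. (dK \<circ> dH) (axis a 1) $ i * L_deriv Hs (axis a 1) rstar l $ j $ k))) p q s = con3 I p q s"
    unfolding con3_cyc3 con3_cdybe_H[OF l reg(2)] K
    \<comment> \<open>The three cyclic instances; \<open>of\<close> takes the variables in their
      order of occurrence q, p, s.\<close>
    using cdybe_difference[OF l reg, of q p s] cdybe_difference[OF l reg, of s q p] cdybe_difference[OF l reg, of p s q] core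
    by (simp only: eq_diff_eq diff_eq_eq) (simp only: diff_conv_add_uminus ac_simps; simp add: algebra_simps)
qed

end

section \<open>Admissibility and the passage to points where r has a pole\<close>

lemma aopen_Int_INT:
  assumes "chart_inj A" "finite F" "aopen A S" "\<And>i. i \<in> F \<Longrightarrow> aopen A (W i)"
  shows "aopen A (S \<inter> (\<Inter>i\<in>F. W i))"
  using assms(2,4)
proof (induction F rule: finite_induct)
  case empty thus ?case using assms(3) by simp
next
  case (insert i F)
  have "S \<inter> (\<Inter>i\<in>insert i F. W i) = (S \<inter> (\<Inter>i\<in>F. W i)) \<inter> W i" by auto
  thus ?case using insert aopen_Int[OF assms(1)] by simp
qed

context reduction begin

lemma aopen_U: "aopen (atlas Ks) U"
  using r openin_mfd_top[OF Ks.inj_charts] by (simp add: triangular_PL_dynamical_r_matrix_def)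

lemma r_admissible: "admissible mode (atlas Ks) U (\<lambda>l. r l $ i $ j)"
  using r unfolding triangular_PL_dynamical_r_matrix_def by blast

lemma rho_smooth: "smooth_fun (atlas Hs) V (\<lambda>l. tmap2 dK (T l) $ i $ j)"
  unfolding tmap2_def vec_lambda_beta
  by (intro smooth_fun_sum smooth_fun_mult smooth_fun_const T_smooth)

lemma rstar_component: "l \<in> V \<Longrightarrow> rstar l $ i $ j = r l $ i $ j + tmap2 dK (T l) $ i $ j"
  by (simp add: rstar_eq V_carrier)

lemma rstar_admissible: "admissible mode (atlas Hs) V (\<lambda>l. rstar l $ i $ j)"
proof (cases mode)
  case Smooth
  hence rU: "smooth_fun (atlas Ks) U (\<lambda>l. r l $ i $ j)" using r_admissible[of i j] by (simp add: admissible_def)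
  have incl: "smooth_map (atlas Hs) V (atlas Ks) (\<lambda>l. l)"
    by (rule smooth_map_subset[OF Hs_incl_smooth Hs.inj_charts V]) (use V_carrier in blast)
  have "smooth_fun (atlas Hs) V (\<lambda>l. r l $ i $ j)"
    by (rule smooth_fun_compose[OF incl rU _ Hs.inj_charts Ks.inj_charts V aopen_U]) (use VU in blast)
  from smooth_fun_add[OF this rho_smooth]
  have "smooth_fun (atlas Hs) V (\<lambda>l. rstar l $ i $ j)"
    by (rule smooth_fun_cong[OF Hs.inj_charts V rstar_component[symmetric], rotated])
  thus ?thesis using Smooth by (simp add: admissible_def)
next
  case Meromorphic
  have "meromorphic_fun (atlas Hs) V (\<lambda>l. r l $ i $ j)"
    using restr Meromorphic by (simp add: restrictable_def)
  from meromorphic_fun_add_smooth[OF this rho_smooth rstar_component]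
  have "meromorphic_fun (atlas Hs) V (\<lambda>l. rstar l $ i $ j)" .
  moreover have "\<exists>i::'k. i * i = -1" using r_admissible Meromorphic by (simp add: admissible_def)
  ultimately show ?thesis using Meromorphic by (simp add: admissible_def)
qed

text \<open>A smooth r is regular everywhere; in the meromorphic case density is part of
  \<open>restrictable\<close>.\<close>

lemma regular_dense:
  assumes l: "l \<in> V" and W: "aopen (atlas Hs) W" "l \<in> W"
  obtains y where "y \<in> W" "y \<in> V" "regular_at (atlas Ks) r y"
proof (cases mode)
  case Smooth
  have "smooth_at (atlas Ks) (\<lambda>l. r l $ i $ j) l" for i j
  proof -
    have "smooth_fun (atlas Ks) U (\<lambda>l. r l $ i $ j)" using r_admissible[of i j] Smooth by (simp add: admissible_def)
    thus ?thesis using aopen_U VU l unfolding smooth_at_def openin_mfd_top[OF Ks.inj_charts] by blast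
  qed
  thus ?thesis using that[OF W(2) l] by (simp add: regular_at_def)
next
  case Meromorphic
  hence "l \<in> mfd_top (atlas Hs) closure_of {x \<in> V. regular_at (atlas Ks) r x}"
    using restr l unfolding restrictable_def by blast
  then obtain y where "y \<in> {x \<in> V. regular_at (atlas Ks) r x}" "y \<in> W"
    using W unfolding in_closure_of openin_mfd_top[OF Hs.inj_charts] by blast
  thus ?thesis using that by blast
qed

text \<open>A nonzero value of F would persist on an open set, and that set contains a point of V
  where r is regular.\<close>

lemma zero_by_density:
  fixes F :: "'s \<Rightarrow> 'k"
  assumes W: "aopen (atlas Hs) W" "l \<in> W" "l \<in> V" and F: "smooth_fun (atlas Hs) W F"
    and z: "\<And>y. y \<in> W \<Longrightarrow> y \<in> V \<Longrightarrow> regular_at (atlas Ks) r y \<Longrightarrow> F y = 0"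
  shows "F l = 0"
proof (rule ccontr)
  assume "F l \<noteq> 0"
  hence "l \<in> {y \<in> W. F y \<noteq> 0}" using W by simp
  from regular_dense[OF W(3) smooth_fun_nonzero_aopen[OF Hs.inj_charts W(1) F] this]
  obtain y where "y \<in> {y \<in> W. F y \<noteq> 0}" "y \<in> V" "regular_at (atlas Ks) r y" by blast
  thus False using z by blast
qed

text \<open>The direction may vary with the point, as it does for the dressing field. Linearity in
  the direction reduces this to the smooth gradient of f.\<close>

lemma L_deriv_smooth:
  assumes W: "aopen (atlas Hs) W" and f: "\<And>i j. smooth_fun (atlas Hs) W (\<lambda>l. f l $ i $ j)"
    and \<alpha>: "\<And>a. smooth_fun (atlas Hs) W (\<lambda>l. \<alpha> l $ a)"
  shows "smooth_fun (atlas Hs) W (\<lambda>l. L_deriv Hs (\<alpha> l) f l $ i $ j)"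
proof -
  obtain d where d: "\<And>x. x \<in> W \<Longrightarrow> kgrad (\<lambda>X. f (lexp Hs X \<otimes>\<^bsub>Hs\<^esub> x) $ i $ j) 0 (d x)"
    "\<And>a. smooth_fun (atlas Hs) W (\<lambda>x. d x $ a)"
    using Hs.left_translation_derivative[OF W f[of i j]] by blast
  have e: "(\<Sum>a\<in>UNIV. d l $ a * \<alpha> l $ a) = L_deriv Hs (\<alpha> l) f l $ i $ j" if "l \<in> W" for l
    using DERIV_imp_deriv[OF kgrad_line[OF d(1)[OF that], of "\<alpha> l"]] by (simp add: L_deriv_def)
  have "smooth_fun (atlas Hs) W (\<lambda>l. \<Sum>a\<in>UNIV. d l $ a * \<alpha> l $ a)"
    by (intro smooth_fun_sum smooth_fun_mult d \<alpha>)
  thus ?thesis by (rule smooth_fun_cong[OF Hs.inj_charts W e, rotated])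
qed

lemma dressing_field_smooth:
  assumes W: "aopen (atlas Hs) W"
  shows "smooth_fun (atlas Hs) W (\<lambda>l. Ad Hs l (vsnd (Ad DH (inv\<^bsub>DH\<^esub> (\<iota>Hs l)) A)) $ a)"
proof -
  have Wc: "W \<subseteq> carrier Hs" by (rule Hs.aopen_subset_carrier[OF W])
  have "smooth_map (atlas Hs) (carrier Hs) (atlas DH) \<iota>Hs" using Hs_in_DH by (simp add: lie_subgroup_def)
  hence im: "smooth_map (atlas Hs) W (atlas DH) (\<lambda>l. inv\<^bsub>DH\<^esub> (\<iota>Hs l))"
    by (intro DH.sm_inv Hs.inj_charts smooth_map_subset[OF _ Hs.inj_charts W Wc])
  have v: "smooth_fun (atlas Hs) W (\<lambda>l. Ad DH (inv\<^bsub>DH\<^esub> (\<iota>Hs l)) A $ c)" for c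
    by (rule smooth_fun_compose[OF im DH.Ad_smooth _ Hs.inj_charts DH.inj_charts W DH.aopen_carrier])
      (use Wc in auto)
  have e: "(\<Sum>b\<in>UNIV. Ad DH (inv\<^bsub>DH\<^esub> (\<iota>Hs l)) A $ Inr b * Ad Hs l (axis b 1) $ a) =
     Ad Hs l (vsnd (Ad DH (inv\<^bsub>DH\<^esub> (\<iota>Hs l)) A)) $ a" if "l \<in> W" for l
    using klinear_nth[OF Hs.Ad_linear, of l "vsnd (Ad DH (inv\<^bsub>DH\<^esub> (\<iota>Hs l)) A)" a] that Wc
    by (auto simp: vsnd_def)
  have "smooth_fun (atlas Hs) W (\<lambda>l. \<Sum>b\<in>UNIV. Ad DH (inv\<^bsub>DH\<^esub> (\<iota>Hs l)) A $ Inr b * Ad Hs l (axis b 1) $ a)"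
    by (intro smooth_fun_sum smooth_fun_mult v smooth_fun_subset[OF Hs.Ad_smooth Wc])
  thus ?thesis by (rule smooth_fun_cong[OF Hs.inj_charts W e, rotated])
qed

theorem rstar_triangular: "triangular_PL_dynamical_r_matrix mode G R I (dK \<circ> dH) Hs DH \<iota>Hs V rstar"
  unfolding triangular_PL_dynamical_r_matrix_def
proof (intro conjI ballI allI impI)
  show "openin (mfd_top (atlas Hs)) V" using V openin_mfd_top[OF Hs.inj_charts] by simp
  show "antisym2 (rstar l)" if "l \<in> V" for l by (rule rstar_antisym[OF that])
  show "admissible mode (atlas Hs) V (\<lambda>l. rstar l $ i $ j)" for i j by (rule rstar_admissible)
  fix l assume l: "l \<in> V" and reg: "regular_at (atlas Hs) rstar l"
  have "\<forall>ij. \<exists>W. aopen (atlas Hs) W \<and> l \<in> W \<and> smooth_fun (atlas Hs) W (\<lambda>y. rstar y $ fst ij $ snd ij)"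
    using reg unfolding regular_at_def smooth_at_def openin_mfd_top[OF Hs.inj_charts] by blast
  from choice[OF this] obtain W' where W': "\<And>ij. aopen (atlas Hs) (W' ij)" "\<And>ij. l \<in> W' ij"
    "\<And>ij. smooth_fun (atlas Hs) (W' ij) (\<lambda>y. rstar y $ fst ij $ snd ij)" by blast
  \<comment> \<open>Each entry of \<open>rstar\<close> has its own neighbourhood of regularity. On
    this finite intersection all entries are smooth, hence so are both sides of the two equations,
    and \<open>zero_by_density\<close> applies.\<close>
  define W where "W = V \<inter> (\<Inter>ij\<in>UNIV. W' ij)"
  have W: "aopen (atlas Hs) W" unfolding W_def by (rule aopen_Int_INT[OF Hs.inj_charts finite V W'(1)])
  have lW: "l \<in> W" using l W'(2) by (simp add: W_def)
  have sm: "smooth_fun (atlas Hs) W (\<lambda>y. rstar y $ i $ j)" for i j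
    using smooth_fun_subset[OF W'(3)[of "(i, j)"], of W] by (auto simp: W_def)
  have regW: "regular_at (atlas Hs) rstar y" if "y \<in> W" for y
    using W sm that unfolding regular_at_def smooth_at_def openin_mfd_top[OF Hs.inj_charts] by blast
  have Wc: "W \<subseteq> carrier Hs" by (rule Hs.aopen_subset_carrier[OF W])
  show "dress_deriv Hs DH \<iota>Hs X rstar l = ad2 G ((dK \<circ> dH) X) (rstar l)" for X
  proof -
    have "dress_deriv Hs DH \<iota>Hs X rstar l $ i $ j - ad2 G ((dK \<circ> dH) X) (rstar l) $ i $ j = 0" for i j
    proof (rule zero_by_density[OF W lW l])
      have e: "L_deriv Hs (Ad Hs y (vsnd (Ad DH (inv\<^bsub>DH\<^esub> (\<iota>Hs y)) (vjoin X 0)))) rstar y $ i $ j = dress_deriv Hs DH \<iota>Hs X rstar y $ i $ j"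
        if "y \<in> W" for y by (simp only: dress_deriv_Hs[OF subsetD[OF Wc that]])
      have "smooth_fun (atlas Hs) W (\<lambda>y. dress_deriv Hs DH \<iota>Hs X rstar y $ i $ j)"
        by (rule smooth_fun_cong[OF Hs.inj_charts W e L_deriv_smooth[OF W sm dressing_field_smooth[OF W]]])
      moreover have "smooth_fun (atlas Hs) W (\<lambda>y. ad2 G ((dK \<circ> dH) X) (rstar y) $ i $ j)"
        unfolding ad2_def vec_lambda_beta by (intro smooth_fun_add smooth_fun_sum smooth_fun_mult smooth_fun_const sm)
      ultimately show "smooth_fun (atlas Hs) W (\<lambda>y. dress_deriv Hs DH \<iota>Hs X rstar y $ i $ j - ad2 G ((dK \<circ> dH) X) (rstar y) $ i $ j)"
        by (rule smooth_fun_diff)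
    qed (simp add: rstar_dress regW)
    thus ?thesis by (simp add: vec_eq_iff)
  qed
  show "cyc3 (br12_23 G (R + rstar l) (R + rstar l) +
     (\<chi> i j k. \<Sum>a\<in>UNIV. (dK \<circ> dH) (axis a 1) $ i * L_deriv Hs (axis a 1) rstar l $ j $ k)) = I"
  proof -
    have "cyc3 (br12_23 G (R + rstar l) (R + rstar l) +
     (\<chi> i j k. \<Sum>a\<in>UNIV. (dK \<circ> dH) (axis a 1) $ i * L_deriv Hs (axis a 1) rstar l $ j $ k)) $ i $ j $ k - I $ i $ j $ k = 0" for i j k
    proof (rule zero_by_density[OF W lW l])
      show "smooth_fun (atlas Hs) W (\<lambda>y. cyc3 (br12_23 G (R + rstar y) (R + rstar y) +
         (\<chi> i j k. \<Sum>a\<in>UNIV. (dK \<circ> dH) (axis a 1) $ i * L_deriv Hs (axis a 1) rstar y $ j $ k)) $ i $ j $ k - I $ i $ j $ k)"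
        unfolding cyc3_def br12_23_def vec_lambda_beta vector_add_component
        by (intro smooth_fun_diff smooth_fun_add smooth_fun_sum smooth_fun_mult smooth_fun_const sm L_deriv_smooth[OF W])
    qed (simp only: rstar_cdybe regW diff_self)
    thus ?thesis by (simp add: vec_eq_iff)
  qed
qed

end

theorem corollary3p7:
  fixes G :: "('g, 'k::{real_normed_field,euclidean_space}, 'n::finite) lie_group_data"
    and K :: "('g, 'k, 'm::finite) lie_group_data"
    and H :: "('g, 'k, 'h::finite) lie_group_data"
    and Ks :: "('s, 'k, 'm) lie_group_data"
    and Hs :: "('s, 'k, 'h) lie_group_data"
    and D :: "('d, 'k, 'm + 'm) lie_group_data"
    and DH :: "('e, 'k, 'h + 'h) lie_group_data"
    and R :: "'k^'n^'n" and I :: "'k^'n^'n^'n"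
    and \<pi>\<^sub>K :: "'g \<Rightarrow> 'k^'m^'m" and \<pi>\<^sub>H :: "'g \<Rightarrow> 'k^'h^'h"
    and d\<^sub>K :: "'k^'m \<Rightarrow> 'k^'n" and d\<^sub>H :: "'k^'h \<Rightarrow> 'k^'m" and d\<^sub>H\<^sub>s :: "'k^'h \<Rightarrow> 'k^'m"
    and \<iota>\<^sub>K :: "'g \<Rightarrow> 'd" and \<iota>\<^sub>K\<^sub>s :: "'s \<Rightarrow> 'd"
    and \<iota>\<^sub>H :: "'g \<Rightarrow> 'e" and \<iota>\<^sub>H\<^sub>s :: "'s \<Rightarrow> 'e"
    and U V :: "'s set" and r :: "'s \<Rightarrow> 'k^'n^'n"
    and \<hh> \<mm> :: "('k^'m) set"
    and J :: "'i set" and M :: "'i \<Rightarrow> 'k^'m" and Cinv :: "'s \<Rightarrow> 'i \<Rightarrow> 'i \<Rightarrow> 'k"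
    and mode :: admissibility
  assumes G: "coboundary_PL_group G R I" "lie_connected G"
    and K: "PL_subgroup d\<^sub>K K \<pi>\<^sub>K G (coboundary_bivector G R)" "lie_connected K"
    and Ks: "dual_PL_group K \<pi>\<^sub>K Ks"
    and D: "drinfeld_double K Ks D \<iota>\<^sub>K \<iota>\<^sub>K\<^sub>s"
    and r: "triangular_PL_dynamical_r_matrix mode G R I d\<^sub>K Ks D \<iota>\<^sub>K\<^sub>s U r"
    and H: "PL_subgroup d\<^sub>H H \<pi>\<^sub>H K \<pi>\<^sub>K" "lie_connected H" "\<hh> = range d\<^sub>H"
    and m: "vec.subspace \<mm>" "\<hh> \<inter> \<mm> = {0}" "{X + Y | X Y. X \<in> \<hh> \<and> Y \<in> \<mm>} = UNIV"
    and hstar_subalgebra: "\<And>\<alpha> \<beta>. \<alpha> \<in> perp \<mm> \<Longrightarrow> \<beta> \<in> perp \<mm> \<Longrightarrow> lie_br Ks \<alpha> \<beta> \<in> perp \<mm>"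
    and hperp_ideal: "\<And>\<alpha> \<beta>. \<beta> \<in> perp \<hh> \<Longrightarrow> lie_br Ks \<alpha> \<beta> \<in> perp \<hh>"
    and reductive: "\<And>X Y. X \<in> \<hh> \<Longrightarrow> Y \<in> \<mm> \<Longrightarrow> lie_br K X Y \<in> \<mm>"
    and Hs: "lie_subgroup (\<lambda>x. x) d\<^sub>H\<^sub>s Hs Ks" "lie_connected Hs" "range d\<^sub>H\<^sub>s = perp \<mm>"
      "\<And>\<alpha> X. pair (d\<^sub>H\<^sub>s \<alpha>) (d\<^sub>H X) = pair \<alpha> X"
    and DH: "drinfeld_double H Hs DH \<iota>\<^sub>H \<iota>\<^sub>H\<^sub>s"
    and M: "finite J" "inj_on M J" "vec.independent (M ` J)" "vec.span (M ` J) = \<mm>"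
    and V: "openin (mfd_top (atlas Hs)) V" "V \<noteq> {}" "V \<subseteq> U"
      "restrictable mode (atlas Ks) (atlas Hs) V r"
    and C: "\<And>l. l \<in> V \<Longrightarrow> inverse_matrix_on J (C_matrix D \<iota>\<^sub>K\<^sub>s \<hh> \<mm> M l) (Cinv l)"
  shows "triangular_PL_dynamical_r_matrix mode G R I (d\<^sub>K \<circ> d\<^sub>H) Hs DH \<iota>\<^sub>H\<^sub>s V
    (\<lambda>l. r l + (\<Sum>i\<in>J. \<Sum>j\<in>J. tscale (Cinv l i j)
       (tensor (d\<^sub>K (m_part D \<iota>\<^sub>K\<^sub>s \<hh> \<mm> l (M i))) (d\<^sub>K (m_part D \<iota>\<^sub>K\<^sub>s \<hh> \<mm> l (M j))))))"
proof -
  note hh = H(3)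
  interpret reduction K H Ks Hs D DH d\<^sub>H d\<^sub>H\<^sub>s \<iota>\<^sub>K \<iota>\<^sub>K\<^sub>s \<iota>\<^sub>H \<iota>\<^sub>H\<^sub>s \<mm> J M Cinv V G R I d\<^sub>K \<pi>\<^sub>K U r mode
  proof (intro reduction.intro dynamical_data.intro reductive_data.intro dynamical_data_axioms.intro reduction_axioms.intro)
    show HK: "lie_subgroup (\<lambda>x. x) d\<^sub>H H K" using H(1) by (simp add: PL_subgroup_def)
    have "lie_group Hs" using Hs(1) by (simp add: lie_subgroup_def)
    hence "chart_inj (atlas Hs)" by (simp add: lie.inj_charts lie_def)
    thus "aopen (atlas Hs) V" using V(1) openin_mfd_top by blast
  qed (fact assms[unfolded hh])+
  show ?thesis using rstar_triangular unfolding rstar_def[abs_def] hh .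
qed

end
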